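(* Let $k$ be a commutative rig, let $!$ be a differential modality on a $k$-linear symmetric monoidal category $(\mathcal C,\otimes,I)$, and let $X\in\mathcal C$. Then $!$ lifts to a differential modality $!^X$ on the $k$-linear symmetric monoidal category $(\mathsf{CAct}[X],\boxtimes,(I,0))$ of commuting $X$-actions, where the functor $!^X$ is given by $!^X(A,\alpha)=(!A,\,!^X\alpha)$ with $$!^X\alpha=\mathsf d_A\circ(!A\otimes\alpha)\circ(\mathsf b_A\otimes X)\colon !A\otimes X\to !A,\qquad \mathsf b_A=(!A\otimes\varepsilon_A)\circ\Delta_A\colon !A\to !A\otimes A,$$ and by $f\mapsto !f$ on morphisms, and where the structural natural transformations $\varepsilon,\delta,\mathsf e,\Delta,\mathsf d$ of $!^X$ are lifts of those of $!$ (i.e. have the same underlying maps in $\mathcal C$).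
   Context: Associativity and unit constraints are suppressed; $\sigma$ is the symmetry. A commutative rig is a commutative "ring without negatives". A symmetric monoidal category is $k$-linear if each hom-set is a $k$-module and composition and tensor of morphisms are $k$-linear in each variable. A commuting $X$-action is a pair $(A,\alpha\colon A\otimes X\to A)$ with $\alpha\circ(\alpha\otimes X)\circ(A\otimes\sigma_{X,X})=\alpha\circ(\alpha\otimes X)$; a map $(A,\alpha)\to(B,\beta)$ is $f\colon A\to B$ with $f\circ\alpha=\beta\circ(f\otimes X)$. These form $\mathsf{CAct}[X]$, with symmetric monoidal structure: unit $(I,0\colon X\to I)$; tensor $(A,\alpha)\boxtimes(B,\beta)=(A\otimes B,\alpha\boxtimes\beta)$ with $\alpha\boxtimes\beta=(A\otimes\beta)+(\alpha\otimes B)\circ(A\otimes\sigma_{B,X})\colon A\otimes B\otimes X\to A\otimes B$; coherence constraints those of $\mathcal C$. A differential modality on $\mathcal C$ is a comonad $(!,\varepsilon,\delta)$ with natural maps $\mathsf e_X\colon !X\to I$, $\Delta_X\colon !X\to !X\otimes !X$ making each $!X$ a cocommutative comonoid such that each $\delta_X\colon !X\to !!X$ is a comonoid morphism, and with a natural family $\mathsf d_X\colon !X\otimes X\to !X$ satisfying - constant rule: $\mathsf e_X\circ\mathsf d_X=0$; - product rule: $\Delta_X\circ\mathsf d_X=\big[(!X\otimes\mathsf d_X)+(\mathsf d_X\otimes !X)\circ(!X\otimes\sigma_{!X,X})\big]\circ(\Delta_X\otimes X)$; - linear rule: $\varepsilon_X\circ\mathsf d_X=\mathsf e_X\otimes X$;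 - chain rule: $\delta_X\circ\mathsf d_X=\mathsf d_{!X}\circ(\delta_X\otimes\mathsf d_X)\circ(\Delta_X\otimes X)$; - interchange rule: $\mathsf d_X\circ(\mathsf d_X\otimes X)\circ(!X\otimes\sigma_{X,X})=\mathsf d_X\circ(\mathsf d_X\otimes X)$. *)

theory Defs
  imports Main
begin

section \<open>Symmetric monoidal categories\<close>

text \<open>
  A category is given by a set of objects and a family of hom-sets, one for each pair of objects.
  As in the hom-set presentation of categories, different hom-sets are not required to be
  disjoint: a morphism from \<open>A\<close> to \<open>B\<close> is an element of \<open>Hom A B\<close>, and all laws are stated for
  given source and target objects.  Every category whose arrows determine their source and target
  is an instance.  The operations on morphisms need no object arguments; hence a category of
  objects with extra structure can be given by restricting the hom-sets, so that a morphism and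
  its underlying map are the same element of the type \<open>'m\<close>.

  Monoidal structure is not assumed strict: associators and unitors are explicit, and come with
  explicit inverses.  Composition is written in the usual right-to-left order.
\<close>

record ('o, 'm) smc =
  Ob :: "'o set"
  Hom :: "'o \<Rightarrow> 'o \<Rightarrow> 'm set"
  ident :: "'o \<Rightarrow> 'm"  ("\<one>\<index> _" [90] 90)
  compose :: "'m \<Rightarrow> 'm \<Rightarrow> 'm"  (infixl "\<cdot>\<index>" 70)
  tensor_ob :: "'o \<Rightarrow> 'o \<Rightarrow> 'o"  (infixl "\<otimes>\<index>" 75)
  tensor_map :: "'m \<Rightarrow> 'm \<Rightarrow> 'm"  (infixl "\<star>\<index>" 75)
  unit_ob :: "'o"  ("\<I>\<index>")
  assoc :: "'o \<Rightarrow> 'o \<Rightarrow> 'o \<Rightarrow> 'm"  ("\<a>\<index>")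
  assoc_inv :: "'o \<Rightarrow> 'o \<Rightarrow> 'o \<Rightarrow> 'm"  ("\<a>\<i>\<index>")
  lunit :: "'o \<Rightarrow> 'm"  ("\<l>\<index>")
  lunit_inv :: "'o \<Rightarrow> 'm"  ("\<l>\<i>\<index>")
  runit :: "'o \<Rightarrow> 'm"  ("\<r>\<index>")
  runit_inv :: "'o \<Rightarrow> 'm"  ("\<r>\<i>\<index>")
  symm :: "'o \<Rightarrow> 'o \<Rightarrow> 'm"  ("\<s>\<index>")

locale hom_category =
  fixes C :: "('o, 'm, 'z) smc_scheme" (structure)
  assumes ident_in: "A \<in> Ob C \<Longrightarrow> \<one> A \<in> Hom C A A"
    and comp_in: "\<lbrakk>A \<in> Ob C; B \<in> Ob C; E \<in> Ob C; f \<in> Hom C A B; g \<in> Hom C B E\<rbrakk>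
      \<Longrightarrow> g \<cdot> f \<in> Hom C A E"
    and comp_ident_right: "\<lbrakk>A \<in> Ob C; B \<in> Ob C; f \<in> Hom C A B\<rbrakk> \<Longrightarrow> f \<cdot> \<one> A = f"
    and comp_ident_left: "\<lbrakk>A \<in> Ob C; B \<in> Ob C; f \<in> Hom C A B\<rbrakk> \<Longrightarrow> \<one> B \<cdot> f = f"
    and comp_assoc: "\<lbrakk>A \<in> Ob C; B \<in> Ob C; E \<in> Ob C; F \<in> Ob C;
      f \<in> Hom C A B; g \<in> Hom C B E; h \<in> Hom C E F\<rbrakk> \<Longrightarrow> h \<cdot> g \<cdot> f = h \<cdot> (g \<cdot> f)"

locale sym_monoidal_category = hom_category +
  assumes unit_ob_in: "\<I> \<in> Ob C"
    and tensor_ob_in: "\<lbrakk>A \<in> Ob C; B \<in> Ob C\<rbrakk> \<Longrightarrow> A \<otimes> B \<in> Ob C"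
    and tensor_map_in: "\<lbrakk>A \<in> Ob C; B \<in> Ob C; A' \<in> Ob C; B' \<in> Ob C;
      f \<in> Hom C A B; f' \<in> Hom C A' B'\<rbrakk> \<Longrightarrow> f \<star> f' \<in> Hom C (A \<otimes> A') (B \<otimes> B')"
    and tensor_ident: "\<lbrakk>A \<in> Ob C; B \<in> Ob C\<rbrakk> \<Longrightarrow> \<one> A \<star> \<one> B = \<one> (A \<otimes> B)"
    and tensor_comp: "\<lbrakk>A \<in> Ob C; B \<in> Ob C; E \<in> Ob C; A' \<in> Ob C; B' \<in> Ob C; E' \<in> Ob C;
      f \<in> Hom C A B; g \<in> Hom C B E; f' \<in> Hom C A' B'; g' \<in> Hom C B' E'\<rbrakk>
      \<Longrightarrow> (g \<cdot> f) \<star> (g' \<cdot> f') = (g \<star> g') \<cdot> (f \<star> f')"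
    and assoc_in: "\<lbrakk>A \<in> Ob C; B \<in> Ob C; E \<in> Ob C\<rbrakk>
      \<Longrightarrow> \<a> A B E \<in> Hom C (A \<otimes> B \<otimes> E) (A \<otimes> (B \<otimes> E))"
    and assoc_inv_in: "\<lbrakk>A \<in> Ob C; B \<in> Ob C; E \<in> Ob C\<rbrakk>
      \<Longrightarrow> \<a>\<i> A B E \<in> Hom C (A \<otimes> (B \<otimes> E)) (A \<otimes> B \<otimes> E)"
    and assoc_inv_left: "\<lbrakk>A \<in> Ob C; B \<in> Ob C; E \<in> Ob C\<rbrakk>
      \<Longrightarrow> \<a>\<i> A B E \<cdot> \<a> A B E = \<one> (A \<otimes> B \<otimes> E)"
    and assoc_inv_right: "\<lbrakk>A \<in> Ob C; B \<in> Ob C; E \<in> Ob C\<rbrakk>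
      \<Longrightarrow> \<a> A B E \<cdot> \<a>\<i> A B E = \<one> (A \<otimes> (B \<otimes> E))"
    and assoc_natural: "\<lbrakk>A \<in> Ob C; B \<in> Ob C; E \<in> Ob C; A' \<in> Ob C; B' \<in> Ob C; E' \<in> Ob C;
      f \<in> Hom C A A'; g \<in> Hom C B B'; h \<in> Hom C E E'\<rbrakk>
      \<Longrightarrow> \<a> A' B' E' \<cdot> (f \<star> g \<star> h) = (f \<star> (g \<star> h)) \<cdot> \<a> A B E"
    and lunit_in: "A \<in> Ob C \<Longrightarrow> \<l> A \<in> Hom C (\<I> \<otimes> A) A"
    and lunit_inv_in: "A \<in> Ob C \<Longrightarrow> \<l>\<i> A \<in> Hom C A (\<I> \<otimes> A)"
    and lunit_inv_left: "A \<in> Ob C \<Longrightarrow> \<l>\<i> A \<cdot> \<l> A = \<one> (\<I> \<otimes> A)"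
    and lunit_inv_right: "A \<in> Ob C \<Longrightarrow> \<l> A \<cdot> \<l>\<i> A = \<one> A"
    and lunit_natural: "\<lbrakk>A \<in> Ob C; B \<in> Ob C; f \<in> Hom C A B\<rbrakk>
      \<Longrightarrow> \<l> B \<cdot> (\<one> \<I> \<star> f) = f \<cdot> \<l> A"
    and runit_in: "A \<in> Ob C \<Longrightarrow> \<r> A \<in> Hom C (A \<otimes> \<I>) A"
    and runit_inv_in: "A \<in> Ob C \<Longrightarrow> \<r>\<i> A \<in> Hom C A (A \<otimes> \<I>)"
    and runit_inv_left: "A \<in> Ob C \<Longrightarrow> \<r>\<i> A \<cdot> \<r> A = \<one> (A \<otimes> \<I>)"
    and runit_inv_right: "A \<in> Ob C \<Longrightarrow> \<r> A \<cdot> \<r>\<i> A = \<one> A"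
    and runit_natural: "\<lbrakk>A \<in> Ob C; B \<in> Ob C; f \<in> Hom C A B\<rbrakk>
      \<Longrightarrow> \<r> B \<cdot> (f \<star> \<one> \<I>) = f \<cdot> \<r> A"
    and pentagon: "\<lbrakk>A \<in> Ob C; B \<in> Ob C; E \<in> Ob C; F \<in> Ob C\<rbrakk>
      \<Longrightarrow> \<a> A B (E \<otimes> F) \<cdot> \<a> (A \<otimes> B) E F
        = (\<one> A \<star> \<a> B E F) \<cdot> \<a> A (B \<otimes> E) F \<cdot> (\<a> A B E \<star> \<one> F)"
    and triangle: "\<lbrakk>A \<in> Ob C; B \<in> Ob C\<rbrakk>
      \<Longrightarrow> (\<one> A \<star> \<l> B) \<cdot> \<a> A \<I> B = \<r> A \<star> \<one> B"
    and symm_in: "\<lbrakk>A \<in> Ob C; B \<in> Ob C\<rbrakk> \<Longrightarrow> \<s> A B \<in> Hom C (A \<otimes> B) (B \<otimes> A)"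
    and symm_natural: "\<lbrakk>A \<in> Ob C; B \<in> Ob C; A' \<in> Ob C; B' \<in> Ob C;
      f \<in> Hom C A A'; g \<in> Hom C B B'\<rbrakk> \<Longrightarrow> \<s> A' B' \<cdot> (f \<star> g) = (g \<star> f) \<cdot> \<s> A B"
    and symm_symm: "\<lbrakk>A \<in> Ob C; B \<in> Ob C\<rbrakk> \<Longrightarrow> \<s> B A \<cdot> \<s> A B = \<one> (A \<otimes> B)"
    and hexagon: "\<lbrakk>A \<in> Ob C; B \<in> Ob C; E \<in> Ob C\<rbrakk>
      \<Longrightarrow> \<a> B E A \<cdot> \<s> A (B \<otimes> E) \<cdot> \<a> A B E
        = (\<one> B \<star> \<s> A E) \<cdot> \<a> B A E \<cdot> (\<s> A B \<star> \<one> E)"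

text \<open>
  The map \<open>A \<otimes> B \<otimes> E \<rightarrow> A \<otimes> E \<otimes> B\<close> exchanging the last two factors; it is \<open>A \<otimes> \<sigma>\<close> once
  associativity constraints are suppressed.
\<close>

definition exch :: "('o, 'm, 'z) smc_scheme \<Rightarrow> 'o \<Rightarrow> 'o \<Rightarrow> 'o \<Rightarrow> 'm" ("\<x>\<index>")
  where "\<x>\<^bsub>C\<^esub> A B E =
    \<a>\<i>\<^bsub>C\<^esub> A E B \<cdot>\<^bsub>C\<^esub> (\<one>\<^bsub>C\<^esub> A \<star>\<^bsub>C\<^esub> \<s>\<^bsub>C\<^esub> B E) \<cdot>\<^bsub>C\<^esub> \<a>\<^bsub>C\<^esub> A B E"


section \<open>Linear structure\<close>

text \<open>
  Since hom-sets may overlap, the zero morphism depends on its source and target.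
  A commutative rig is a type of sort \<open>{comm_semiring_0, comm_monoid_mult}\<close>.  The class
  \<open>comm_semiring_1\<close> is not used because it excludes the trivial rig.
\<close>

record ('o, 'm, 'k) linear_smc = "('o, 'm) smc" +
  add_map :: "'m \<Rightarrow> 'm \<Rightarrow> 'm"  (infixl "\<oplus>\<index>" 65)
  zero_map :: "'o \<Rightarrow> 'o \<Rightarrow> 'm"  ("\<zero>\<index>")
  scale_map :: "'k \<Rightarrow> 'm \<Rightarrow> 'm"  (infixr "\<odot>\<index>" 80)

locale linear_sym_monoidal_category = sym_monoidal_category C
  for C :: "('o, 'm, 'k :: {comm_semiring_0, comm_monoid_mult}, 'z) linear_smc_scheme" (structure) +
  assumes add_in: "\<lbrakk>A \<in> Ob C; B \<in> Ob C; f \<in> Hom C A B; g \<in> Hom C A B\<rbrakk> \<Longrightarrow> f \<oplus> g \<in> Hom C A B"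
    and zero_in: "\<lbrakk>A \<in> Ob C; B \<in> Ob C\<rbrakk> \<Longrightarrow> \<zero> A B \<in> Hom C A B"
    and scale_in: "\<lbrakk>A \<in> Ob C; B \<in> Ob C; f \<in> Hom C A B\<rbrakk> \<Longrightarrow> r \<odot> f \<in> Hom C A B"
    and add_assoc: "\<lbrakk>A \<in> Ob C; B \<in> Ob C; f \<in> Hom C A B; g \<in> Hom C A B; h \<in> Hom C A B\<rbrakk>
      \<Longrightarrow> f \<oplus> g \<oplus> h = f \<oplus> (g \<oplus> h)"
    and add_commute: "\<lbrakk>A \<in> Ob C; B \<in> Ob C; f \<in> Hom C A B; g \<in> Hom C A B\<rbrakk> \<Longrightarrow> f \<oplus> g = g \<oplus> f"
    and add_zero: "\<lbrakk>A \<in> Ob C; B \<in> Ob C; f \<in> Hom C A B\<rbrakk> \<Longrightarrow> f \<oplus> \<zero> A B = f"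
    and scale_add: "\<lbrakk>A \<in> Ob C; B \<in> Ob C; f \<in> Hom C A B; g \<in> Hom C A B\<rbrakk>
      \<Longrightarrow> r \<odot> (f \<oplus> g) = r \<odot> f \<oplus> r \<odot> g"
    and scale_zero: "\<lbrakk>A \<in> Ob C; B \<in> Ob C\<rbrakk> \<Longrightarrow> r \<odot> \<zero> A B = \<zero> A B"
    and add_scale: "\<lbrakk>A \<in> Ob C; B \<in> Ob C; f \<in> Hom C A B\<rbrakk> \<Longrightarrow> (r + s) \<odot> f = r \<odot> f \<oplus> s \<odot> f"
    and zero_scale: "\<lbrakk>A \<in> Ob C; B \<in> Ob C; f \<in> Hom C A B\<rbrakk> \<Longrightarrow> 0 \<odot> f = \<zero> A B"
    and mult_scale: "\<lbrakk>A \<in> Ob C; B \<in> Ob C; f \<in> Hom C A B\<rbrakk> \<Longrightarrow> (r * s) \<odot> f = r \<odot> s \<odot> f"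
    and one_scale: "\<lbrakk>A \<in> Ob C; B \<in> Ob C; f \<in> Hom C A B\<rbrakk> \<Longrightarrow> 1 \<odot> f = f"
    and comp_add_left: "\<lbrakk>A \<in> Ob C; B \<in> Ob C; E \<in> Ob C; f \<in> Hom C A B; g \<in> Hom C B E; g' \<in> Hom C B E\<rbrakk>
      \<Longrightarrow> (g \<oplus> g') \<cdot> f = g \<cdot> f \<oplus> g' \<cdot> f"
    and comp_add_right: "\<lbrakk>A \<in> Ob C; B \<in> Ob C; E \<in> Ob C; f \<in> Hom C A B; f' \<in> Hom C A B; g \<in> Hom C B E\<rbrakk>
      \<Longrightarrow> g \<cdot> (f \<oplus> f') = g \<cdot> f \<oplus> g \<cdot> f'"
    and comp_scale_left: "\<lbrakk>A \<in> Ob C; B \<in> Ob C; E \<in> Ob C; f \<in> Hom C A B; g \<in> Hom C B E\<rbrakk>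
      \<Longrightarrow> (r \<odot> g) \<cdot> f = r \<odot> (g \<cdot> f)"
    and comp_scale_right: "\<lbrakk>A \<in> Ob C; B \<in> Ob C; E \<in> Ob C; f \<in> Hom C A B; g \<in> Hom C B E\<rbrakk>
      \<Longrightarrow> g \<cdot> (r \<odot> f) = r \<odot> (g \<cdot> f)"
    and tensor_add_left: "\<lbrakk>A \<in> Ob C; B \<in> Ob C; A' \<in> Ob C; B' \<in> Ob C;
      f \<in> Hom C A B; g \<in> Hom C A B; h \<in> Hom C A' B'\<rbrakk> \<Longrightarrow> (f \<oplus> g) \<star> h = f \<star> h \<oplus> g \<star> h"
    and tensor_add_right: "\<lbrakk>A \<in> Ob C; B \<in> Ob C; A' \<in> Ob C; B' \<in> Ob C;
      f \<in> Hom C A B; g \<in> Hom C A' B'; h \<in> Hom C A' B'\<rbrakk> \<Longrightarrow> f \<star> (g \<oplus> h) = f \<star> g \<oplus> f \<star> h"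
    and tensor_scale_left: "\<lbrakk>A \<in> Ob C; B \<in> Ob C; A' \<in> Ob C; B' \<in> Ob C;
      f \<in> Hom C A B; g \<in> Hom C A' B'\<rbrakk> \<Longrightarrow> (r \<odot> f) \<star> g = r \<odot> (f \<star> g)"
    and tensor_scale_right: "\<lbrakk>A \<in> Ob C; B \<in> Ob C; A' \<in> Ob C; B' \<in> Ob C;
      f \<in> Hom C A B; g \<in> Hom C A' B'\<rbrakk> \<Longrightarrow> f \<star> (r \<odot> g) = r \<odot> (f \<star> g)"


section \<open>Differential modalities\<close>

text \<open>
  The endofunctor of \<open>D\<close> is \<open>bang\<close> on objects and \<open>bang_map\<close> on morphisms.
\<close>

record ('o, 'm) modality =
  bang :: "'o \<Rightarrow> 'o"
  bang_map :: "'m \<Rightarrow> 'm"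
  counit :: "'o \<Rightarrow> 'm"
  comult :: "'o \<Rightarrow> 'm"
  discard :: "'o \<Rightarrow> 'm"
  copy :: "'o \<Rightarrow> 'm"
  deriving :: "'o \<Rightarrow> 'm"

locale functorial_comonad = hom_category C
  for C :: "('o, 'm, 'z) smc_scheme" (structure) and D :: "('o, 'm, 'y) modality_scheme" +
  assumes bang_in: "A \<in> Ob C \<Longrightarrow> bang D A \<in> Ob C"
    and bang_map_in: "\<lbrakk>A \<in> Ob C; B \<in> Ob C; f \<in> Hom C A B\<rbrakk>
      \<Longrightarrow> bang_map D f \<in> Hom C (bang D A) (bang D B)"
    and bang_ident: "A \<in> Ob C \<Longrightarrow> bang_map D (\<one> A) = \<one> (bang D A)"
    and bang_comp: "\<lbrakk>A \<in> Ob C; B \<in> Ob C; E \<in> Ob C; f \<in> Hom C A B; g \<in> Hom C B E\<rbrakk>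
      \<Longrightarrow> bang_map D (g \<cdot> f) = bang_map D g \<cdot> bang_map D f"
    and counit_in: "A \<in> Ob C \<Longrightarrow> counit D A \<in> Hom C (bang D A) A"
    and counit_natural: "\<lbrakk>A \<in> Ob C; B \<in> Ob C; f \<in> Hom C A B\<rbrakk>
      \<Longrightarrow> counit D B \<cdot> bang_map D f = f \<cdot> counit D A"
    and comult_in: "A \<in> Ob C \<Longrightarrow> comult D A \<in> Hom C (bang D A) (bang D (bang D A))"
    and comult_natural: "\<lbrakk>A \<in> Ob C; B \<in> Ob C; f \<in> Hom C A B\<rbrakk>
      \<Longrightarrow> comult D B \<cdot> bang_map D f = bang_map D (bang_map D f) \<cdot> comult D A"
    and comonad_unit_left: "A \<in> Ob C \<Longrightarrow> counit D (bang D A) \<cdot> comult D A = \<one> (bang D A)"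
    and comonad_unit_right: "A \<in> Ob C \<Longrightarrow> bang_map D (counit D A) \<cdot> comult D A = \<one> (bang D A)"
    and comonad_assoc: "A \<in> Ob C
      \<Longrightarrow> comult D (bang D A) \<cdot> comult D A = bang_map D (comult D A) \<cdot> comult D A"

locale coalgebra_modality = sym_monoidal_category C + functorial_comonad C D
  for C :: "('o, 'm, 'z) smc_scheme" (structure) and D :: "('o, 'm, 'y) modality_scheme" +
  assumes discard_in: "A \<in> Ob C \<Longrightarrow> discard D A \<in> Hom C (bang D A) \<I>"
    and discard_natural: "\<lbrakk>A \<in> Ob C; B \<in> Ob C; f \<in> Hom C A B\<rbrakk>
      \<Longrightarrow> discard D B \<cdot> bang_map D f = discard D A"
    and copy_in: "A \<in> Ob C \<Longrightarrow> copy D A \<in> Hom C (bang D A) (bang D A \<otimes> bang D A)"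
    and copy_natural: "\<lbrakk>A \<in> Ob C; B \<in> Ob C; f \<in> Hom C A B\<rbrakk>
      \<Longrightarrow> copy D B \<cdot> bang_map D f = (bang_map D f \<star> bang_map D f) \<cdot> copy D A"
    and comonoid_assoc: "A \<in> Ob C
      \<Longrightarrow> \<a> (bang D A) (bang D A) (bang D A) \<cdot> (copy D A \<star> \<one> (bang D A)) \<cdot> copy D A
        = (\<one> (bang D A) \<star> copy D A) \<cdot> copy D A"
    and comonoid_unit_left: "A \<in> Ob C
      \<Longrightarrow> \<l> (bang D A) \<cdot> (discard D A \<star> \<one> (bang D A)) \<cdot> copy D A = \<one> (bang D A)"
    and comonoid_unit_right: "A \<in> Ob C
      \<Longrightarrow> \<r> (bang D A) \<cdot> (\<one> (bang D A) \<star> discard D A) \<cdot> copy D A = \<one> (bang D A)"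
    and comonoid_commute: "A \<in> Ob C \<Longrightarrow> \<s> (bang D A) (bang D A) \<cdot> copy D A = copy D A"
    and comult_discard: "A \<in> Ob C \<Longrightarrow> discard D (bang D A) \<cdot> comult D A = discard D A"
    and comult_copy: "A \<in> Ob C
      \<Longrightarrow> copy D (bang D A) \<cdot> comult D A = (comult D A \<star> comult D A) \<cdot> copy D A"

locale differential_modality = linear_sym_monoidal_category C + coalgebra_modality C D
  for C :: "('o, 'm, 'k :: {comm_semiring_0, comm_monoid_mult}, 'z) linear_smc_scheme" (structure)
    and D :: "('o, 'm, 'y) modality_scheme" +
  assumes deriving_in: "A \<in> Ob C \<Longrightarrow> deriving D A \<in> Hom C (bang D A \<otimes> A) (bang D A)"
    and deriving_natural: "\<lbrakk>A \<in> Ob C; B \<in> Ob C; f \<in> Hom C A B\<rbrakk>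
      \<Longrightarrow> deriving D B \<cdot> (bang_map D f \<star> f) = bang_map D f \<cdot> deriving D A"
    and constant_rule: "A \<in> Ob C \<Longrightarrow> discard D A \<cdot> deriving D A = \<zero> (bang D A \<otimes> A) \<I>"
    and product_rule: "A \<in> Ob C \<Longrightarrow> copy D A \<cdot> deriving D A
      = ((\<one> (bang D A) \<star> deriving D A) \<cdot> \<a> (bang D A) (bang D A) A
          \<oplus> (deriving D A \<star> \<one> (bang D A)) \<cdot> \<x> (bang D A) (bang D A) A)
        \<cdot> (copy D A \<star> \<one> A)"
    and linear_rule: "A \<in> Ob C \<Longrightarrow> counit D A \<cdot> deriving D A = \<l> A \<cdot> (discard D A \<star> \<one> A)"
    and chain_rule: "A \<in> Ob C \<Longrightarrow> comult D A \<cdot> deriving D A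
      = deriving D (bang D A) \<cdot> (comult D A \<star> deriving D A)
        \<cdot> \<a> (bang D A) (bang D A) A \<cdot> (copy D A \<star> \<one> A)"
    and interchange_rule: "A \<in> Ob C
      \<Longrightarrow> deriving D A \<cdot> (deriving D A \<star> \<one> A) \<cdot> \<x> (bang D A) A A
        = deriving D A \<cdot> (deriving D A \<star> \<one> A)"


section \<open>Commuting actions\<close>

definition commuting_actions :: "('o, 'm, 'z) smc_scheme \<Rightarrow> 'o \<Rightarrow> ('o \<times> 'm) set"
  where "commuting_actions C X = {(A, \<alpha>). A \<in> Ob C \<and> \<alpha> \<in> Hom C (A \<otimes>\<^bsub>C\<^esub> X) A \<and>
    \<alpha> \<cdot>\<^bsub>C\<^esub> (\<alpha> \<star>\<^bsub>C\<^esub> \<one>\<^bsub>C\<^esub> X) \<cdot>\<^bsub>C\<^esub> \<x>\<^bsub>C\<^esub> A X X = \<alpha> \<cdot>\<^bsub>C\<^esub> (\<alpha> \<star>\<^bsub>C\<^esub> \<one>\<^bsub>C\<^esub> X)}"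

definition action_maps :: "('o, 'm, 'z) smc_scheme \<Rightarrow> 'o \<Rightarrow> 'o \<times> 'm \<Rightarrow> 'o \<times> 'm \<Rightarrow> 'm set"
  where "action_maps C X = (\<lambda>(A, \<alpha>) (B, \<beta>).
    {f \<in> Hom C A B. f \<cdot>\<^bsub>C\<^esub> \<alpha> = \<beta> \<cdot>\<^bsub>C\<^esub> (f \<star>\<^bsub>C\<^esub> \<one>\<^bsub>C\<^esub> X)})"

definition action_tensor ::
    "('o, 'm, 'k, 'z) linear_smc_scheme \<Rightarrow> 'o \<Rightarrow> 'o \<times> 'm \<Rightarrow> 'o \<times> 'm \<Rightarrow> 'o \<times> 'm"
  where "action_tensor C X = (\<lambda>(A, \<alpha>) (B, \<beta>). (A \<otimes>\<^bsub>C\<^esub> B,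
    (\<one>\<^bsub>C\<^esub> A \<star>\<^bsub>C\<^esub> \<beta>) \<cdot>\<^bsub>C\<^esub> \<a>\<^bsub>C\<^esub> A B X \<oplus>\<^bsub>C\<^esub> (\<alpha> \<star>\<^bsub>C\<^esub> \<one>\<^bsub>C\<^esub> B) \<cdot>\<^bsub>C\<^esub> \<x>\<^bsub>C\<^esub> A B X))"

definition CAct :: "('o, 'm, 'k) linear_smc \<Rightarrow> 'o \<Rightarrow> ('o \<times> 'm, 'm, 'k) linear_smc"
  where "CAct C X = \<lparr>
    Ob = commuting_actions C X,
    Hom = action_maps C X,
    ident = (\<lambda>(A, \<alpha>). \<one>\<^bsub>C\<^esub> A),
    compose = compose C,
    tensor_ob = action_tensor C X,
    tensor_map = tensor_map C,
    unit_ob = (\<I>\<^bsub>C\<^esub>, \<zero>\<^bsub>C\<^esub> (\<I>\<^bsub>C\<^esub> \<otimes>\<^bsub>C\<^esub> X) \<I>\<^bsub>C\<^esub>),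
    assoc = (\<lambda>(A, \<alpha>) (B, \<beta>) (E, \<gamma>). \<a>\<^bsub>C\<^esub> A B E),
    assoc_inv = (\<lambda>(A, \<alpha>) (B, \<beta>) (E, \<gamma>). \<a>\<i>\<^bsub>C\<^esub> A B E),
    lunit = (\<lambda>(A, \<alpha>). \<l>\<^bsub>C\<^esub> A),
    lunit_inv = (\<lambda>(A, \<alpha>). \<l>\<i>\<^bsub>C\<^esub> A),
    runit = (\<lambda>(A, \<alpha>). \<r>\<^bsub>C\<^esub> A),
    runit_inv = (\<lambda>(A, \<alpha>). \<r>\<i>\<^bsub>C\<^esub> A),
    symm = (\<lambda>(A, \<alpha>) (B, \<beta>). \<s>\<^bsub>C\<^esub> A B),
    add_map = add_map C,
    zero_map = (\<lambda>(A, \<alpha>) (B, \<beta>). \<zero>\<^bsub>C\<^esub> A B),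
    scale_map = scale_map C\<rparr>"


section \<open>The lifted modality\<close>

definition borrow :: "('o, 'm, 'z) smc_scheme \<Rightarrow> ('o, 'm, 'y) modality_scheme \<Rightarrow> 'o \<Rightarrow> 'm"
  where "borrow C D A = (\<one>\<^bsub>C\<^esub> (bang D A) \<star>\<^bsub>C\<^esub> counit D A) \<cdot>\<^bsub>C\<^esub> copy D A"

definition bang_action ::
    "('o, 'm, 'z) smc_scheme \<Rightarrow> ('o, 'm, 'y) modality_scheme \<Rightarrow> 'o \<Rightarrow> 'o \<Rightarrow> 'm \<Rightarrow> 'm"
  where "bang_action C D X A \<alpha> = deriving D A \<cdot>\<^bsub>C\<^esub> (\<one>\<^bsub>C\<^esub> (bang D A) \<star>\<^bsub>C\<^esub> \<alpha>)
    \<cdot>\<^bsub>C\<^esub> \<a>\<^bsub>C\<^esub> (bang D A) A X \<cdot>\<^bsub>C\<^esub> (borrow C D A \<star>\<^bsub>C\<^esub> \<one>\<^bsub>C\<^esub> X)"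

definition lifted_modality ::
    "('o, 'm, 'z) smc_scheme \<Rightarrow> ('o, 'm) modality \<Rightarrow> 'o \<Rightarrow> ('o \<times> 'm, 'm) modality"
  where "lifted_modality C D X = \<lparr>
    bang = (\<lambda>(A, \<alpha>). (bang D A, bang_action C D X A \<alpha>)),
    bang_map = bang_map D,
    counit = (\<lambda>(A, \<alpha>). counit D A),
    comult = (\<lambda>(A, \<alpha>). comult D A),
    discard = (\<lambda>(A, \<alpha>). discard D A),
    copy = (\<lambda>(A, \<alpha>). copy D A),
    deriving = (\<lambda>(A, \<alpha>). deriving D A)\<rparr>"

end

theory Submission
  imports Defs
begin

text \<open>
  Almost everything in the statement is inherited: morphisms of actions are certain morphisms of
  \<open>C\<close>, with the operations of \<open>C\<close>, so that every equational law of a \<open>k\<close>-linear symmetric monoidal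
  category or of a differential modality holds for actions because it holds in \<open>C\<close>.  What has to be
  shown is closure: tensor products and \<open>!\<close> of commuting actions are commuting actions, and all the
  structural maps are morphisms of actions.

  For the tensor product this is bookkeeping with symmetries.  For \<open>!\<close>, write \<open>b = (1 \<otimes> \<epsilon>) \<Delta>\<close> for the
  map that borrows one argument; the lifted action \<open>!\<^sup>X\<alpha> = d (1 \<otimes> \<alpha>) (b \<otimes> X)\<close> borrows an argument, lets
  \<open>X\<close> act on it, and gives the result back.  The product and linear rules, with the counit law, give
  \<open>b d = 1 + (d \<otimes> 1) (1 \<otimes> \<sigma>) (b \<otimes> 1)\<close> (lemma \<open>der_bor\<close>): the argument borrowed after one has been given
  is either the given one or another one.  Acting twice is therefore a sum of two terms: both letters
  act on the same argument, which is symmetric in the letters because \<open>\<alpha>\<close> commutes, or they act on two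
  different ones, which is symmetric because \<open>\<Delta>\<close> is cocommutative and by the interchange rule
  (\<open>two_borrows_symmetric\<close>).  The same splitting, again with the interchange rule, makes \<open>d\<close> a map of
  actions.  For \<open>\<epsilon>\<close>, \<open>\<Delta>\<close>, \<open>e\<close> and \<open>\<delta>\<close> it suffices to apply the linear, product, constant and chain rule
  respectively to the final \<open>d\<close> of the lifted action and to rearrange the remaining comonoid structure.

  These are computations with string diagrams, whereas \<open>C\<close> is not strict.  The greater part of the
  text makes the passage between the two rigorous.  Finite lists of objects, with morphisms between
  their iterated tensor products, form a \<^emph>\<open>strict\<close> symmetric monoidal category; the main coherence
  fact behind this is \<open>flat_assoc\<close>.  A diagram is then a list of layers \<open>(i, F)\<close>, performed from left to
  right, each applying \<open>F\<close> to the consecutive entries of the current list that start at position \<open>i\<close>.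
  Diagrams that differ only in the order of independent layers have the same value (\<open>isotopy\<close>), which
  the simplifier checks by computing normal forms, and an equation between diagrams may be applied
  inside a larger one (\<open>deq_rewrite\<close>, \<open>dsum_rewrite\<close>).  The diagram proofs below are chains of such
  rewriting steps.
\<close>

section \<open>Typed arrows\<close>

text \<open>
  Hom-sets may overlap, so that an element of \<open>'m\<close> does not know its source and target.  Carrying them
  along turns the typing side conditions of all laws into equations between objects, which rewriting
  can decide.  The type of objects is a parameter because arrows between lists of objects are used as
  well.
\<close>

type_synonym ('a, 'm) arrow = "'a \<times> 'm \<times> 'a"

definition src :: "('a, 'm) arrow \<Rightarrow> 'a" where "src f = fst f"
definition mor :: "('a, 'm) arrow \<Rightarrow> 'm" where "mor f = fst (snd f)"
definition trg :: "('a, 'm) arrow \<Rightarrow> 'a" where "trg f = snd (snd f)"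

lemma arrow_sel [simp]: "src (A, m, B) = A" "mor (A, m, B) = m" "trg (A, m, B) = B"
  by (simp_all add: src_def mor_def trg_def)

lemma arrow_eqI: "src f = src g \<Longrightarrow> mor f = mor g \<Longrightarrow> trg f = trg g \<Longrightarrow> f = g"
  by (cases f; cases g) simp

context sym_monoidal_category
begin

definition comp_arr :: "('x, 'b) arrow \<Rightarrow> ('x, 'b) arrow \<Rightarrow> ('x, 'b) arrow"  (infixr "\<bullet>" 70)
  where "g \<bullet> f = (src f, mor g \<cdot> mor f, trg g)"

definition tens_arr :: "('a, 'b) arrow \<Rightarrow> ('a, 'b) arrow \<Rightarrow> ('a, 'b) arrow"  (infixr "\<diamond>" 75)
  where "f \<diamond> g = (src f \<otimes> src g, mor f \<star> mor g, trg f \<otimes> trg g)"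

definition is_arr :: "('a, 'b) arrow \<Rightarrow> bool"
  where "is_arr f \<longleftrightarrow> src f \<in> Ob C \<and> trg f \<in> Ob C \<and> mor f \<in> Hom C (src f) (trg f)"

definition idm where "idm A = (A, \<one> A, A)"
definition asc where "asc A B E = (A \<otimes> B \<otimes> E, \<a> A B E, A \<otimes> (B \<otimes> E))"
definition asc' where "asc' A B E = (A \<otimes> (B \<otimes> E), \<a>\<i> A B E, A \<otimes> B \<otimes> E)"
definition lu where "lu A = (\<I> \<otimes> A, \<l> A, A)"
definition lu' where "lu' A = (A, \<l>\<i> A, \<I> \<otimes> A)"
definition ru where "ru A = (A \<otimes> \<I>, \<r> A, A)"
definition ru' where "ru' A = (A, \<r>\<i> A, A \<otimes> \<I>)"
definition br where "br A B = (A \<otimes> B, \<s> A B, B \<otimes> A)"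

declare unit_ob_in [simp] tensor_ob_in [simp]

lemma src_comp [simp]: "src (g \<bullet> f) = src f" and trg_comp [simp]: "trg (g \<bullet> f) = trg g"
  and mor_comp [simp]: "mor (g \<bullet> f) = mor g \<cdot> mor f"
  by (simp_all add: comp_arr_def)

lemma src_tens [simp]: "src (f \<diamond> g) = src f \<otimes> src g"
  and trg_tens [simp]: "trg (f \<diamond> g) = trg f \<otimes> trg g"
  and mor_tens [simp]: "mor (f \<diamond> g) = mor f \<star> mor g"
  by (simp_all add: tens_arr_def)

lemma structural_sel [simp]:
  "src (idm A) = A" "trg (idm A) = A" "mor (idm A) = \<one> A"
  "src (asc A B E) = A \<otimes> B \<otimes> E" "trg (asc A B E) = A \<otimes> (B \<otimes> E)" "mor (asc A B E) = \<a> A B E"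
  "src (asc' A B E) = A \<otimes> (B \<otimes> E)" "trg (asc' A B E) = A \<otimes> B \<otimes> E" "mor (asc' A B E) = \<a>\<i> A B E"
  "src (lu A) = \<I> \<otimes> A" "trg (lu A) = A" "mor (lu A) = \<l> A"
  "src (lu' A) = A" "trg (lu' A) = \<I> \<otimes> A" "mor (lu' A) = \<l>\<i> A"
  "src (ru A) = A \<otimes> \<I>" "trg (ru A) = A" "mor (ru A) = \<r> A"
  "src (ru' A) = A" "trg (ru' A) = A \<otimes> \<I>" "mor (ru' A) = \<r>\<i> A"
  "src (br A B) = A \<otimes> B" "trg (br A B) = B \<otimes> A" "mor (br A B) = \<s> A B"
  by (simp_all add: idm_def asc_def asc'_def lu_def lu'_def ru_def ru'_def br_def)

lemma is_arr_ob: "is_arr f \<Longrightarrow> src f \<in> Ob C" "is_arr f \<Longrightarrow> trg f \<in> Ob C"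
  by (simp_all add: is_arr_def)

lemma is_arr_comp [simp]: "is_arr f \<Longrightarrow> is_arr g \<Longrightarrow> src g = trg f \<Longrightarrow> is_arr (g \<bullet> f)"
  using comp_in[of "src f" "trg f" "trg g" "mor f" "mor g"] by (simp add: is_arr_def)

lemma is_arr_tens [simp]: "is_arr f \<Longrightarrow> is_arr g \<Longrightarrow> is_arr (f \<diamond> g)"
  using tensor_map_in[of "src f" "trg f" "src g" "trg g" "mor f" "mor g"] by (simp add: is_arr_def)

lemma is_arr_structural [simp]:
  "A \<in> Ob C \<Longrightarrow> is_arr (idm A)"
  "A \<in> Ob C \<Longrightarrow> B \<in> Ob C \<Longrightarrow> E \<in> Ob C \<Longrightarrow> is_arr (asc A B E)"
  "A \<in> Ob C \<Longrightarrow> B \<in> Ob C \<Longrightarrow> E \<in> Ob C \<Longrightarrow> is_arr (asc' A B E)"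
  "A \<in> Ob C \<Longrightarrow> is_arr (lu A)"
  "A \<in> Ob C \<Longrightarrow> is_arr (lu' A)"
  "A \<in> Ob C \<Longrightarrow> is_arr (ru A)"
  "A \<in> Ob C \<Longrightarrow> is_arr (ru' A)"
  "A \<in> Ob C \<Longrightarrow> B \<in> Ob C \<Longrightarrow> is_arr (br A B)"
  by (simp_all add: is_arr_def ident_in assoc_in assoc_inv_in lunit_in lunit_inv_in runit_in
      runit_inv_in symm_in)

lemma comp_arr_assoc [simp]:
  "is_arr f \<Longrightarrow> is_arr g \<Longrightarrow> is_arr h \<Longrightarrow> src g = trg f \<Longrightarrow> src h = trg g
    \<Longrightarrow> (h \<bullet> g) \<bullet> f = h \<bullet> g \<bullet> f"
  using comp_assoc[of "src f" "trg f" "trg g" "trg h" "mor f" "mor g" "mor h"]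
  by (intro arrow_eqI) (simp_all add: is_arr_def)

lemma comp_arr_id [simp]:
  "is_arr f \<Longrightarrow> src f = A \<Longrightarrow> f \<bullet> idm A = f" "is_arr f \<Longrightarrow> trg f = A \<Longrightarrow> idm A \<bullet> f = f"
  using comp_ident_right[of "src f" "trg f" "mor f"] comp_ident_left[of "src f" "trg f" "mor f"]
  by (auto intro!: arrow_eqI simp: is_arr_def)

lemma tens_comp:
  "is_arr f \<Longrightarrow> is_arr g \<Longrightarrow> src g = trg f \<Longrightarrow> is_arr f' \<Longrightarrow> is_arr g' \<Longrightarrow> src g' = trg f'
    \<Longrightarrow> (g \<bullet> f) \<diamond> (g' \<bullet> f') = (g \<diamond> g') \<bullet> (f \<diamond> f')"
  using tensor_comp[of "src f" "trg f" "trg g" "src f'" "trg f'" "trg g'"]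
  by (intro arrow_eqI) (simp_all add: is_arr_def)

lemma tens_id [simp]: "A \<in> Ob C \<Longrightarrow> B \<in> Ob C \<Longrightarrow> idm A \<diamond> idm B = idm (A \<otimes> B)"
  by (intro arrow_eqI) (simp_all add: tensor_ident)

lemma tens_comp_left:
  "is_arr f \<Longrightarrow> is_arr g \<Longrightarrow> src g = trg f \<Longrightarrow> A \<in> Ob C
    \<Longrightarrow> idm A \<diamond> (g \<bullet> f) = (idm A \<diamond> g) \<bullet> (idm A \<diamond> f)"
  using tens_comp[of "idm A" "idm A" f g] by simp

lemma tens_comp_right:
  "is_arr f \<Longrightarrow> is_arr g \<Longrightarrow> src g = trg f \<Longrightarrow> A \<in> Ob C
    \<Longrightarrow> (g \<bullet> f) \<diamond> idm A = (g \<diamond> idm A) \<bullet> (f \<diamond> idm A)"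
  using tens_comp[of f g "idm A" "idm A"] by simp

lemma structural_inverse [simp]:
  "A \<in> Ob C \<Longrightarrow> B \<in> Ob C \<Longrightarrow> E \<in> Ob C \<Longrightarrow> asc A B E \<bullet> asc' A B E = idm (A \<otimes> (B \<otimes> E))"
  "A \<in> Ob C \<Longrightarrow> B \<in> Ob C \<Longrightarrow> E \<in> Ob C \<Longrightarrow> asc' A B E \<bullet> asc A B E = idm (A \<otimes> B \<otimes> E)"
  "A \<in> Ob C \<Longrightarrow> lu A \<bullet> lu' A = idm A"
  "A \<in> Ob C \<Longrightarrow> lu' A \<bullet> lu A = idm (\<I> \<otimes> A)"
  "A \<in> Ob C \<Longrightarrow> ru A \<bullet> ru' A = idm A"
  "A \<in> Ob C \<Longrightarrow> ru' A \<bullet> ru A = idm (A \<otimes> \<I>)"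
  "A \<in> Ob C \<Longrightarrow> B \<in> Ob C \<Longrightarrow> br A B \<bullet> br B A = idm (B \<otimes> A)"
  by (rule arrow_eqI; simp add: assoc_inv_left assoc_inv_right lunit_inv_left lunit_inv_right
      runit_inv_left runit_inv_right symm_symm)+

lemma structural_inverse_reassoc [simp]:
  "A \<in> Ob C \<Longrightarrow> B \<in> Ob C \<Longrightarrow> E \<in> Ob C \<Longrightarrow> is_arr k \<Longrightarrow> trg k = A \<otimes> (B \<otimes> E)
    \<Longrightarrow> asc A B E \<bullet> asc' A B E \<bullet> k = k"
  "A \<in> Ob C \<Longrightarrow> B \<in> Ob C \<Longrightarrow> E \<in> Ob C \<Longrightarrow> is_arr k \<Longrightarrow> trg k = A \<otimes> B \<otimes> E
    \<Longrightarrow> asc' A B E \<bullet> asc A B E \<bullet> k = k"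
  "A \<in> Ob C \<Longrightarrow> is_arr k \<Longrightarrow> trg k = A \<Longrightarrow> lu A \<bullet> lu' A \<bullet> k = k"
  "A \<in> Ob C \<Longrightarrow> is_arr k \<Longrightarrow> trg k = \<I> \<otimes> A \<Longrightarrow> lu' A \<bullet> lu A \<bullet> k = k"
  "A \<in> Ob C \<Longrightarrow> is_arr k \<Longrightarrow> trg k = A \<Longrightarrow> ru A \<bullet> ru' A \<bullet> k = k"
  "A \<in> Ob C \<Longrightarrow> is_arr k \<Longrightarrow> trg k = A \<otimes> \<I> \<Longrightarrow> ru' A \<bullet> ru A \<bullet> k = k"
  "A \<in> Ob C \<Longrightarrow> B \<in> Ob C \<Longrightarrow> is_arr k \<Longrightarrow> trg k = B \<otimes> A \<Longrightarrow> br A B \<bullet> br B A \<bullet> k = k"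
  by (simp_all flip: comp_arr_assoc)

lemma asc_nat: "is_arr f \<Longrightarrow> is_arr g \<Longrightarrow> is_arr h
  \<Longrightarrow> asc (trg f) (trg g) (trg h) \<bullet> ((f \<diamond> g) \<diamond> h) = (f \<diamond> g \<diamond> h) \<bullet> asc (src f) (src g) (src h)"
  using assoc_natural[of "src f" "src g" "src h" "trg f" "trg g" "trg h"]
  by (intro arrow_eqI) (simp_all add: is_arr_def)

lemma lu_nat: "is_arr f \<Longrightarrow> lu (trg f) \<bullet> (idm \<I> \<diamond> f) = f \<bullet> lu (src f)"
  using lunit_natural[of "src f" "trg f"] by (intro arrow_eqI) (simp_all add: is_arr_def)

lemma ru_nat: "is_arr f \<Longrightarrow> ru (trg f) \<bullet> (f \<diamond> idm \<I>) = f \<bullet> ru (src f)"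
  using runit_natural[of "src f" "trg f"] by (intro arrow_eqI) (simp_all add: is_arr_def)

lemma br_nat: "is_arr f \<Longrightarrow> is_arr g
  \<Longrightarrow> br (trg f) (trg g) \<bullet> (f \<diamond> g) = (g \<diamond> f) \<bullet> br (src f) (src g)"
  using symm_natural[of "src f" "src g" "trg f" "trg g"]
  by (intro arrow_eqI) (simp_all add: is_arr_def)

text \<open>
  Not earlier: once \<open>is_arr\<close> is unfolded, these rules send the simplifier back to \<open>is_arr\<close>.
\<close>

declare is_arr_ob [simp]

lemma pentagon_arr:
  assumes "A \<in> Ob C" "B \<in> Ob C" "E \<in> Ob C" "F \<in> Ob C"
  shows "asc A B (E \<otimes> F) \<bullet> asc (A \<otimes> B) E F
    = (idm A \<diamond> asc B E F) \<bullet> asc A (B \<otimes> E) F \<bullet> (asc A B E \<diamond> idm F)"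
proof -
  have "asc A B (E \<otimes> F) \<bullet> asc (A \<otimes> B) E F
    = ((idm A \<diamond> asc B E F) \<bullet> asc A (B \<otimes> E) F) \<bullet> (asc A B E \<diamond> idm F)"
    by (rule arrow_eqI) (use assms in \<open>simp_all add: pentagon del: comp_arr_assoc\<close>)
  then show ?thesis using assms by simp
qed

lemma triangle_arr: "A \<in> Ob C \<Longrightarrow> B \<in> Ob C
  \<Longrightarrow> (idm A \<diamond> lu B) \<bullet> asc A \<I> B = ru A \<diamond> idm B"
  by (intro arrow_eqI) (simp_all add: triangle)

lemma hexagon_arr:
  assumes "A \<in> Ob C" "B \<in> Ob C" "E \<in> Ob C"
  shows "asc B E A \<bullet> br A (B \<otimes> E) \<bullet> asc A B E
    = (idm B \<diamond> br A E) \<bullet> asc B A E \<bullet> (br A B \<diamond> idm E)"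
proof -
  have "(asc B E A \<bullet> br A (B \<otimes> E)) \<bullet> asc A B E
    = ((idm B \<diamond> br A E) \<bullet> asc B A E) \<bullet> (br A B \<diamond> idm E)"
    by (rule arrow_eqI) (use assms in \<open>simp_all add: hexagon del: comp_arr_assoc\<close>)
  then show ?thesis using assms by simp
qed

end

section \<open>Coherence of the unit\<close>

context sym_monoidal_category
begin

text \<open>
  Composites are kept bracketed to the right; in this form an equation for \<open>g \<bullet> f\<close> also applies in front
  of further factors.
\<close>

lemma comp_reassoc:
  assumes "g \<bullet> f = h" "is_arr f" "is_arr g" "src g = trg f" "is_arr k" "trg k = src f"
  shows "g \<bullet> f \<bullet> k = h \<bullet> k"
  using assms comp_arr_assoc[of k f g] by simp

lemma comp_right_cancel:
  assumes "f \<bullet> i = g \<bullet> i" "i \<bullet> j = idm (trg i)" "is_arr f" "is_arr g" "is_arr i" "is_arr j"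
    "src f = trg i" "src g = trg i" "trg j = src i"
  shows "f = g"
proof -
  have "f = (f \<bullet> i) \<bullet> j" and "g = (g \<bullet> i) \<bullet> j"
    using assms(2-) by simp_all
  then show ?thesis using assms(1) by simp
qed

lemma comp_left_cancel:
  assumes "i \<bullet> f = i \<bullet> g" "j \<bullet> i = idm (src i)" "is_arr f" "is_arr g" "is_arr i" "is_arr j"
    "trg f = src i" "trg g = src i" "trg i = src j"
  shows "f = g"
proof -
  have "f = j \<bullet> i \<bullet> f" and "g = j \<bullet> i \<bullet> g"
    using assms(2-) by (simp_all flip: comp_arr_assoc)
  then show ?thesis using assms(1) by simp
qed

text \<open>
  Tensoring with the unit is faithful because the unitors are natural isomorphisms.
\<close>

lemma unit_tens_cancel:
  assumes "idm \<I> \<diamond> f = idm \<I> \<diamond> g" "is_arr f" "is_arr g" "src f = src g" "trg f = trg g"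
  shows "f = g"
proof (rule comp_right_cancel[where j = "lu' (src f)"])
  show "f \<bullet> lu (src f) = g \<bullet> lu (src f)"
    using lu_nat[of f] lu_nat[of g] assms by simp
qed (use assms in auto)

lemma tens_unit_cancel:
  assumes "f \<diamond> idm \<I> = g \<diamond> idm \<I>" "is_arr f" "is_arr g" "src f = src g" "trg f = trg g"
  shows "f = g"
proof (rule comp_right_cancel[where j = "ru' (src f)"])
  show "f \<bullet> ru (src f) = g \<bullet> ru (src f)"
    using ru_nat[of f] ru_nat[of g] assms by simp
qed (use assms in auto)

lemma whisker_inverse_right [simp]:
  assumes "A \<in> Ob C" "B \<in> Ob C" "E \<in> Ob C" "F \<in> Ob C"
  shows "(asc A B E \<diamond> idm F) \<bullet> (asc' A B E \<diamond> idm F) = idm (A \<otimes> (B \<otimes> E) \<otimes> F)"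
    and "(asc' A B E \<diamond> idm F) \<bullet> (asc A B E \<diamond> idm F) = idm (A \<otimes> B \<otimes> E \<otimes> F)"
  using assms by (simp_all flip: tens_comp_right)

text \<open>
  The axioms contain only the triangle with the unit in the middle.  This law and \<open>ru_tens\<close>
  are Kelly's: they follow from the pentagon with two unit entries after tensoring with \<open>\<I>\<close>, which
  is faithful.
\<close>

lemma lu_tens:
  assumes A: "A \<in> Ob C" and B: "B \<in> Ob C"
  shows "lu (A \<otimes> B) \<bullet> asc \<I> A B = lu A \<diamond> idm B"
proof (rule unit_tens_cancel)
  note [simp] = A B
  let ?k = "asc \<I> (\<I> \<otimes> A) B \<bullet> (asc \<I> \<I> A \<diamond> idm B)"
  show "idm \<I> \<diamond> (lu (A \<otimes> B) \<bullet> asc \<I> A B) = idm \<I> \<diamond> (lu A \<diamond> idm B)"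
  proof (rule comp_right_cancel)
    \<comment> \<open>\<open>?k\<close> is the isomorphism that completes the left-hand side to one side of the pentagon
        for \<open>\<I>, \<I>, A, B\<close>; it is cancelled in the end.\<close>
    have "(idm \<I> \<diamond> (lu (A \<otimes> B) \<bullet> asc \<I> A B)) \<bullet> ?k
      = (idm \<I> \<diamond> lu (A \<otimes> B)) \<bullet> (idm \<I> \<diamond> asc \<I> A B) \<bullet> ?k"
      by (simp add: tens_comp_left)
    also have "\<dots> = (idm \<I> \<diamond> lu (A \<otimes> B)) \<bullet> asc \<I> \<I> (A \<otimes> B) \<bullet> asc (\<I> \<otimes> \<I>) A B"
      by (simp add: pentagon_arr)
    also have "\<dots> = (ru \<I> \<diamond> idm (A \<otimes> B)) \<bullet> asc (\<I> \<otimes> \<I>) A B"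
      by (subst comp_reassoc[OF triangle_arr]) simp_all
    also have "\<dots> = asc \<I> A B \<bullet> ((ru \<I> \<diamond> idm A) \<diamond> idm B)"
      using asc_nat[of "ru \<I>" "idm A" "idm B"] by simp
    also have "\<dots> = asc \<I> A B \<bullet> ((idm \<I> \<diamond> lu A) \<diamond> idm B) \<bullet> (asc \<I> \<I> A \<diamond> idm B)"
      by (simp flip: triangle_arr tens_comp_right)
    also have "\<dots> = (idm \<I> \<diamond> (lu A \<diamond> idm B)) \<bullet> ?k"
      using comp_reassoc[OF asc_nat[of "idm \<I>" "lu A" "idm B"], of "asc \<I> \<I> A \<diamond> idm B"] by simp
    finally show "(idm \<I> \<diamond> (lu (A \<otimes> B) \<bullet> asc \<I> A B)) \<bullet> ?k
      = (idm \<I> \<diamond> (lu A \<diamond> idm B)) \<bullet> ?k" .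
    show "?k \<bullet> (asc' \<I> \<I> A \<diamond> idm B) \<bullet> asc' \<I> (\<I> \<otimes> A) B = idm (trg ?k)"
      by (simp add: comp_reassoc[OF whisker_inverse_right(1)])
  qed simp_all
qed (use A B in simp_all)

lemma ru_tens:
  assumes A: "A \<in> Ob C" and B: "B \<in> Ob C"
  shows "(idm A \<diamond> ru B) \<bullet> asc A B \<I> = ru (A \<otimes> B)"
proof (rule tens_unit_cancel)
  note [simp] = A B
  show "((idm A \<diamond> ru B) \<bullet> asc A B \<I>) \<diamond> idm \<I> = ru (A \<otimes> B) \<diamond> idm \<I>"
  proof (rule comp_left_cancel)
    have "asc A B \<I> \<bullet> (ru (A \<otimes> B) \<diamond> idm \<I>)
      = asc A B \<I> \<bullet> (idm (A \<otimes> B) \<diamond> lu \<I>) \<bullet> asc (A \<otimes> B) \<I> \<I>"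
      by (simp add: triangle_arr)
    also have "\<dots> = (idm A \<diamond> (idm B \<diamond> lu \<I>)) \<bullet> asc A B (\<I> \<otimes> \<I>) \<bullet> asc (A \<otimes> B) \<I> \<I>"
      using comp_reassoc[OF asc_nat[of "idm A" "idm B" "lu \<I>"], of "asc (A \<otimes> B) \<I> \<I>"] by simp
    also have "\<dots> = (idm A \<diamond> (idm B \<diamond> lu \<I>)) \<bullet> (idm A \<diamond> asc B \<I> \<I>) \<bullet> asc A (B \<otimes> \<I>) \<I>
        \<bullet> (asc A B \<I> \<diamond> idm \<I>)"
      by (simp add: pentagon_arr)
    also have "\<dots> = (idm A \<diamond> (ru B \<diamond> idm \<I>)) \<bullet> asc A (B \<otimes> \<I>) \<I> \<bullet> (asc A B \<I> \<diamond> idm \<I>)"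
      by (subst comp_reassoc[OF tens_comp_left[symmetric]]) (simp_all add: triangle_arr)
    also have "\<dots> = asc A B \<I> \<bullet> ((idm A \<diamond> ru B) \<diamond> idm \<I>) \<bullet> (asc A B \<I> \<diamond> idm \<I>)"
      using comp_reassoc[OF asc_nat[of "idm A" "ru B" "idm \<I>"], of "asc A B \<I> \<diamond> idm \<I>"] by simp
    also have "\<dots> = asc A B \<I> \<bullet> (((idm A \<diamond> ru B) \<bullet> asc A B \<I>) \<diamond> idm \<I>)"
      by (simp add: tens_comp_right)
    finally show "asc A B \<I> \<bullet> (((idm A \<diamond> ru B) \<bullet> asc A B \<I>) \<diamond> idm \<I>)
      = asc A B \<I> \<bullet> (ru (A \<otimes> B) \<diamond> idm \<I>)" ..
    show "asc' A B \<I> \<bullet> asc A B \<I> = idm (src (asc A B \<I>))" by simp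
  qed simp_all
qed (use A B in simp_all)

text \<open>
  After tensoring with \<open>\<I>\<close>, the triangle and \<open>lu_tens\<close> at \<open>A = B = \<I>\<close> compare the two sides, since
  \<open>lu (\<I> \<otimes> \<I>) = idm \<I> \<diamond> lu \<I>\<close> by naturality of \<open>lu\<close> at itself.
\<close>

lemma lu_unit_eq_ru_unit: "lu \<I> = ru \<I>"
proof (rule tens_unit_cancel)
  have "lu (\<I> \<otimes> \<I>) = idm \<I> \<diamond> lu \<I>"
  proof (rule comp_left_cancel)
    show "lu \<I> \<bullet> lu (\<I> \<otimes> \<I>) = lu \<I> \<bullet> (idm \<I> \<diamond> lu \<I>)"
      using lu_nat[of "lu \<I>"] by simp
    show "lu' \<I> \<bullet> lu \<I> = idm (src (lu \<I>))" by simp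
  qed simp_all
  then show "lu \<I> \<diamond> idm \<I> = ru \<I> \<diamond> idm \<I>"
    using lu_tens[of \<I> \<I>] triangle_arr[of \<I> \<I>] by simp
qed simp_all

text \<open>
  That the symmetry exchanges the unitors is not among the axioms.  It comes from the hexagon for
  \<open>A, \<I>, \<I>\<close>, again after tensoring with \<open>\<I>\<close>.
\<close>

lemma lu_br:
  assumes A: "A \<in> Ob C"
  shows "lu A \<bullet> br A \<I> = ru A"
proof (rule tens_unit_cancel)
  note [simp] = A
  show "(lu A \<bullet> br A \<I>) \<diamond> idm \<I> = ru A \<diamond> idm \<I>"
  proof (rule comp_left_cancel)
    have "br A \<I> \<bullet> (ru A \<diamond> idm \<I>) = br A \<I> \<bullet> (idm A \<diamond> lu \<I>) \<bullet> asc A \<I> \<I>"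
      by (simp add: triangle_arr)
    also have "\<dots> = (lu \<I> \<diamond> idm A) \<bullet> br A (\<I> \<otimes> \<I>) \<bullet> asc A \<I> \<I>"
      using comp_reassoc[OF br_nat[of "idm A" "lu \<I>"], of "asc A \<I> \<I>"] by simp
    also have "\<dots> = lu (\<I> \<otimes> A) \<bullet> asc \<I> \<I> A \<bullet> br A (\<I> \<otimes> \<I>) \<bullet> asc A \<I> \<I>"
      by (simp flip: lu_tens)
    also have "\<dots> = lu (\<I> \<otimes> A) \<bullet> (idm \<I> \<diamond> br A \<I>) \<bullet> asc \<I> A \<I> \<bullet> (br A \<I> \<diamond> idm \<I>)"
      by (simp add: hexagon_arr)
    also have "\<dots> = br A \<I> \<bullet> lu (A \<otimes> \<I>) \<bullet> asc \<I> A \<I> \<bullet> (br A \<I> \<diamond> idm \<I>)"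
      using comp_reassoc[OF lu_nat[of "br A \<I>"], of "asc \<I> A \<I> \<bullet> (br A \<I> \<diamond> idm \<I>)"] by simp
    also have "\<dots> = br A \<I> \<bullet> (lu A \<diamond> idm \<I>) \<bullet> (br A \<I> \<diamond> idm \<I>)"
      by (simp add: comp_reassoc[OF lu_tens])
    also have "\<dots> = br A \<I> \<bullet> ((lu A \<bullet> br A \<I>) \<diamond> idm \<I>)"
      by (simp add: tens_comp_right)
    finally show "br A \<I> \<bullet> ((lu A \<bullet> br A \<I>) \<diamond> idm \<I>) = br A \<I> \<bullet> (ru A \<diamond> idm \<I>)" ..
    show "br \<I> A \<bullet> br A \<I> = idm (src (br A \<I>))" by simp
  qed simp_all
qed (use A in simp_all)

end

section \<open>Tensor products of lists of objects\<close>

context sym_monoidal_category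
begin

text \<open>
  Lists are tensored with brackets to the left, as in \<open>A \<otimes> B \<otimes> E\<close>, and without a unit factor unless the
  list is empty.  In this way \<open>ob [A, B, X]\<close> is literally the source of an action on \<open>A \<otimes> B\<close>.  As the
  recursion removes the last factor, it runs over the reversed list.
\<close>

fun ob_rev :: "'a list \<Rightarrow> 'a" where
  "ob_rev [] = \<I>"
| "ob_rev [A] = A"
| "ob_rev (B # A # \<Gamma>) = ob_rev (A # \<Gamma>) \<otimes> B"

definition ob :: "'a list \<Rightarrow> 'a" where "ob \<Gamma> = ob_rev (rev \<Gamma>)"

text \<open>
  The comparison between appending an object and tensoring with it; it is an identity unless the list
  is empty.  With it, \<open>flat_rev\<close> needs no case distinction.
\<close>

definition snoc :: "'a list \<Rightarrow> 'a \<Rightarrow> ('a, 'b) arrow"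
  where "snoc \<Gamma> B = (if \<Gamma> = [] then lu B else idm (ob \<Gamma> \<otimes> B))"

definition snoc' :: "'a list \<Rightarrow> 'a \<Rightarrow> ('a, 'b) arrow"
  where "snoc' \<Gamma> B = (if \<Gamma> = [] then lu' B else idm (ob \<Gamma> \<otimes> B))"

text \<open>
  The structural isomorphism \<open>flat \<Gamma> \<Delta> : ob \<Gamma> \<otimes> ob \<Delta> \<rightarrow> ob (\<Gamma> @ \<Delta>)\<close>, with inverse \<open>flat'\<close>.
\<close>

fun flat_rev :: "'a list \<Rightarrow> 'a list \<Rightarrow> ('a, 'b) arrow" where
  "flat_rev \<Gamma> [] = ru (ob \<Gamma>)"
| "flat_rev \<Gamma> (B # \<Delta>) = snoc (\<Gamma> @ rev \<Delta>) B \<bullet> (flat_rev \<Gamma> \<Delta> \<diamond> idm B)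
    \<bullet> asc' (ob \<Gamma>) (ob (rev \<Delta>)) B \<bullet> (idm (ob \<Gamma>) \<diamond> snoc' (rev \<Delta>) B)"

fun flat'_rev :: "'a list \<Rightarrow> 'a list \<Rightarrow> ('a, 'b) arrow" where
  "flat'_rev \<Gamma> [] = ru' (ob \<Gamma>)"
| "flat'_rev \<Gamma> (B # \<Delta>) = (idm (ob \<Gamma>) \<diamond> snoc (rev \<Delta>) B) \<bullet> asc (ob \<Gamma>) (ob (rev \<Delta>)) B
    \<bullet> (flat'_rev \<Gamma> \<Delta> \<diamond> idm B) \<bullet> snoc' (\<Gamma> @ rev \<Delta>) B"

definition flat where "flat \<Gamma> \<Delta> = flat_rev \<Gamma> (rev \<Delta>)"
definition flat' where "flat' \<Gamma> \<Delta> = flat'_rev \<Gamma> (rev \<Delta>)"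

lemma ob_simps: "ob [] = \<I>" "ob [A] = A" "\<Gamma> \<noteq> [] \<Longrightarrow> ob (\<Gamma> @ [B]) = ob \<Gamma> \<otimes> B"
  by (simp_all add: ob_def) (cases "rev \<Gamma>"; simp)

lemma ob_in [simp]: "set \<Gamma> \<subseteq> Ob C \<Longrightarrow> ob \<Gamma> \<in> Ob C"
proof (induction \<Gamma> rule: rev_induct)
  case (snoc B \<Gamma>)
  then show ?case by (cases "\<Gamma> = []") (simp_all add: ob_simps)
qed (simp add: ob_simps)

lemma snoc_sel [simp]:
  "src (snoc \<Gamma> B) = ob \<Gamma> \<otimes> B" "trg (snoc \<Gamma> B) = ob (\<Gamma> @ [B])"
  "src (snoc' \<Gamma> B) = ob (\<Gamma> @ [B])" "trg (snoc' \<Gamma> B) = ob \<Gamma> \<otimes> B"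
  by (simp_all add: snoc_def snoc'_def ob_simps)

lemma is_arr_snoc [simp]:
  "set \<Gamma> \<subseteq> Ob C \<Longrightarrow> B \<in> Ob C \<Longrightarrow> is_arr (snoc \<Gamma> B)"
  "set \<Gamma> \<subseteq> Ob C \<Longrightarrow> B \<in> Ob C \<Longrightarrow> is_arr (snoc' \<Gamma> B)"
  by (simp_all add: snoc_def snoc'_def)

lemma snoc_inverse [simp]:
  "set \<Gamma> \<subseteq> Ob C \<Longrightarrow> B \<in> Ob C \<Longrightarrow> snoc \<Gamma> B \<bullet> snoc' \<Gamma> B = idm (ob (\<Gamma> @ [B]))"
  "set \<Gamma> \<subseteq> Ob C \<Longrightarrow> B \<in> Ob C \<Longrightarrow> snoc' \<Gamma> B \<bullet> snoc \<Gamma> B = idm (ob \<Gamma> \<otimes> B)"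
  by (simp_all add: snoc_def snoc'_def ob_simps)

lemma snoc_inverse_reassoc [simp]:
  assumes "set \<Gamma> \<subseteq> Ob C" "B \<in> Ob C" "is_arr k"
  shows "trg k = ob (\<Gamma> @ [B]) \<Longrightarrow> snoc \<Gamma> B \<bullet> snoc' \<Gamma> B \<bullet> k = k"
    and "trg k = ob \<Gamma> \<otimes> B \<Longrightarrow> snoc' \<Gamma> B \<bullet> snoc \<Gamma> B \<bullet> k = k"
  using assms by (simp_all flip: comp_arr_assoc)

lemma flat_Nil: "flat \<Gamma> [] = ru (ob \<Gamma>)" and flat'_Nil: "flat' \<Gamma> [] = ru' (ob \<Gamma>)"
  by (simp_all add: flat_def flat'_def)

lemma flat_snoc: "flat \<Gamma> (\<Delta> @ [B]) = snoc (\<Gamma> @ \<Delta>) B \<bullet> (flat \<Gamma> \<Delta> \<diamond> idm B)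
    \<bullet> asc' (ob \<Gamma>) (ob \<Delta>) B \<bullet> (idm (ob \<Gamma>) \<diamond> snoc' \<Delta> B)"
  and flat'_snoc: "flat' \<Gamma> (\<Delta> @ [B]) = (idm (ob \<Gamma>) \<diamond> snoc \<Delta> B) \<bullet> asc (ob \<Gamma>) (ob \<Delta>) B
    \<bullet> (flat' \<Gamma> \<Delta> \<diamond> idm B) \<bullet> snoc' (\<Gamma> @ \<Delta>) B"
  by (simp_all add: flat_def flat'_def)

lemma flat_sel [simp]:
  "src (flat \<Gamma> \<Delta>) = ob \<Gamma> \<otimes> ob \<Delta>" "trg (flat \<Gamma> \<Delta>) = ob (\<Gamma> @ \<Delta>)"
  "src (flat' \<Gamma> \<Delta>) = ob (\<Gamma> @ \<Delta>)" "trg (flat' \<Gamma> \<Delta>) = ob \<Gamma> \<otimes> ob \<Delta>"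
  by (cases \<Delta> rule: rev_cases; simp add: flat_Nil flat'_Nil flat_snoc flat'_snoc ob_simps)+

lemma is_arr_flat [simp]:
  assumes \<Gamma>: "set \<Gamma> \<subseteq> Ob C" and "set \<Delta> \<subseteq> Ob C"
  shows "is_arr (flat \<Gamma> \<Delta>)" and "is_arr (flat' \<Gamma> \<Delta>)"
  using assms(2) by (induction \<Delta> rule: rev_induct; simp add: flat_Nil flat'_Nil flat_snoc flat'_snoc \<Gamma>)+

lemma flat_inverse [simp]:
  assumes \<Gamma>: "set \<Gamma> \<subseteq> Ob C" and "set \<Delta> \<subseteq> Ob C"
  shows "flat \<Gamma> \<Delta> \<bullet> flat' \<Gamma> \<Delta> = idm (ob (\<Gamma> @ \<Delta>))"
    and "flat' \<Gamma> \<Delta> \<bullet> flat \<Gamma> \<Delta> = idm (ob \<Gamma> \<otimes> ob \<Delta>)"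
proof -
  note [simp] = \<Gamma>
  have "flat \<Gamma> \<Delta> \<bullet> flat' \<Gamma> \<Delta> = idm (ob (\<Gamma> @ \<Delta>)) \<and> flat' \<Gamma> \<Delta> \<bullet> flat \<Gamma> \<Delta> = idm (ob \<Gamma> \<otimes> ob \<Delta>)"
    using assms(2)
  proof (induction \<Delta> rule: rev_induct)
    case Nil
    then show ?case by (simp add: flat_Nil flat'_Nil ob_simps)
  next
    case (snoc B \<Delta>)
    then have [simp]: "set \<Delta> \<subseteq> Ob C" "B \<in> Ob C"
      and IH: "flat \<Gamma> \<Delta> \<bullet> flat' \<Gamma> \<Delta> = idm (ob (\<Gamma> @ \<Delta>))"
        "flat' \<Gamma> \<Delta> \<bullet> flat \<Gamma> \<Delta> = idm (ob \<Gamma> \<otimes> ob \<Delta>)"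
      by auto
    have 1: "(idm (ob \<Gamma>) \<diamond> snoc' \<Delta> B) \<bullet> (idm (ob \<Gamma>) \<diamond> snoc \<Delta> B) = idm (ob \<Gamma> \<otimes> (ob \<Delta> \<otimes> B))"
      "(idm (ob \<Gamma>) \<diamond> snoc \<Delta> B) \<bullet> (idm (ob \<Gamma>) \<diamond> snoc' \<Delta> B) = idm (ob \<Gamma> \<otimes> ob (\<Delta> @ [B]))"
      by (simp_all flip: tens_comp_left)
    have 2: "(flat \<Gamma> \<Delta> \<diamond> idm B) \<bullet> (flat' \<Gamma> \<Delta> \<diamond> idm B) = idm (ob (\<Gamma> @ \<Delta>) \<otimes> B)"
      "(flat' \<Gamma> \<Delta> \<diamond> idm B) \<bullet> (flat \<Gamma> \<Delta> \<diamond> idm B) = idm (ob \<Gamma> \<otimes> ob \<Delta> \<otimes> B)"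
      by (simp_all add: IH flip: tens_comp_right)
    show ?case
      by (simp add: flat_snoc flat'_snoc 1 2 1 [THEN comp_reassoc] 2 [THEN comp_reassoc])
  qed
  then show "flat \<Gamma> \<Delta> \<bullet> flat' \<Gamma> \<Delta> = idm (ob (\<Gamma> @ \<Delta>))"
    and "flat' \<Gamma> \<Delta> \<bullet> flat \<Gamma> \<Delta> = idm (ob \<Gamma> \<otimes> ob \<Delta>)" by auto
qed

lemma flat_inverse_reassoc [simp]:
  assumes "set \<Gamma> \<subseteq> Ob C" "set \<Delta> \<subseteq> Ob C" "is_arr k"
  shows "trg k = ob (\<Gamma> @ \<Delta>) \<Longrightarrow> flat \<Gamma> \<Delta> \<bullet> flat' \<Gamma> \<Delta> \<bullet> k = k"
    and "trg k = ob \<Gamma> \<otimes> ob \<Delta> \<Longrightarrow> flat' \<Gamma> \<Delta> \<bullet> flat \<Gamma> \<Delta> \<bullet> k = k"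
  using assms by (simp_all flip: comp_arr_assoc)

text \<open>
  The recursion for \<open>flat\<close> runs over its second argument; that an empty first argument gives the other
  unitor depends on \<open>lu_tens\<close> and \<open>lu_unit_eq_ru_unit\<close>.
\<close>

lemma flat_Nil_left:
  assumes "set \<Gamma> \<subseteq> Ob C" shows "flat [] \<Gamma> = lu (ob \<Gamma>)"
  using assms
proof (induction \<Gamma> rule: rev_induct)
  case Nil
  then show ?case by (simp add: flat_Nil ob_simps lu_unit_eq_ru_unit)
next
  case (snoc B \<Gamma>)
  then have [simp]: "set \<Gamma> \<subseteq> Ob C" "B \<in> Ob C" by auto
  have "flat [] (\<Gamma> @ [B])
    = snoc \<Gamma> B \<bullet> (lu (ob \<Gamma>) \<diamond> idm B) \<bullet> asc' \<I> (ob \<Gamma>) B \<bullet> (idm \<I> \<diamond> snoc' \<Gamma> B)"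
    using snoc by (simp add: flat_snoc ob_simps)
  also have "\<dots> = snoc \<Gamma> B \<bullet> lu (ob \<Gamma> \<otimes> B) \<bullet> (idm \<I> \<diamond> snoc' \<Gamma> B)"
    by (simp flip: lu_tens)
  also have "\<dots> = lu (ob (\<Gamma> @ [B]))"
    using lu_nat[of "snoc' \<Gamma> B"] by simp
  finally show ?case .
qed

lemma flat_single:
  assumes [simp]: "set \<Gamma> \<subseteq> Ob C" "B \<in> Ob C" shows "flat \<Gamma> [B] = snoc \<Gamma> B"
proof -
  have "flat \<Gamma> [B] = snoc \<Gamma> B \<bullet> (ru (ob \<Gamma>) \<diamond> idm B) \<bullet> asc' (ob \<Gamma>) \<I> B \<bullet> (idm (ob \<Gamma>) \<diamond> lu' B)"
    using flat_snoc[of \<Gamma> "[]" B] by (simp add: flat_Nil ob_simps snoc'_def)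
  also have "\<dots> = snoc \<Gamma> B \<bullet> (idm (ob \<Gamma>) \<diamond> lu B) \<bullet> (idm (ob \<Gamma>) \<diamond> lu' B)"
    by (simp flip: triangle_arr)
  also have "\<dots> = snoc \<Gamma> B"
    by (simp flip: tens_comp_left)
  finally show ?thesis .
qed

text \<open>
  The two ways to flatten three lists agree.  By induction on the last list: the empty list is
  \<open>ru_tens\<close>, and appending an object is the pentagon.  Strictness of the category of lists rests on
  this statement and on \<open>flat_Nil_left\<close>.
\<close>

lemma flat_assoc:
  assumes "set \<Gamma> \<subseteq> Ob C" "set \<Delta> \<subseteq> Ob C" "set \<Theta> \<subseteq> Ob C"
  shows "flat (\<Gamma> @ \<Delta>) \<Theta> \<bullet> (flat \<Gamma> \<Delta> \<diamond> idm (ob \<Theta>))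
    = flat \<Gamma> (\<Delta> @ \<Theta>) \<bullet> (idm (ob \<Gamma>) \<diamond> flat \<Delta> \<Theta>) \<bullet> asc (ob \<Gamma>) (ob \<Delta>) (ob \<Theta>)"
  using assms(3)
proof (induction \<Theta> rule: rev_induct)
  note [simp] = assms(1,2)
  case Nil
  show ?case
    using ru_nat[of "flat \<Gamma> \<Delta>"] by (simp add: flat_Nil ob_simps ru_tens)
next
  note [simp] = assms(1,2)
  case (snoc B \<Theta>)
  then have [simp]: "set \<Theta> \<subseteq> Ob C" "B \<in> Ob C" by auto
  let ?G = "ob \<Gamma>" and ?D = "ob \<Delta>" and ?T = "ob \<Theta>" and ?k = "snoc (\<Gamma> @ \<Delta> @ \<Theta>) B"
  let ?s = "(idm (?G \<otimes> ?D) \<diamond> snoc' \<Theta> B)"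
  have "flat (\<Gamma> @ \<Delta>) (\<Theta> @ [B]) \<bullet> (flat \<Gamma> \<Delta> \<diamond> idm (ob (\<Theta> @ [B])))
    = ?k \<bullet> (flat (\<Gamma> @ \<Delta>) \<Theta> \<diamond> idm B) \<bullet> asc' (ob (\<Gamma> @ \<Delta>)) ?T B \<bullet> (flat \<Gamma> \<Delta> \<diamond> snoc' \<Theta> B)"
    by (simp add: flat_snoc flip: tens_comp)
  also have "\<dots> = ?k \<bullet> (flat (\<Gamma> @ \<Delta>) \<Theta> \<diamond> idm B) \<bullet> asc' (ob (\<Gamma> @ \<Delta>)) ?T B
      \<bullet> (flat \<Gamma> \<Delta> \<diamond> idm (?T \<otimes> B)) \<bullet> ?s"
    by (simp flip: tens_comp)
  \<comment> \<open>Naturality of the associator moves \<open>flat \<Gamma> \<Delta>\<close> next to \<open>flat (\<Gamma> @ \<Delta>) \<Theta>\<close>, where the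
      induction hypothesis applies.\<close>
  also have "asc' (ob (\<Gamma> @ \<Delta>)) ?T B \<bullet> (flat \<Gamma> \<Delta> \<diamond> idm (?T \<otimes> B)) \<bullet> ?s
    = ((flat \<Gamma> \<Delta> \<diamond> idm ?T) \<diamond> idm B) \<bullet> asc' (?G \<otimes> ?D) ?T B \<bullet> ?s"
    by (rule comp_left_cancel[where i = "asc (ob (\<Gamma> @ \<Delta>)) ?T B" and j = "asc' (ob (\<Gamma> @ \<Delta>)) ?T B"])
      (use comp_reassoc[OF asc_nat[of "flat \<Gamma> \<Delta>" "idm ?T" "idm B"], of "asc' (?G \<otimes> ?D) ?T B \<bullet> ?s"]
        in simp_all)
  also have "?k \<bullet> (flat (\<Gamma> @ \<Delta>) \<Theta> \<diamond> idm B) \<bullet> \<dots>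
    = ?k \<bullet> ((flat (\<Gamma> @ \<Delta>) \<Theta> \<bullet> (flat \<Gamma> \<Delta> \<diamond> idm ?T)) \<diamond> idm B) \<bullet> asc' (?G \<otimes> ?D) ?T B \<bullet> ?s"
    by (simp add: tens_comp_right)
  also have "\<dots> = ?k \<bullet> (flat \<Gamma> (\<Delta> @ \<Theta>) \<diamond> idm B) \<bullet> ((idm ?G \<diamond> flat \<Delta> \<Theta>) \<diamond> idm B)
      \<bullet> (asc ?G ?D ?T \<diamond> idm B) \<bullet> asc' (?G \<otimes> ?D) ?T B \<bullet> ?s"
    using snoc by (simp add: tens_comp_right)
  \<comment> \<open>This step is the pentagon.\<close>
  also have "(asc ?G ?D ?T \<diamond> idm B) \<bullet> asc' (?G \<otimes> ?D) ?T B \<bullet> ?s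
    = asc' ?G (?D \<otimes> ?T) B \<bullet> (idm ?G \<diamond> asc' ?D ?T B) \<bullet> asc ?G ?D (?T \<otimes> B) \<bullet> ?s"
    (is "?l = ?r")
  proof -
    have 1: "(idm ?G \<diamond> asc ?D ?T B) \<bullet> (idm ?G \<diamond> asc' ?D ?T B) = idm (?G \<otimes> (?D \<otimes> (?T \<otimes> B)))"
      "(idm ?G \<diamond> asc' ?D ?T B) \<bullet> (idm ?G \<diamond> asc ?D ?T B) = idm (?G \<otimes> (?D \<otimes> ?T \<otimes> B))"
      by (simp_all flip: tens_comp_left)
    have "asc ?G ?D (?T \<otimes> B) \<bullet> ?s
      = (asc ?G ?D (?T \<otimes> B) \<bullet> asc (?G \<otimes> ?D) ?T B) \<bullet> asc' (?G \<otimes> ?D) ?T B \<bullet> ?s"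
      by simp
    also have "\<dots> = (idm ?G \<diamond> asc ?D ?T B) \<bullet> asc ?G (?D \<otimes> ?T) B \<bullet> ?l"
      by (simp add: pentagon_arr del: comp_arr_assoc) simp
    finally show ?thesis
      by (simp add: 1 comp_reassoc[OF 1(2)] ob_simps)
  qed
  also have "asc ?G ?D (?T \<otimes> B) \<bullet> ?s
    = (idm ?G \<diamond> (idm ?D \<diamond> snoc' \<Theta> B)) \<bullet> asc ?G ?D (ob (\<Theta> @ [B]))"
    using asc_nat[of "idm ?G" "idm ?D" "snoc' \<Theta> B"] by simp
  also have "((idm ?G \<diamond> flat \<Delta> \<Theta>) \<diamond> idm B) \<bullet> asc' ?G (?D \<otimes> ?T) B \<bullet> (idm ?G \<diamond> asc' ?D ?T B)
      \<bullet> (idm ?G \<diamond> (idm ?D \<diamond> snoc' \<Theta> B)) \<bullet> asc ?G ?D (ob (\<Theta> @ [B]))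
    = asc' ?G (ob (\<Delta> @ \<Theta>)) B \<bullet> (idm ?G \<diamond> (flat \<Delta> \<Theta> \<diamond> idm B)) \<bullet> (idm ?G \<diamond> asc' ?D ?T B)
      \<bullet> (idm ?G \<diamond> (idm ?D \<diamond> snoc' \<Theta> B)) \<bullet> asc ?G ?D (ob (\<Theta> @ [B]))"
    by (rule comp_left_cancel[where i = "asc ?G (ob (\<Delta> @ \<Theta>)) B" and j = "asc' ?G (ob (\<Delta> @ \<Theta>)) B"])
      (use comp_reassoc[OF asc_nat[of "idm ?G" "flat \<Delta> \<Theta>" "idm B"],
          of "asc' ?G (?D \<otimes> ?T) B \<bullet> (idm ?G \<diamond> asc' ?D ?T B)
            \<bullet> (idm ?G \<diamond> (idm ?D \<diamond> snoc' \<Theta> B)) \<bullet> asc ?G ?D (ob (\<Theta> @ [B]))"]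
        in simp_all)
  also have "\<dots> = asc' ?G (ob (\<Delta> @ \<Theta>)) B \<bullet> (idm ?G \<diamond> (snoc' (\<Delta> @ \<Theta>) B \<bullet> flat \<Delta> (\<Theta> @ [B])))
      \<bullet> asc ?G ?D (ob (\<Theta> @ [B]))"
    by (simp add: flat_snoc tens_comp_left)
  also have "?k \<bullet> (flat \<Gamma> (\<Delta> @ \<Theta>) \<diamond> idm B) \<bullet> \<dots>
    = flat \<Gamma> (\<Delta> @ \<Theta> @ [B]) \<bullet> (idm ?G \<diamond> flat \<Delta> (\<Theta> @ [B])) \<bullet> asc ?G ?D (ob (\<Theta> @ [B]))"
    using flat_snoc[of \<Gamma> "\<Delta> @ \<Theta>" B] by (simp add: tens_comp_left)
  finally show ?case .
qed

end

section \<open>The strict symmetric monoidal category of lists\<close>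

context sym_monoidal_category
begin

text \<open>
  A \<^emph>\<open>list arrow\<close> from \<open>\<Gamma>\<close> to \<open>\<Delta>\<close> is an arrow of \<open>C\<close> from \<open>ob \<Gamma>\<close> to \<open>ob \<Delta>\<close>; \<open>ar\<close> forgets how source and target
  are divided into factors.  Hence an equation between list arrows is an equation in \<open>C\<close>, and
  translations go both ways.
\<close>

definition ar where "ar F = (ob (src F), mor F, ob (trg F))"

definition is_larr where
  "is_larr F \<longleftrightarrow> set (src F) \<subseteq> Ob C \<and> set (trg F) \<subseteq> Ob C \<and> is_arr (ar F)"

definition lid where "lid \<Gamma> = (\<Gamma>, \<one> (ob \<Gamma>), \<Gamma>)"

definition ltens (infixr "\<parallel>" 75) where
  "F \<parallel> G = (src F @ src G,
    mor (flat (trg F) (trg G) \<bullet> (ar F \<diamond> ar G) \<bullet> flat' (src F) (src G)), trg F @ trg G)"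

definition lbr where
  "lbr \<Gamma> \<Delta> = (\<Gamma> @ \<Delta>, mor (flat \<Delta> \<Gamma> \<bullet> br (ob \<Gamma>) (ob \<Delta>) \<bullet> flat' \<Gamma> \<Delta>), \<Delta> @ \<Gamma>)"

lemma ar_sel [simp]: "src (ar F) = ob (src F)" "trg (ar F) = ob (trg F)" "mor (ar F) = mor F"
  by (simp_all add: ar_def)

lemma larr_sel [simp]:
  "src (lid \<Gamma>) = \<Gamma>" "trg (lid \<Gamma>) = \<Gamma>" "mor (lid \<Gamma>) = \<one> (ob \<Gamma>)"
  "src (F \<parallel> G) = src F @ src G" "trg (F \<parallel> G) = trg F @ trg G"
  "src (lbr \<Gamma> \<Delta>) = \<Gamma> @ \<Delta>" "trg (lbr \<Gamma> \<Delta>) = \<Delta> @ \<Gamma>"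
  by (simp_all add: lid_def ltens_def lbr_def)

lemma ar_simps [simp]:
  "ar (lid \<Gamma>) = idm (ob \<Gamma>)"
  "ar (G \<bullet> F) = ar G \<bullet> ar F"
  "ar (F \<parallel> G) = flat (trg F) (trg G) \<bullet> (ar F \<diamond> ar G) \<bullet> flat' (src F) (src G)"
  "ar (lbr \<Gamma> \<Delta>) = flat \<Delta> \<Gamma> \<bullet> br (ob \<Gamma>) (ob \<Delta>) \<bullet> flat' \<Gamma> \<Delta>"
  by (simp_all add: ar_def lid_def ltens_def lbr_def idm_def comp_arr_def)

lemma larr_eqI: "src F = src G \<Longrightarrow> trg F = trg G \<Longrightarrow> ar F = ar G \<Longrightarrow> F = G"
  by (rule arrow_eqI) (auto simp: ar_def)

lemma is_larrD: "is_larr F \<Longrightarrow> set (src F) \<subseteq> Ob C" "is_larr F \<Longrightarrow> set (trg F) \<subseteq> Ob C"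
  "is_larr F \<Longrightarrow> is_arr (ar F)"
  by (simp_all add: is_larr_def)

lemma is_larr_lid [simp]: "set \<Gamma> \<subseteq> Ob C \<Longrightarrow> is_larr (lid \<Gamma>)"
  by (simp add: is_larr_def)

lemma is_larr_comp [simp]: "is_larr F \<Longrightarrow> is_larr G \<Longrightarrow> src G = trg F \<Longrightarrow> is_larr (G \<bullet> F)"
  by (simp add: is_larr_def)

lemma is_larr_ltens [simp]: "is_larr F \<Longrightarrow> is_larr G \<Longrightarrow> is_larr (F \<parallel> G)"
  by (simp add: is_larr_def)

lemma is_larr_lbr [simp]: "set \<Gamma> \<subseteq> Ob C \<Longrightarrow> set \<Delta> \<subseteq> Ob C \<Longrightarrow> is_larr (lbr \<Gamma> \<Delta>)"
  by (simp add: is_larr_def)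

declare is_larrD [simp]

lemma lcomp_assoc:
  "is_larr F \<Longrightarrow> is_larr G \<Longrightarrow> is_larr H \<Longrightarrow> src G = trg F \<Longrightarrow> src H = trg G
    \<Longrightarrow> (H \<bullet> G) \<bullet> F = H \<bullet> G \<bullet> F"
  by (rule larr_eqI) simp_all

lemma lcomp_id [simp]:
  "is_larr F \<Longrightarrow> src F = \<Gamma> \<Longrightarrow> F \<bullet> lid \<Gamma> = F"
  "is_larr F \<Longrightarrow> trg F = \<Gamma> \<Longrightarrow> lid \<Gamma> \<bullet> F = F"
  by (auto intro!: larr_eqI)

lemma ltens_lcomp:
  assumes "is_larr F" "is_larr G" "src G = trg F" "is_larr F'" "is_larr G'" "src G' = trg F'"
  shows "(G \<bullet> F) \<parallel> (G' \<bullet> F') = (G \<parallel> G') \<bullet> (F \<parallel> F')"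
  using assms by (intro larr_eqI) (simp_all add: tens_comp)

lemma ltens_lid [simp]: "set \<Gamma> \<subseteq> Ob C \<Longrightarrow> set \<Delta> \<subseteq> Ob C \<Longrightarrow> lid \<Gamma> \<parallel> lid \<Delta> = lid (\<Gamma> @ \<Delta>)"
  by (rule larr_eqI) simp_all

lemma ltens_Nil [simp]:
  assumes [simp]: "is_larr F"
  shows "lid [] \<parallel> F = F" and "F \<parallel> lid [] = F"
proof -
  have lu: "flat' [] \<Gamma> = lu' (ob \<Gamma>)" if [simp]: "set \<Gamma> \<subseteq> Ob C" for \<Gamma>
  proof (rule comp_left_cancel[where i = "flat [] \<Gamma>" and j = "flat' [] \<Gamma>"])
    show "flat [] \<Gamma> \<bullet> flat' [] \<Gamma> = flat [] \<Gamma> \<bullet> lu' (ob \<Gamma>)"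
      by simp (simp add: flat_Nil_left)
  qed (simp_all add: ob_simps)
  show "lid [] \<parallel> F = F"
    using comp_reassoc[OF lu_nat[of "ar F"], of "lu' (ob (src F))"]
    by (intro larr_eqI) (simp_all add: lu flat_Nil_left, simp_all add: ob_simps)
  show "F \<parallel> lid [] = F"
    using comp_reassoc[OF ru_nat[of "ar F"], of "ru' (ob (src F))"]
    by (intro larr_eqI) (simp_all add: flat_Nil flat'_Nil, simp_all add: ob_simps)
qed

lemma flat'_assoc:
  assumes [simp]: "set \<Gamma> \<subseteq> Ob C" "set \<Delta> \<subseteq> Ob C" "set \<Theta> \<subseteq> Ob C"
  shows "asc (ob \<Gamma>) (ob \<Delta>) (ob \<Theta>) \<bullet> (flat' \<Gamma> \<Delta> \<diamond> idm (ob \<Theta>)) \<bullet> flat' (\<Gamma> @ \<Delta>) \<Theta>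
    = (idm (ob \<Gamma>) \<diamond> flat' \<Delta> \<Theta>) \<bullet> flat' \<Gamma> (\<Delta> @ \<Theta>)" (is "?l = ?r")
proof -
  have 1: "(idm (ob \<Gamma>) \<diamond> flat' \<Delta> \<Theta>) \<bullet> (idm (ob \<Gamma>) \<diamond> flat \<Delta> \<Theta>)
      = idm (ob \<Gamma> \<otimes> (ob \<Delta> \<otimes> ob \<Theta>))"
    "(flat \<Gamma> \<Delta> \<diamond> idm (ob \<Theta>)) \<bullet> (flat' \<Gamma> \<Delta> \<diamond> idm (ob \<Theta>)) = idm (ob (\<Gamma> @ \<Delta>) \<otimes> ob \<Theta>)"
    by (simp_all flip: tens_comp_left tens_comp_right)
  have "?r = ?r \<bullet> (flat (\<Gamma> @ \<Delta>) \<Theta> \<bullet> (flat \<Gamma> \<Delta> \<diamond> idm (ob \<Theta>)))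
      \<bullet> (flat' \<Gamma> \<Delta> \<diamond> idm (ob \<Theta>)) \<bullet> flat' (\<Gamma> @ \<Delta>) \<Theta>"
    by (simp add: comp_reassoc[OF 1(2)])
  also have "\<dots> = ?l"
    by (subst flat_assoc) (simp_all add: comp_reassoc[OF 1(1)])
  finally show ?thesis by simp
qed

text \<open>
  Strictness: \<open>flat_assoc\<close> at the targets and its inverse at the sources produce an associator and its
  inverse, which cancel by naturality.
\<close>

lemma ltens_assoc [simp]:
  assumes [simp]: "is_larr F" "is_larr G" "is_larr H"
  shows "(F \<parallel> G) \<parallel> H = F \<parallel> G \<parallel> H"
proof (rule larr_eqI)
  let ?a = "asc (ob (src F)) (ob (src G)) (ob (src H))"
  let ?b = "asc (ob (trg F)) (ob (trg G)) (ob (trg H))"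
  let ?r = "(flat' (src F) (src G) \<diamond> idm (ob (src H))) \<bullet> flat' (src F @ src G) (src H)"
  have "ar ((F \<parallel> G) \<parallel> H) = flat (trg F @ trg G) (trg H)
    \<bullet> ((flat (trg F) (trg G) \<bullet> (ar F \<diamond> ar G) \<bullet> flat' (src F) (src G)) \<diamond> ar H)
    \<bullet> flat' (src F @ src G) (src H)"
    by simp
  also have "(flat (trg F) (trg G) \<bullet> (ar F \<diamond> ar G) \<bullet> flat' (src F) (src G)) \<diamond> ar H
    = (flat (trg F) (trg G) \<bullet> (ar F \<diamond> ar G) \<bullet> flat' (src F) (src G))
      \<diamond> (idm (ob (trg H)) \<bullet> ar H \<bullet> idm (ob (src H)))"
    by simp
  also have "\<dots> = (flat (trg F) (trg G) \<diamond> idm (ob (trg H))) \<bullet> ((ar F \<diamond> ar G) \<diamond> ar H)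
      \<bullet> (flat' (src F) (src G) \<diamond> idm (ob (src H)))"
    by (simp add: tens_comp del: comp_arr_id)
  also have "flat (trg F @ trg G) (trg H) \<bullet> \<dots> \<bullet> flat' (src F @ src G) (src H)
    = (flat (trg F @ trg G) (trg H) \<bullet> (flat (trg F) (trg G) \<diamond> idm (ob (trg H))))
      \<bullet> ((ar F \<diamond> ar G) \<diamond> ar H) \<bullet> ?r"
    by simp
  also have "\<dots> = flat (trg F) (trg G @ trg H) \<bullet> (idm (ob (trg F)) \<diamond> flat (trg G) (trg H))
      \<bullet> ?b \<bullet> ((ar F \<diamond> ar G) \<diamond> ar H) \<bullet> ?r"
    by (subst flat_assoc) simp_all
  also have "?b \<bullet> ((ar F \<diamond> ar G) \<diamond> ar H) \<bullet> ?r = (ar F \<diamond> ar G \<diamond> ar H) \<bullet> ?a \<bullet> ?r"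
    using comp_reassoc[OF asc_nat[of "ar F" "ar G" "ar H"], of ?r] by simp
  also have "?a \<bullet> ?r = (idm (ob (src F)) \<diamond> flat' (src G) (src H)) \<bullet> flat' (src F) (src G @ src H)"
    by (rule flat'_assoc) simp_all
  also have "flat (trg F) (trg G @ trg H) \<bullet> (idm (ob (trg F)) \<diamond> flat (trg G) (trg H))
      \<bullet> (ar F \<diamond> ar G \<diamond> ar H) \<bullet> \<dots>
    = flat (trg F) (trg G @ trg H) \<bullet> ((idm (ob (trg F)) \<bullet> ar F \<bullet> idm (ob (src F)))
      \<diamond> (flat (trg G) (trg H) \<bullet> (ar G \<diamond> ar H) \<bullet> flat' (src G) (src H)))
      \<bullet> flat' (src F) (src G @ src H)"
    by (simp add: tens_comp del: comp_arr_id)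
  also have "\<dots> = ar (F \<parallel> G \<parallel> H)"
    by simp
  finally show "ar ((F \<parallel> G) \<parallel> H) = ar (F \<parallel> G \<parallel> H)" .
qed simp_all

lemma lbr_nat:
  assumes "is_larr F" "is_larr G"
  shows "lbr (trg F) (trg G) \<bullet> (F \<parallel> G) = (G \<parallel> F) \<bullet> lbr (src F) (src G)"
  using assms comp_reassoc[OF br_nat[of "ar F" "ar G"], of "flat' (src F) (src G)"]
  by (intro larr_eqI) simp_all

lemma lbr_inverse:
  assumes "set \<Gamma> \<subseteq> Ob C" "set \<Delta> \<subseteq> Ob C"
  shows "lbr \<Delta> \<Gamma> \<bullet> lbr \<Gamma> \<Delta> = lid (\<Gamma> @ \<Delta>)"
  using assms by (intro larr_eqI) simp_all

lemma lbr_Nil: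
  assumes [simp]: "set \<Gamma> \<subseteq> Ob C"
  shows "lbr \<Gamma> [] = lid \<Gamma>"
proof (rule larr_eqI)
  show "ar (lbr \<Gamma> []) = ar (lid \<Gamma>)"
    using comp_reassoc[OF lu_br[of "ob \<Gamma>"], of "ru' (ob \<Gamma>)"]
    by (simp add: flat_Nil_left flat'_Nil, simp add: ob_simps)
qed simp_all

text \<open>
  Between lists the hexagon has no associators left; it decomposes the symmetry with a list into
  symmetries with its members.
\<close>

lemma lbr_hexagon:
  assumes [simp]: "set \<Gamma> \<subseteq> Ob C" "set \<Delta> \<subseteq> Ob C" "set \<Theta> \<subseteq> Ob C"
  shows "lbr \<Gamma> (\<Delta> @ \<Theta>) = (lid \<Delta> \<parallel> lbr \<Gamma> \<Theta>) \<bullet> (lbr \<Gamma> \<Delta> \<parallel> lid \<Theta>)"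
proof (rule larr_eqI)
  let ?G = "ob \<Gamma>" and ?D = "ob \<Delta>" and ?T = "ob \<Theta>"
  let ?r = "(flat' \<Gamma> \<Delta> \<diamond> idm ?T) \<bullet> flat' (\<Gamma> @ \<Delta>) \<Theta>"
  have 1: "(idm ?D \<diamond> flat' \<Gamma> \<Theta>) \<bullet> (idm ?D \<diamond> flat \<Gamma> \<Theta>) = idm (?D \<otimes> (?G \<otimes> ?T))"
    "(idm ?G \<diamond> flat \<Delta> \<Theta>) \<bullet> (idm ?G \<diamond> flat' \<Delta> \<Theta>) = idm (?G \<otimes> ob (\<Delta> @ \<Theta>))"
    by (simp_all flip: tens_comp_left)
  have "ar ((lid \<Delta> \<parallel> lbr \<Gamma> \<Theta>) \<bullet> (lbr \<Gamma> \<Delta> \<parallel> lid \<Theta>))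
    = flat \<Delta> (\<Theta> @ \<Gamma>) \<bullet> (idm ?D \<diamond> flat \<Theta> \<Gamma>) \<bullet> (idm ?D \<diamond> br ?G ?T)
      \<bullet> (idm ?D \<diamond> flat' \<Gamma> \<Theta>) \<bullet> flat' \<Delta> (\<Gamma> @ \<Theta>)
      \<bullet> (flat (\<Delta> @ \<Gamma>) \<Theta> \<bullet> (flat \<Delta> \<Gamma> \<diamond> idm ?T)) \<bullet> (br ?G ?D \<diamond> idm ?T) \<bullet> ?r"
    by (simp add: tens_comp_left tens_comp_right)
  also have "\<dots> = flat \<Delta> (\<Theta> @ \<Gamma>) \<bullet> (idm ?D \<diamond> flat \<Theta> \<Gamma>) \<bullet> ((idm ?D \<diamond> br ?G ?T)
      \<bullet> asc ?D ?G ?T \<bullet> (br ?G ?D \<diamond> idm ?T)) \<bullet> ?r"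
    by (subst flat_assoc) (simp_all add: comp_reassoc[OF 1(1)])
  also have "\<dots> = (flat \<Delta> (\<Theta> @ \<Gamma>) \<bullet> (idm ?D \<diamond> flat \<Theta> \<Gamma>) \<bullet> asc ?D ?T ?G)
      \<bullet> br ?G (?D \<otimes> ?T) \<bullet> asc ?G ?D ?T \<bullet> ?r"
    by (subst hexagon_arr[symmetric]) simp_all
  also have "\<dots> = flat (\<Delta> @ \<Theta>) \<Gamma> \<bullet> (flat \<Delta> \<Theta> \<diamond> idm ?G) \<bullet> br ?G (?D \<otimes> ?T) \<bullet> asc ?G ?D ?T \<bullet> ?r"
    by (subst flat_assoc[symmetric]) simp_all
  also have "asc ?G ?D ?T \<bullet> ?r = (idm ?G \<diamond> flat' \<Delta> \<Theta>) \<bullet> flat' \<Gamma> (\<Delta> @ \<Theta>)"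
    by (rule flat'_assoc) simp_all
  also have "(flat \<Delta> \<Theta> \<diamond> idm ?G) \<bullet> br ?G (?D \<otimes> ?T) \<bullet> \<dots>
    = br ?G (ob (\<Delta> @ \<Theta>)) \<bullet> flat' \<Gamma> (\<Delta> @ \<Theta>)"
    using comp_reassoc[OF br_nat[of "idm ?G" "flat \<Delta> \<Theta>", symmetric],
        of "(idm ?G \<diamond> flat' \<Delta> \<Theta>) \<bullet> flat' \<Gamma> (\<Delta> @ \<Theta>)"]
    by (simp add: comp_reassoc[OF 1(2)])
  finally show "ar (lbr \<Gamma> (\<Delta> @ \<Theta>)) = ar ((lid \<Delta> \<parallel> lbr \<Gamma> \<Theta>) \<bullet> (lbr \<Gamma> \<Delta> \<parallel> lid \<Theta>))"
    by simp
qed simp_all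

end

section \<open>String diagrams\<close>

text \<open>
  The layer \<open>(i, F)\<close> applies \<open>F\<close> to the consecutive entries \<open>src F\<close> of the current list that start at
  position \<open>i\<close>.  Lists of layers are read from left to right.  As positions are numbers and lists are
  explicit, typing and planar isotopy can be decided by evaluation.
\<close>

type_synonym ('a, 'm) layer = "nat \<times> ('a list, 'm) arrow"

primrec shift :: "nat \<Rightarrow> ('a, 'm) layer list \<Rightarrow> ('a, 'm) layer list" where
  "shift k [] = []"
| "shift k (l # ds) = (fst l + k, snd l) # shift k ds"

fun after :: "'a list \<Rightarrow> ('a, 'm) layer \<Rightarrow> 'a list" where
  "after \<Gamma> (i, F) = take i \<Gamma> @ trg F @ drop (i + length (src F)) \<Gamma>"

primrec out :: "'a list \<Rightarrow> ('a, 'm) layer list \<Rightarrow> 'a list" where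
  "out \<Gamma> [] = \<Gamma>"
| "out \<Gamma> (l # ds) = out (after \<Gamma> l) ds"

text \<open>
  Puts a layer in front of a diagram and moves it back as long as the next layer lies completely to its
  right: of two independent layers the right one comes first.  Positions are shifted because \<open>G\<close> now precedes
  \<open>F\<close>.  Adding before subtracting avoids truncation.
\<close>

fun insert_layer :: "('a, 'm) layer \<Rightarrow> ('a, 'm) layer list \<Rightarrow> ('a, 'm) layer list" where
  "insert_layer (i, F) [] = [(i, F)]"
| "insert_layer (i, F) ((j, G) # ds) = (if i + length (trg F) \<le> j
    then (j + length (src F) - length (trg F), G) # insert_layer (i, F) ds
    else (i, F) # (j, G) # ds)"

primrec nf :: "('a, 'm) layer list \<Rightarrow> ('a, 'm) layer list" where
  "nf [] = []"
| "nf (l # ds) = insert_layer l (nf ds)"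

lemma out_append [simp]: "out \<Gamma> (xs @ ys) = out (out \<Gamma> xs) ys"
  by (induction xs arbitrary: \<Gamma>) auto

context sym_monoidal_category
begin

fun fits where
  "fits \<Gamma> (i, F) \<longleftrightarrow> is_larr F \<and> i + length (src F) \<le> length \<Gamma> \<and> take (length (src F)) (drop i \<Gamma>) = src F"

primrec wt where
  "wt \<Gamma> [] \<longleftrightarrow> set \<Gamma> \<subseteq> Ob C"
| "wt \<Gamma> (l # ds) \<longleftrightarrow> fits \<Gamma> l \<and> wt (after \<Gamma> l) ds"

fun lay where
  "lay \<Gamma> (i, F) = lid (take i \<Gamma>) \<parallel> F \<parallel> lid (drop (i + length (src F)) \<Gamma>)"

primrec ev where
  "ev \<Gamma> [] = lid \<Gamma>"
| "ev \<Gamma> (l # ds) = ev (after \<Gamma> l) ds \<bullet> lay \<Gamma> l"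

lemma fitsE:
  assumes "fits \<Gamma> (i, F)"
  obtains \<Xi> \<Theta> where "\<Gamma> = \<Xi> @ src F @ \<Theta>" "length \<Xi> = i" "is_larr F"
proof
  show "\<Gamma> = take i \<Gamma> @ src F @ drop (i + length (src F)) \<Gamma>"
    using assms by (metis append_take_drop_id drop_drop add.commute fits.simps)
qed (use assms in auto)

lemma lay_split: "length \<Xi> = i \<Longrightarrow> lay (\<Xi> @ src F @ \<Theta>) (i, F) = lid \<Xi> \<parallel> F \<parallel> lid \<Theta>"
  by simp

lemma wt_imp_ob: "wt \<Gamma> ds \<Longrightarrow> set \<Gamma> \<subseteq> Ob C"
proof (induction ds arbitrary: \<Gamma>)
  case (Cons l ds)
  obtain i F where l: "l = (i, F)" by (cases l)
  then obtain \<Xi> \<Theta> where "\<Gamma> = \<Xi> @ src F @ \<Theta>" "length \<Xi> = i" "is_larr F"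
    using Cons.prems fitsE[of \<Gamma> i F] by auto
  then show ?case using Cons.IH[of "after \<Gamma> l"] Cons.prems l by (auto dest: is_larrD)
qed simp

lemma is_larr_lay [simp]:
  assumes "fits \<Gamma> l" "set \<Gamma> \<subseteq> Ob C"
  shows "is_larr (lay \<Gamma> l)" "src (lay \<Gamma> l) = \<Gamma>" "trg (lay \<Gamma> l) = after \<Gamma> l"
proof -
  obtain i F where l: "l = (i, F)" by (cases l)
  then obtain \<Xi> \<Theta> where "\<Gamma> = \<Xi> @ src F @ \<Theta>" "length \<Xi> = i" "is_larr F"
    using assms fitsE[of \<Gamma> i F] by auto
  then show "is_larr (lay \<Gamma> l)" "src (lay \<Gamma> l) = \<Gamma>" "trg (lay \<Gamma> l) = after \<Gamma> l"
    using assms(2) by (simp_all add: l)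
qed

lemma wt_append [simp]: "wt \<Gamma> (xs @ ys) \<longleftrightarrow> wt \<Gamma> xs \<and> wt (out \<Gamma> xs) ys"
proof (induction xs arbitrary: \<Gamma>)
  case Nil then show ?case using wt_imp_ob by auto
qed simp

lemma ev_arr:
  assumes "wt \<Gamma> ds"
  shows "is_larr (ev \<Gamma> ds)" "src (ev \<Gamma> ds) = \<Gamma>" "trg (ev \<Gamma> ds) = out \<Gamma> ds"
proof -
  have "is_larr (ev \<Gamma> ds) \<and> src (ev \<Gamma> ds) = \<Gamma> \<and> trg (ev \<Gamma> ds) = out \<Gamma> ds"
    using assms
  proof (induction ds arbitrary: \<Gamma>)
    case (Cons l ds)
    then have "set \<Gamma> \<subseteq> Ob C" using wt_imp_ob by blast
    then show ?case using Cons by simp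
  qed simp
  then show "is_larr (ev \<Gamma> ds)" "src (ev \<Gamma> ds) = \<Gamma>" "trg (ev \<Gamma> ds) = out \<Gamma> ds" by auto
qed

declare ev_arr [simp]

lemma ev_append [simp]: "wt \<Gamma> (xs @ ys) \<Longrightarrow> ev \<Gamma> (xs @ ys) = ev (out \<Gamma> xs) ys \<bullet> ev \<Gamma> xs"
proof (induction xs arbitrary: \<Gamma>)
  case (Cons l xs)
  then have "set \<Gamma> \<subseteq> Ob C" using wt_imp_ob by blast
  then show ?case using Cons by (simp add: lcomp_assoc)
qed simp

text \<open>
  Adding spectator objects on both sides of a diagram.
\<close>

lemma shift_whisker:
  assumes "wt \<Gamma> ds" "set \<Xi> \<subseteq> Ob C" "set \<Theta> \<subseteq> Ob C" "length \<Xi> = k"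
  shows "wt (\<Xi> @ \<Gamma> @ \<Theta>) (shift k ds)"
    and "out (\<Xi> @ \<Gamma> @ \<Theta>) (shift k ds) = \<Xi> @ out \<Gamma> ds @ \<Theta>"
    and "ev (\<Xi> @ \<Gamma> @ \<Theta>) (shift k ds) = lid \<Xi> \<parallel> ev \<Gamma> ds \<parallel> lid \<Theta>"
proof -
  note [simp] = assms(2,3)
  have "wt (\<Xi> @ \<Gamma> @ \<Theta>) (shift k ds) \<and> out (\<Xi> @ \<Gamma> @ \<Theta>) (shift k ds) = \<Xi> @ out \<Gamma> ds @ \<Theta>
    \<and> ev (\<Xi> @ \<Gamma> @ \<Theta>) (shift k ds) = lid \<Xi> \<parallel> ev \<Gamma> ds \<parallel> lid \<Theta>"
    using assms(1)
  proof (induction ds arbitrary: \<Gamma>)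
    case Nil
    then show ?case by simp
  next
    case (Cons l ds)
    obtain i F where l: "l = (i, F)" by (cases l)
    then obtain \<Xi>' \<Theta>' where \<Gamma>: "\<Gamma> = \<Xi>' @ src F @ \<Theta>'" and i: "length \<Xi>' = i" and F: "is_larr F"
      using Cons.prems fitsE[of \<Gamma> i F] by auto
    have ob: "set \<Xi>' \<subseteq> Ob C" "set \<Theta>' \<subseteq> Ob C"
      using wt_imp_ob[OF Cons.prems] by (simp_all add: \<Gamma>)
    let ?\<Gamma> = "\<Xi>' @ trg F @ \<Theta>'"
    have af: "after \<Gamma> l = ?\<Gamma>" and w: "wt ?\<Gamma> ds"
      using Cons.prems i by (simp_all add: l \<Gamma>)
    have af': "after (\<Xi> @ \<Gamma> @ \<Theta>) (i + k, F) = \<Xi> @ ?\<Gamma> @ \<Theta>"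
      using i assms(4) by (simp add: \<Gamma>)
    have ft: "fits (\<Xi> @ \<Gamma> @ \<Theta>) (i + k, F)"
      using i assms(4) F by (simp add: \<Gamma>)
    have "ev (\<Xi> @ \<Gamma> @ \<Theta>) (shift k (l # ds))
      = (lid \<Xi> \<parallel> ev ?\<Gamma> ds \<parallel> lid \<Theta>) \<bullet> lay (\<Xi> @ \<Gamma> @ \<Theta>) (i + k, F)"
      using Cons.IH[OF w] af' by (simp add: l del: after.simps lay.simps)
    also have "lay (\<Xi> @ \<Gamma> @ \<Theta>) (i + k, F) = lid (\<Xi> @ \<Xi>') \<parallel> F \<parallel> lid (\<Theta>' @ \<Theta>)"
      using lay_split[of "\<Xi> @ \<Xi>'" "i + k" F "\<Theta>' @ \<Theta>"] i assms(4) by (simp add: \<Gamma> del: lay.simps)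
    also have "\<dots> = lid \<Xi> \<parallel> lay \<Gamma> l \<parallel> lid \<Theta>"
      using i ob F by (simp add: l \<Gamma> flip: ltens_lid)
    also have "(lid \<Xi> \<parallel> ev ?\<Gamma> ds \<parallel> lid \<Theta>) \<bullet> \<dots> = lid \<Xi> \<parallel> ev \<Gamma> (l # ds) \<parallel> lid \<Theta>"
      using w ob F i af is_larr_lay[of \<Gamma> l] Cons.prems
      by (simp add: \<Gamma> l del: after.simps lay.simps ev_arr(1) flip: ltens_lcomp add: ev_arr(1))
    finally show ?case
      using Cons.IH[OF w] af af' ft by (simp add: l del: after.simps lay.simps fits.simps)
  qed
  then show "wt (\<Xi> @ \<Gamma> @ \<Theta>) (shift k ds)"
    and "out (\<Xi> @ \<Gamma> @ \<Theta>) (shift k ds) = \<Xi> @ out \<Gamma> ds @ \<Theta>"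
    and "ev (\<Xi> @ \<Gamma> @ \<Theta>) (shift k ds) = lid \<Xi> \<parallel> ev \<Gamma> ds \<parallel> lid \<Theta>" by auto
qed

text \<open>
  Independent layers may be exchanged.  Both orders equal the single arrow
  \<open>lid \<Xi> \<parallel> F \<parallel> lid \<Theta>' \<parallel> G \<parallel> lid \<Omega>\<close> by functoriality of the strict tensor product.
\<close>

lemma exchange_layers:
  assumes "wt \<Gamma> ((i, F) # (j, G) # ds)" and ij: "i + length (trg F) \<le> j"
  defines "ds' \<equiv> (j + length (src F) - length (trg F), G) # (i, F) # ds"
  shows "wt \<Gamma> ds' \<and> ev \<Gamma> ds' = ev \<Gamma> ((i, F) # (j, G) # ds)"
proof -
  obtain \<Xi> \<Theta> where \<Gamma>: "\<Gamma> = \<Xi> @ src F @ \<Theta>" and i: "length \<Xi> = i" and F: "is_larr F"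
    using assms(1) fitsE[of \<Gamma> i F] by auto
  have af: "after \<Gamma> (i, F) = \<Xi> @ trg F @ \<Theta>" using i by (simp add: \<Gamma>)
  obtain \<Xi>' \<Omega> where eq: "\<Xi> @ trg F @ \<Theta> = \<Xi>' @ src G @ \<Omega>" and j: "length \<Xi>' = j" and G: "is_larr G"
    using assms(1) af fitsE[of "\<Xi> @ trg F @ \<Theta>" j G] by (metis wt.simps(2))
  obtain \<Theta>' where \<Xi>': "\<Xi>' = \<Xi> @ trg F @ \<Theta>'" and \<Theta>: "\<Theta> = \<Theta>' @ src G @ \<Omega>"
  proof
    show "\<Xi>' = \<Xi> @ trg F @ drop (i + length (trg F)) \<Xi>'"
      using arg_cong[OF eq, of "take (i + length (trg F))"] i j ij
      by (metis append.assoc append_eq_conv_conj append_take_drop_id length_append take_append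
          diff_is_0_eq take_0 append_Nil2)
    show "\<Theta> = drop (i + length (trg F)) \<Xi>' @ src G @ \<Omega>"
      using arg_cong[OF eq, of "drop (i + length (trg F))"] i j ij by simp
  qed
  have ob: "set \<Xi> \<subseteq> Ob C" "set \<Theta>' \<subseteq> Ob C" "set \<Omega> \<subseteq> Ob C"
    using wt_imp_ob[OF assms(1)] by (simp_all add: \<Gamma> \<Theta>)
  let ?j = "j + length (src F) - length (trg F)"
  have j': "?j = length (\<Xi> @ src F @ \<Theta>')" using i j by (simp add: \<Xi>')
  have 1: "fits \<Gamma> (?j, G)" "after \<Gamma> (?j, G) = \<Xi> @ src F @ \<Theta>' @ trg G @ \<Omega>"
    "lay \<Gamma> (?j, G) = lid (\<Xi> @ src F @ \<Theta>') \<parallel> G \<parallel> lid \<Omega>"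
    unfolding j' using G by (simp_all add: \<Gamma> \<Theta>)
  have 2: "fits (\<Xi> @ src F @ \<Theta>' @ trg G @ \<Omega>) (i, F)"
    "after (\<Xi> @ src F @ \<Theta>' @ trg G @ \<Omega>) (i, F) = \<Xi> @ trg F @ \<Theta>' @ trg G @ \<Omega>"
    "lay (\<Xi> @ src F @ \<Theta>' @ trg G @ \<Omega>) (i, F) = lid \<Xi> \<parallel> F \<parallel> lid (\<Theta>' @ trg G @ \<Omega>)"
    using F i by simp_all
  have 3: "lay \<Gamma> (i, F) = lid \<Xi> \<parallel> F \<parallel> lid (\<Theta>' @ src G @ \<Omega>)"
    "after \<Gamma> (i, F) = \<Xi> @ trg F @ \<Theta>' @ src G @ \<Omega>"
    using i by (simp_all add: \<Gamma> \<Theta>)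
  have 4: "after (\<Xi> @ trg F @ \<Theta>' @ src G @ \<Omega>) (j, G) = \<Xi> @ trg F @ \<Theta>' @ trg G @ \<Omega>"
    "lay (\<Xi> @ trg F @ \<Theta>' @ src G @ \<Omega>) (j, G) = lid (\<Xi> @ trg F @ \<Theta>') \<parallel> G \<parallel> lid \<Omega>"
    using i j by (simp_all add: \<Xi>')
  let ?m = "lid \<Xi> \<parallel> F \<parallel> lid \<Theta>' \<parallel> G \<parallel> lid \<Omega>"
  have "?m = (lid \<Xi> \<bullet> lid \<Xi>) \<parallel> (lid (trg F) \<bullet> F) \<parallel> (lid \<Theta>' \<bullet> lid \<Theta>') \<parallel> (G \<bullet> lid (src G))
      \<parallel> (lid \<Omega> \<bullet> lid \<Omega>)"
    using ob F G by simp
  also have "\<dots> = (lid \<Xi> \<parallel> lid (trg F) \<parallel> lid \<Theta>' \<parallel> G \<parallel> lid \<Omega>)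
      \<bullet> (lid \<Xi> \<parallel> F \<parallel> lid \<Theta>' \<parallel> lid (src G) \<parallel> lid \<Omega>)"
    using ob F G by (simp add: ltens_lcomp del: lcomp_id ltens_lid)
  also have "\<dots> = (lid (\<Xi> @ trg F @ \<Theta>') \<parallel> G \<parallel> lid \<Omega>) \<bullet> (lid \<Xi> \<parallel> F \<parallel> lid (\<Theta>' @ src G @ \<Omega>))"
    using ob F G by (simp flip: ltens_lid)
  finally have a: "?m = \<dots>" .
  have "?m = (lid \<Xi> \<bullet> lid \<Xi>) \<parallel> (F \<bullet> lid (src F)) \<parallel> (lid \<Theta>' \<bullet> lid \<Theta>') \<parallel> (lid (trg G) \<bullet> G)
      \<parallel> (lid \<Omega> \<bullet> lid \<Omega>)"
    using ob F G by simp
  also have "\<dots> = (lid \<Xi> \<parallel> F \<parallel> lid \<Theta>' \<parallel> lid (trg G) \<parallel> lid \<Omega>)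
      \<bullet> (lid \<Xi> \<parallel> lid (src F) \<parallel> lid \<Theta>' \<parallel> G \<parallel> lid \<Omega>)"
    using ob F G by (simp add: ltens_lcomp del: lcomp_id ltens_lid)
  also have "\<dots> = (lid \<Xi> \<parallel> F \<parallel> lid (\<Theta>' @ trg G @ \<Omega>)) \<bullet> (lid (\<Xi> @ src F @ \<Theta>') \<parallel> G \<parallel> lid \<Omega>)"
    using ob F G by (simp flip: ltens_lid)
  finally have b: "?m = \<dots>" .
  have w: "wt (\<Xi> @ trg F @ \<Theta>' @ trg G @ \<Omega>) ds"
    using assms(1) 3(2) 4(1) by (simp del: after.simps fits.simps)
  have "ev \<Gamma> ds' = (ev (\<Xi> @ trg F @ \<Theta>' @ trg G @ \<Omega>) ds \<bullet> (lid \<Xi> \<parallel> F \<parallel> lid (\<Theta>' @ trg G @ \<Omega>)))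
      \<bullet> (lid (\<Xi> @ src F @ \<Theta>') \<parallel> G \<parallel> lid \<Omega>)"
    unfolding ds'_def using 1 2 by (simp del: after.simps lay.simps)
  also have "\<dots> = ev (\<Xi> @ trg F @ \<Theta>' @ trg G @ \<Omega>) ds \<bullet> ?m"
    unfolding b using ob F G w by (intro lcomp_assoc) simp_all
  also have "\<dots> = (ev (\<Xi> @ trg F @ \<Theta>' @ trg G @ \<Omega>) ds \<bullet> (lid (\<Xi> @ trg F @ \<Theta>') \<parallel> G \<parallel> lid \<Omega>))
      \<bullet> (lid \<Xi> \<parallel> F \<parallel> lid (\<Theta>' @ src G @ \<Omega>))"
    unfolding a using ob F G w by (intro lcomp_assoc[symmetric]) simp_all
  also have "\<dots> = ev \<Gamma> ((i, F) # (j, G) # ds)"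
    using 3 4 by (simp del: after.simps lay.simps)
  finally show ?thesis
    unfolding ds'_def using 1 2 w by (simp del: after.simps lay.simps fits.simps)
qed

lemma insert_layer_sound: "wt \<Gamma> (l # ds)
  \<Longrightarrow> wt \<Gamma> (insert_layer l ds) \<and> ev \<Gamma> (insert_layer l ds) = ev \<Gamma> (l # ds)"
proof (induction l ds arbitrary: \<Gamma> rule: insert_layer.induct)
  case (2 i F j G ds)
  show ?case
  proof (cases "i + length (trg F) \<le> j")
    case True
    let ?j = "j + length (src F) - length (trg F)"
    have e: "wt \<Gamma> ((?j, G) # (i, F) # ds)"
      "ev \<Gamma> ((?j, G) # (i, F) # ds) = ev \<Gamma> ((i, F) # (j, G) # ds)"
      using exchange_layers[OF 2(2) True] by auto
    have "wt (after \<Gamma> (?j, G)) ((i, F) # ds)"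
      using e(1) by (simp only: wt.simps)
    then have "wt (after \<Gamma> (?j, G)) (insert_layer (i, F) ds)
      \<and> ev (after \<Gamma> (?j, G)) (insert_layer (i, F) ds) = ev (after \<Gamma> (?j, G)) ((i, F) # ds)"
      by (rule 2(1)[OF True])
    then show ?thesis using True e by (simp del: after.simps lay.simps fits.simps)
  qed (use 2 in \<open>simp del: after.simps lay.simps fits.simps wt.simps ev.simps\<close>)
qed simp

lemma nf_sound: "wt \<Gamma> ds \<Longrightarrow> wt \<Gamma> (nf ds) \<and> ev \<Gamma> (nf ds) = ev \<Gamma> ds"
proof (induction ds arbitrary: \<Gamma>)
  case (Cons l ds)
  then have "wt (after \<Gamma> l) (nf ds) \<and> ev (after \<Gamma> l) (nf ds) = ev (after \<Gamma> l) ds" by simp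
  then show ?case using insert_layer_sound[of \<Gamma> l "nf ds"] Cons.prems by simp
qed simp

text \<open>
  Equality of diagrams includes their well-typedness, so that chains of equations need no separate
  typing argument.
\<close>

definition deq where "deq \<Gamma> xs ys \<longleftrightarrow> wt \<Gamma> xs \<and> wt \<Gamma> ys \<and> ev \<Gamma> xs = ev \<Gamma> ys"

lemma deq_trans [trans]: "deq \<Gamma> xs ys \<Longrightarrow> deq \<Gamma> ys zs \<Longrightarrow> deq \<Gamma> xs zs"
  and deq_sym: "deq \<Gamma> xs ys \<Longrightarrow> deq \<Gamma> ys xs"
  and deq_refl: "wt \<Gamma> xs \<Longrightarrow> deq \<Gamma> xs xs"
  by (simp_all add: deq_def)

lemma deq_out: "deq \<Gamma> xs ys \<Longrightarrow> out \<Gamma> xs = out \<Gamma> ys"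
  unfolding deq_def by (metis ev_arr(3))

lemma isotopy: "nf xs = nf ys \<Longrightarrow> wt \<Gamma> xs \<Longrightarrow> wt \<Gamma> ys \<Longrightarrow> deq \<Gamma> xs ys"
  using nf_sound[of \<Gamma> xs] nf_sound[of \<Gamma> ys] by (simp add: deq_def)

lemma context_split:
  assumes "take (length \<Gamma>') (drop i (out \<Gamma> pre)) = \<Gamma>'" "i + length \<Gamma>' \<le> length (out \<Gamma> pre)" "wt \<Gamma> pre"
  obtains \<Xi> \<Theta> where "out \<Gamma> pre = \<Xi> @ \<Gamma>' @ \<Theta>" "length \<Xi> = i" "set \<Xi> \<subseteq> Ob C" "set \<Theta> \<subseteq> Ob C"
proof -
  have 1: "out \<Gamma> pre = take i (out \<Gamma> pre) @ \<Gamma>' @ drop (i + length \<Gamma>') (out \<Gamma> pre)"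
    using assms(1) by (metis append_take_drop_id drop_drop add.commute)
  have "set (out \<Gamma> pre) \<subseteq> Ob C"
    using assms(3) ev_arr[of \<Gamma> pre] is_larrD(2) by fastforce
  then have "set (take i (out \<Gamma> pre)) \<subseteq> Ob C" "set (drop (i + length \<Gamma>') (out \<Gamma> pre)) \<subseteq> Ob C"
    using set_take_subset set_drop_subset by fastforce+
  then show ?thesis using that[OF 1] assms(2) by simp
qed

text \<open>
  The value of a diagram depends on a part \<open>xs\<close> only through the value of \<open>xs\<close>, and additively; this
  formula underlies rewriting with equations and with sums.
\<close>

lemma ev_in_context:
  assumes xs: "wt \<Gamma>' xs" and out: "out \<Gamma> pre = \<Xi> @ \<Gamma>' @ \<Theta>" and i: "length \<Xi> = i"
    and ob: "set \<Xi> \<subseteq> Ob C" "set \<Theta> \<subseteq> Ob C"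
    and w: "wt \<Gamma> pre" "wt (\<Xi> @ out \<Gamma>' xs @ \<Theta>) post"
  shows "wt \<Gamma> (pre @ shift i xs @ post)"
    and "out \<Gamma> (pre @ shift i xs @ post) = out (\<Xi> @ out \<Gamma>' xs @ \<Theta>) post"
    and "ev \<Gamma> (pre @ shift i xs @ post)
      = ev (\<Xi> @ out \<Gamma>' xs @ \<Theta>) post \<bullet> (lid \<Xi> \<parallel> ev \<Gamma>' xs \<parallel> lid \<Theta>) \<bullet> ev \<Gamma> pre"
proof -
  note sh = shift_whisker[OF xs ob i]
  show 1: "wt \<Gamma> (pre @ shift i xs @ post)"
    using w sh by (simp add: out)
  show "out \<Gamma> (pre @ shift i xs @ post) = out (\<Xi> @ out \<Gamma>' xs @ \<Theta>) post"
    using sh by (simp add: out)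
  show "ev \<Gamma> (pre @ shift i xs @ post)
      = ev (\<Xi> @ out \<Gamma>' xs @ \<Theta>) post \<bullet> (lid \<Xi> \<parallel> ev \<Gamma>' xs \<parallel> lid \<Theta>) \<bullet> ev \<Gamma> pre"
    using 1 w sh ob xs by (simp add: out lcomp_assoc)
qed

text \<open>
  One rewriting step: up to isotopy, \<open>ds\<close> contains \<open>xs\<close> between \<open>pre\<close> and \<open>post\<close>, at horizontal position
  \<open>i\<close>, and \<open>ds'\<close> has \<open>ys\<close> in its place.  For concrete diagrams all premises except the equation itself
  are settled by evaluation.
\<close>

lemma deq_rewrite:
  assumes r: "deq \<Gamma>' xs ys"
    and nf: "nf ds = nf (pre @ shift i xs @ post)" "nf ds' = nf (pre @ shift i ys @ post)"
    and w: "wt \<Gamma> ds" "wt \<Gamma> ds'" "wt \<Gamma> pre" "wt (out \<Gamma> (pre @ shift i xs)) post"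
    and m: "take (length \<Gamma>') (drop i (out \<Gamma> pre)) = \<Gamma>'" "i + length \<Gamma>' \<le> length (out \<Gamma> pre)"
  shows "deq \<Gamma> ds ds'"
proof -
  obtain \<Xi> \<Theta> where c: "out \<Gamma> pre = \<Xi> @ \<Gamma>' @ \<Theta>" "length \<Xi> = i" "set \<Xi> \<subseteq> Ob C" "set \<Theta> \<subseteq> Ob C"
    using context_split[OF m w(3)] .
  have xs: "wt \<Gamma>' xs" "wt \<Gamma>' ys" "ev \<Gamma>' xs = ev \<Gamma>' ys" "out \<Gamma>' ys = out \<Gamma>' xs"
    using r deq_out[OF r] by (auto simp: deq_def)
  have wp: "wt (\<Xi> @ out \<Gamma>' xs @ \<Theta>) post"
    using w(4) shift_whisker(2)[OF xs(1) c(3,4,2)] by (simp add: c(1))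
  have "deq \<Gamma> (pre @ shift i xs @ post) (pre @ shift i ys @ post)"
    unfolding deq_def
    using ev_in_context[OF xs(1) c w(3) wp] ev_in_context[OF xs(2) c w(3), unfolded xs(4), OF wp] xs(3)
    by metis
  then show ?thesis
    using isotopy[OF nf(1) w(1)] isotopy[OF nf(2) w(2)] deq_trans deq_sym unfolding deq_def by metis
qed

abbreviation \<sigma> where "\<sigma> A B \<equiv> lbr [A] [B]"

text \<open>
  The mirror image of the hexagon, by inverting both sides.
\<close>

lemma lbr_hexagon_left:
  assumes [simp]: "set \<Gamma> \<subseteq> Ob C" "set \<Delta> \<subseteq> Ob C" "set \<Theta> \<subseteq> Ob C"
  shows "lbr (\<Delta> @ \<Theta>) \<Gamma> = (lbr \<Delta> \<Gamma> \<parallel> lid \<Theta>) \<bullet> (lid \<Delta> \<parallel> lbr \<Theta> \<Gamma>)" (is "?l = ?r")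
proof -
  have 1: "(lbr \<Gamma> \<Delta> \<parallel> lid \<Theta>) \<bullet> (lbr \<Delta> \<Gamma> \<parallel> lid \<Theta>) = lid (\<Delta> @ \<Gamma> @ \<Theta>)"
    "(lid \<Delta> \<parallel> lbr \<Gamma> \<Theta>) \<bullet> (lid \<Delta> \<parallel> lbr \<Theta> \<Gamma>) = lid (\<Delta> @ \<Theta> @ \<Gamma>)"
    by (simp_all add: lbr_inverse flip: ltens_lcomp)
  have "lbr \<Gamma> (\<Delta> @ \<Theta>) \<bullet> ?r = (lid \<Delta> \<parallel> lbr \<Gamma> \<Theta>) \<bullet> ((lbr \<Gamma> \<Delta> \<parallel> lid \<Theta>) \<bullet> (lbr \<Delta> \<Gamma> \<parallel> lid \<Theta>))
      \<bullet> (lid \<Delta> \<parallel> lbr \<Theta> \<Gamma>)"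
    by (simp add: lbr_hexagon lcomp_assoc)
  then have "lbr \<Gamma> (\<Delta> @ \<Theta>) \<bullet> ?r = lid (\<Delta> @ \<Theta> @ \<Gamma>)"
    by (simp add: 1)
  then have "?l = (?l \<bullet> lbr \<Gamma> (\<Delta> @ \<Theta>)) \<bullet> ?r"
    by (simp add: lcomp_assoc)
  also have "\<dots> = ?r"
    by (simp add: lbr_inverse)
  finally show ?thesis .
qed

text \<open>
  Strands are moved past lists one object at a time.  Naturality of these moves
  (\<open>move_right_nat\<close>, \<open>move_left_nat\<close>) slides a strand past an arbitrary arrow.  For the arrow \<open>\<sigma> X X\<close> this is
  the Yang-Baxter equation.
\<close>

primrec move_right where
  "move_right Y [] = []"
| "move_right Y (A # \<Gamma>) = (0, \<sigma> Y A) # shift 1 (move_right Y \<Gamma>)"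

primrec move_left where
  "move_left [] Y = []"
| "move_left (A # \<Gamma>) Y = shift 1 (move_left \<Gamma> Y) @ [(0, \<sigma> A Y)]"

lemma move_right:
  assumes Y: "Y \<in> Ob C" and "set \<Gamma> \<subseteq> Ob C"
  shows "wt (Y # \<Gamma>) (move_right Y \<Gamma>) \<and> out (Y # \<Gamma>) (move_right Y \<Gamma>) = \<Gamma> @ [Y]
    \<and> ev (Y # \<Gamma>) (move_right Y \<Gamma>) = lbr [Y] \<Gamma>"
  using assms(2)
proof (induction \<Gamma>)
  case Nil
  then show ?case using Y by (simp add: lbr_Nil)
next
  case (Cons A \<Gamma>)
  then have "set \<Gamma> \<subseteq> Ob C" "A \<in> Ob C" by auto
  then show ?case
    using Cons.IH shift_whisker[of "Y # \<Gamma>" "move_right Y \<Gamma>" "[A]" "[]" 1] Y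
      lbr_hexagon[of "[Y]" "[A]" \<Gamma>] by simp
qed

lemma move_left:
  assumes Y: "Y \<in> Ob C" and "set \<Gamma> \<subseteq> Ob C"
  shows "wt (\<Gamma> @ [Y]) (move_left \<Gamma> Y) \<and> out (\<Gamma> @ [Y]) (move_left \<Gamma> Y) = Y # \<Gamma>
    \<and> ev (\<Gamma> @ [Y]) (move_left \<Gamma> Y) = lbr \<Gamma> [Y]"
  using assms(2)
proof (induction \<Gamma>)
  case Nil
  have "lbr [] [Y] = lid [Y]"
    using lbr_inverse[of "[Y]" "[]"] Y by (simp add: lbr_Nil)
  then show ?case using Y by simp
next
  case (Cons A \<Gamma>)
  then have "set \<Gamma> \<subseteq> Ob C" "A \<in> Ob C" by auto
  then show ?case
    using Cons.IH shift_whisker[of "\<Gamma> @ [Y]" "move_left \<Gamma> Y" "[A]" "[]" 1] Y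
      lbr_hexagon_left[of "[Y]" "[A]" \<Gamma>] by simp
qed

lemma move_right_nat:
  assumes "is_larr G" "Y \<in> Ob C"
  shows "deq (Y # src G) ((1, G) # move_right Y (trg G)) (move_right Y (src G) @ [(0, G)])"
proof -
  have "wt (Y # src G) (move_right Y (src G) @ [(0, G)])" using assms move_right[of Y "src G"] by simp
  then show ?thesis
  using assms move_right[of Y "src G"] move_right[of Y "trg G"] lbr_nat[of "lid [Y]" G]
  by (simp add: deq_def)
qed

lemma move_left_nat:
  assumes "is_larr G" "Y \<in> Ob C"
  shows "deq (src G @ [Y]) ((0, G) # move_left (trg G) Y) (move_left (src G) Y @ [(1, G)])"
proof -
  have "wt (src G @ [Y]) (move_left (src G) Y @ [(1, G)])" using assms move_left[of Y "src G"] by simp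
  then show ?thesis
  using assms move_left[of Y "src G"] move_left[of Y "trg G"] lbr_nat[of G "lid [Y]"]
  by (simp add: deq_def)
qed

lemma swap_swap: "A \<in> Ob C \<Longrightarrow> B \<in> Ob C \<Longrightarrow> deq [A, B] [(0, \<sigma> A B), (0, \<sigma> B A)] []"
  using lbr_inverse[of "[A]" "[B]"] by (simp add: deq_def)

end

section \<open>Reading diagrams as composites\<close>

context sym_monoidal_category
begin

text \<open>
  When the second list has at most two objects, \<open>flat\<close> is an associator, a unitor or an identity.  With these rules
  the simplifier turns the value of a small diagram into the expression that it depicts.
\<close>

lemma ob_eval [simp]: "ob [] = \<I>" "ob [A] = A" "ob [A, B] = A \<otimes> B" "ob [A, B, E] = A \<otimes> B \<otimes> E"
  "ob [A, B, E, F] = A \<otimes> B \<otimes> E \<otimes> F"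
  by (simp_all add: ob_def)

lemma flat'_eqI:
  assumes "flat \<Gamma> \<Delta> \<bullet> g = idm (ob (\<Gamma> @ \<Delta>))" "is_arr g" "trg g = ob \<Gamma> \<otimes> ob \<Delta>"
    and [simp]: "set \<Gamma> \<subseteq> Ob C" "set \<Delta> \<subseteq> Ob C"
  shows "flat' \<Gamma> \<Delta> = g"
proof (rule comp_left_cancel[where i = "flat \<Gamma> \<Delta>" and j = "flat' \<Gamma> \<Delta>"])
qed (use assms in simp_all)

lemma flat_single_eval [simp]:
  assumes [simp]: "set \<Gamma> \<subseteq> Ob C" "B \<in> Ob C" "\<Gamma> \<noteq> []"
  shows "flat \<Gamma> [B] = idm (ob \<Gamma> \<otimes> B)" and "flat' \<Gamma> [B] = idm (ob \<Gamma> \<otimes> B)"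
proof -
  show 1: "flat \<Gamma> [B] = idm (ob \<Gamma> \<otimes> B)" by (simp add: flat_single snoc_def)
  show "flat' \<Gamma> [B] = idm (ob \<Gamma> \<otimes> B)"
    by (rule flat'_eqI) (use 1 in \<open>simp_all add: ob_simps\<close>)
qed

lemma flat_pair_eval [simp]:
  assumes [simp]: "set \<Gamma> \<subseteq> Ob C" "B \<in> Ob C" "E \<in> Ob C" "\<Gamma> \<noteq> []"
  shows "flat \<Gamma> [B, E] = asc' (ob \<Gamma>) B E" and "flat' \<Gamma> [B, E] = asc (ob \<Gamma>) B E"
proof -
  show 1: "flat \<Gamma> [B, E] = asc' (ob \<Gamma>) B E"
    using flat_snoc[of \<Gamma> "[B]" E] by (simp add: snoc_def snoc'_def ob_simps)
  show "flat' \<Gamma> [B, E] = asc (ob \<Gamma>) B E"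
    using ob_simps(3)[of "\<Gamma> @ [B]" E]
    by (intro flat'_eqI) (use 1 in \<open>simp_all add: ob_simps\<close>)
qed

lemma flat_Nil_eval [simp]:
  "flat \<Gamma> [] = ru (ob \<Gamma>)" "flat' \<Gamma> [] = ru' (ob \<Gamma>)" "set \<Gamma> \<subseteq> Ob C \<Longrightarrow> flat [] \<Gamma> = lu (ob \<Gamma>)"
  by (simp_all add: flat_Nil flat'_Nil flat_Nil_left)

lemma mor_\<sigma> [simp]: "A \<in> Ob C \<Longrightarrow> B \<in> Ob C \<Longrightarrow> mor (\<sigma> A B) = \<s> A B"
proof -
  assume [simp]: "A \<in> Ob C" "B \<in> Ob C"
  have "ar (\<sigma> A B) = br A B" by simp
  then have "mor (ar (\<sigma> A B)) = \<s> A B" by simp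
  then show ?thesis by (simp del: ar_simps)
qed

lemma is_larr_iff_Hom: "is_larr (\<Gamma>, m, \<Delta>) \<longleftrightarrow>
  set \<Gamma> \<subseteq> Ob C \<and> set \<Delta> \<subseteq> Ob C \<and> m \<in> Hom C (ob \<Gamma>) (ob \<Delta>)"
  by (auto simp: is_larr_def is_arr_def simp del: is_arr_ob is_larrD)

lemma exch_arr: "A \<in> Ob C \<Longrightarrow> B \<in> Ob C \<Longrightarrow> E \<in> Ob C
  \<Longrightarrow> mor (asc' A E B \<bullet> (idm A \<diamond> br B E) \<bullet> asc A B E) = \<x> A B E"
  by (subst comp_arr_assoc[symmetric]) (simp_all add: exch_def del: comp_arr_assoc)

definition act where "act X A \<alpha> = ([A, X], \<alpha>, [A])"
definition gmap where "gmap A f B = ([A], f, [B])"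

lemma act_sel [simp]:
  "src (act X A \<alpha>) = [A, X]" "trg (act X A \<alpha>) = [A]" "mor (act X A \<alpha>) = \<alpha>"
  "src (gmap A f B) = [A]" "trg (gmap A f B) = [B]" "mor (gmap A f B) = f"
  by (simp_all add: act_def gmap_def)

end

section \<open>Sums of diagrams\<close>

context linear_sym_monoidal_category
begin

definition add_arr :: "('x, 'm) arrow \<Rightarrow> ('x, 'm) arrow \<Rightarrow> ('x, 'm) arrow" (infixl "\<boxplus>" 65)
  where "f \<boxplus> g = (src f, mor f \<oplus> mor g, trg f)"

lemma add_arr_sel [simp]: "src (f \<boxplus> g) = src f" "trg (f \<boxplus> g) = trg f" "mor (f \<boxplus> g) = mor f \<oplus> mor g"
  by (simp_all add: add_arr_def)

lemma is_arr_add [simp]: "is_arr f \<Longrightarrow> is_arr g \<Longrightarrow> src g = src f \<Longrightarrow> trg g = trg f \<Longrightarrow> is_arr (f \<boxplus> g)"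
  using add_in[of "src f" "trg f" "mor f" "mor g"] by (simp add: is_arr_def del: is_arr_ob)

lemma comp_arr_add:
  assumes "is_arr f" "is_arr g" "is_arr f'" "src f' = src f" "trg f' = trg f" "src g = trg f"
  shows "g \<bullet> (f \<boxplus> f') = g \<bullet> f \<boxplus> g \<bullet> f'"
  using assms comp_add_right[of "src f" "trg f" "trg g" "mor f" "mor f'" "mor g"]
  by (intro arrow_eqI) (simp_all add: is_arr_def del: is_arr_ob)

lemma add_arr_comp:
  assumes "is_arr f" "is_arr g" "is_arr g'" "src g' = src g" "trg g' = trg g" "src g = trg f"
  shows "(g \<boxplus> g') \<bullet> f = g \<bullet> f \<boxplus> g' \<bullet> f"
  using assms comp_add_left[of "src f" "trg f" "trg g" "mor f" "mor g" "mor g'"]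
  by (intro arrow_eqI) (simp_all add: is_arr_def del: is_arr_ob)

lemma add_arr_tens:
  assumes "is_arr f" "is_arr f'" "is_arr h" "src f' = src f" "trg f' = trg f"
  shows "(f \<boxplus> f') \<diamond> h = f \<diamond> h \<boxplus> f' \<diamond> h" and "h \<diamond> (f \<boxplus> f') = h \<diamond> f \<boxplus> h \<diamond> f'"
  using assms tensor_add_left[of "src f" "trg f" "src h" "trg h" "mor f" "mor f'" "mor h"]
    tensor_add_right[of "src h" "trg h" "src f" "trg f" "mor h" "mor f" "mor f'"]
  by (auto intro!: arrow_eqI simp: is_arr_def simp del: is_arr_ob)

lemma ar_add [simp]: "ar (F \<boxplus> G) = ar F \<boxplus> ar G"
  by (simp add: ar_def add_arr_def)

lemma is_larr_add [simp]: "is_larr F \<Longrightarrow> is_larr G \<Longrightarrow> src G = src F \<Longrightarrow> trg G = trg F \<Longrightarrow> is_larr (F \<boxplus> G)"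
  by (simp add: is_larr_def del: is_larrD)

lemma ltens_add:
  assumes "is_larr F" "is_larr F'" "is_larr H" "src F' = src F" "trg F' = trg F"
  shows "(F \<boxplus> F') \<parallel> H = F \<parallel> H \<boxplus> F' \<parallel> H" and "H \<parallel> (F \<boxplus> F') = H \<parallel> F \<boxplus> H \<parallel> F'"
  using assms by (auto intro!: larr_eqI simp: add_arr_tens comp_arr_add add_arr_comp)

lemma lcomp_add:
  assumes "is_larr F" "is_larr F'" "src F' = src F" "trg F' = trg F"
  shows "is_larr H \<Longrightarrow> src H = trg F \<Longrightarrow> H \<bullet> (F \<boxplus> F') = H \<bullet> F \<boxplus> H \<bullet> F'"
    and "is_larr K \<Longrightarrow> src F = trg K \<Longrightarrow> (F \<boxplus> F') \<bullet> K = F \<bullet> K \<boxplus> F' \<bullet> K"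
  using assms by (auto intro!: larr_eqI simp: add_arr_tens comp_arr_add add_arr_comp)

text \<open>
  No diagram below splits into more than two summands at once, so that formal sums of diagrams are not
  needed.
\<close>

definition dsum where
  "dsum \<Gamma> xs ys zs \<longleftrightarrow> wt \<Gamma> xs \<and> wt \<Gamma> ys \<and> wt \<Gamma> zs \<and> out \<Gamma> ys = out \<Gamma> xs \<and> out \<Gamma> zs = out \<Gamma> xs
    \<and> ev \<Gamma> xs = ev \<Gamma> ys \<boxplus> ev \<Gamma> zs"

text \<open>
  A rewriting step with an equation whose right-hand side is a sum; the rest of the diagram
  distributes over it.
\<close>

lemma dsum_rewrite:
  assumes r: "dsum \<Gamma>' xs ys zs"
    and nf: "nf ds = nf (pre @ shift i xs @ post)"
      "nf ds' = nf (pre @ shift i ys @ post)" "nf ds'' = nf (pre @ shift i zs @ post)"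
    and w: "wt \<Gamma> ds" "wt \<Gamma> ds'" "wt \<Gamma> ds''" "wt \<Gamma> pre" "wt (out \<Gamma> (pre @ shift i xs)) post"
    and m: "take (length \<Gamma>') (drop i (out \<Gamma> pre)) = \<Gamma>'" "i + length \<Gamma>' \<le> length (out \<Gamma> pre)"
  shows "dsum \<Gamma> ds ds' ds''"
proof -
  obtain \<Xi> \<Theta> where c: "out \<Gamma> pre = \<Xi> @ \<Gamma>' @ \<Theta>" "length \<Xi> = i" "set \<Xi> \<subseteq> Ob C" "set \<Theta> \<subseteq> Ob C"
    using context_split[OF m w(4)] .
  have xs: "wt \<Gamma>' xs" "wt \<Gamma>' ys" "wt \<Gamma>' zs" "ev \<Gamma>' xs = ev \<Gamma>' ys \<boxplus> ev \<Gamma>' zs"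
    "out \<Gamma>' ys = out \<Gamma>' xs" "out \<Gamma>' zs = out \<Gamma>' xs"
    using r by (auto simp: dsum_def)
  have wp: "wt (\<Xi> @ out \<Gamma>' xs @ \<Theta>) post"
    using w(5) shift_whisker(2)[OF xs(1) c(3,4,2)] by (simp add: c(1))
  note x = ev_in_context[OF xs(1) c w(4) wp]
  note y = ev_in_context[OF xs(2) c w(4), unfolded xs(5), OF wp]
  note z = ev_in_context[OF xs(3) c w(4), unfolded xs(6), OF wp]
  have "ev \<Gamma> (pre @ shift i xs @ post)
    = ev \<Gamma> (pre @ shift i ys @ post) \<boxplus> ev \<Gamma> (pre @ shift i zs @ post)"
    unfolding x(3) y(3) z(3) xs(4) using w(4) wp xs(1,2,3,5,6) c
    by (simp add: ltens_add lcomp_add)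
  moreover have r: "deq \<Gamma> ds (pre @ shift i xs @ post)" "deq \<Gamma> ds' (pre @ shift i ys @ post)"
    "deq \<Gamma> ds'' (pre @ shift i zs @ post)"
    using isotopy nf w(1-3) x(1) y(1) z(1) by blast+
  moreover have "out \<Gamma> ds' = out \<Gamma> ds" "out \<Gamma> ds'' = out \<Gamma> ds"
    using r[THEN deq_out] x(2) y(2) z(2) by simp_all
  ultimately show ?thesis
    using w(1-3) unfolding dsum_def deq_def by metis
qed

end

section \<open>The axioms of a differential modality as diagrams\<close>

context differential_modality
begin

abbreviation ban ("\<B>") where "\<B> A \<equiv> bang D A"

text \<open>
  The structural maps as generators of diagrams.  The map \<open>bor A\<close>, which borrows one argument, is
  treated as a generator of its own because most of the calculation takes place at this level.
\<close>

definition "der A = ([\<B> A, A], deriving D A, [\<B> A])"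
definition "cop A = ([\<B> A], copy D A, [\<B> A, \<B> A])"
definition "dis A = ([\<B> A], discard D A, [])"
definition "cou A = ([\<B> A], counit D A, [A])"
definition "com A = ([\<B> A], comult D A, [\<B> (\<B> A)])"
definition "bor A = ([\<B> A], borrow C D A, [\<B> A, A])"

lemma gen_sel [simp]:
  "src (der A) = [\<B> A, A]" "trg (der A) = [\<B> A]" "mor (der A) = deriving D A"
  "src (cop A) = [\<B> A]" "trg (cop A) = [\<B> A, \<B> A]" "mor (cop A) = copy D A"
  "src (dis A) = [\<B> A]" "trg (dis A) = []" "mor (dis A) = discard D A"
  "src (cou A) = [\<B> A]" "trg (cou A) = [A]" "mor (cou A) = counit D A"
  "src (com A) = [\<B> A]" "trg (com A) = [\<B> (\<B> A)]" "mor (com A) = comult D A"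
  "src (bor A) = [\<B> A]" "trg (bor A) = [\<B> A, A]" "mor (bor A) = borrow C D A"
  by (simp_all add: der_def cop_def dis_def cou_def com_def bor_def)

declare bang_in [simp]

lemma is_larr_gen [simp]:
  assumes "A \<in> Ob C"
  shows "is_larr (der A)" "is_larr (cop A)" "is_larr (dis A)" "is_larr (cou A)" "is_larr (com A)"
  using assms by (simp_all add: der_def cop_def dis_def cou_def com_def is_larr_iff_Hom
    deriving_in copy_in discard_in counit_in comult_in)

lemma borrow_arr: "A \<in> Ob C \<Longrightarrow> ar (bor A) = (idm (\<B> A) \<diamond> ar (cou A)) \<bullet> ar (cop A)"
  by (rule arrow_eqI) (simp_all add: borrow_def)

lemma is_larr_bor [simp]: "A \<in> Ob C \<Longrightarrow> is_larr (bor A)"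
  unfolding is_larr_def[of "bor A"] borrow_arr by simp

lemma borrow_deq: "A \<in> Ob C \<Longrightarrow> deq [\<B> A] [(0, bor A)] [(0, cop A), (1, cou A)]"
  unfolding deq_def by (auto intro!: larr_eqI simp: borrow_arr)

lemma linear_deq: "A \<in> Ob C \<Longrightarrow> deq [\<B> A, A] [(0, der A), (0, cou A)] [(0, dis A)]"
proof -
  assume [simp]: "A \<in> Ob C"
  have "ar (cou A) \<bullet> ar (der A) = lu A \<bullet> (ar (dis A) \<diamond> idm A)"
    using linear_rule[of A] by (intro arrow_eqI) simp_all
  then show ?thesis
  unfolding deq_def by (auto intro!: larr_eqI)
qed

lemma interchange_deq: "A \<in> Ob C
  \<Longrightarrow> deq [\<B> A, A, A] [(1, \<sigma> A A), (0, der A), (0, der A)] [(0, der A), (0, der A)]"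
proof -
  assume [simp]: "A \<in> Ob C"
  have "(ar (der A) \<bullet> (ar (der A) \<diamond> idm A)) \<bullet> (asc' (\<B> A) A A \<bullet> (idm (\<B> A) \<diamond> br A A) \<bullet> asc (\<B> A) A A)
    = ar (der A) \<bullet> (ar (der A) \<diamond> idm A)"
    using interchange_rule[of A] exch_arr[of "\<B> A" A A]
    by (intro arrow_eqI) (simp_all del: comp_arr_assoc)
  then show ?thesis
  unfolding deq_def by (auto intro!: larr_eqI)
qed

lemma chain_deq: "A \<in> Ob C
  \<Longrightarrow> deq [\<B> A, A] [(0, der A), (0, com A)] [(0, cop A), (1, der A), (0, com A), (0, der (\<B> A))]"
proof -
  assume [simp]: "A \<in> Ob C"
  have "(ar (com A) \<bullet> ar (der A)) = ((ar (der (\<B> A)) \<bullet> (ar (com A) \<diamond> ar (der A)))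
      \<bullet> asc (\<B> A) (\<B> A) A) \<bullet> (ar (cop A) \<diamond> idm A)"
    using chain_rule[of A] by (intro arrow_eqI) (simp_all del: comp_arr_assoc)
  moreover have "ar (com A) \<diamond> ar (der A) = (ar (com A) \<diamond> idm (\<B> A)) \<bullet> (idm (\<B> A) \<diamond> ar (der A))"
    by (simp flip: tens_comp)
  ultimately show ?thesis
  unfolding deq_def by (auto intro!: larr_eqI)
qed

lemma product_dsum: "A \<in> Ob C \<Longrightarrow> dsum [\<B> A, A] [(0, der A), (0, cop A)]
  [(0, cop A), (1, der A)] [(0, cop A), (1, \<sigma> (\<B> A) A), (0, der A)]"
proof -
  assume [simp]: "A \<in> Ob C"
  have "ar (cop A) \<bullet> ar (der A) = ((idm (\<B> A) \<diamond> ar (der A)) \<bullet> asc (\<B> A) (\<B> A) A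
      \<boxplus> (ar (der A) \<diamond> idm (\<B> A)) \<bullet> (asc' (\<B> A) A (\<B> A) \<bullet> (idm (\<B> A) \<diamond> br (\<B> A) A)
          \<bullet> asc (\<B> A) (\<B> A) A)) \<bullet> (ar (cop A) \<diamond> idm A)"
    using product_rule[of A] exch_arr[of "\<B> A" "\<B> A" A]
    by (intro arrow_eqI) (simp_all del: comp_arr_assoc)
  then show ?thesis
  unfolding dsum_def by (auto intro!: larr_eqI simp: add_arr_comp)
qed

lemma coassoc_deq: "A \<in> Ob C \<Longrightarrow> deq [\<B> A] [(0, cop A), (0, cop A)] [(0, cop A), (1, cop A)]"
proof -
  assume [simp]: "A \<in> Ob C"
  have "(asc (\<B> A) (\<B> A) (\<B> A) \<bullet> (ar (cop A) \<diamond> idm (\<B> A))) \<bullet> ar (cop A)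
    = (idm (\<B> A) \<diamond> ar (cop A)) \<bullet> ar (cop A)"
    using comonoid_assoc[of A] by (intro arrow_eqI) (simp_all del: comp_arr_assoc)
  then have "asc' (\<B> A) (\<B> A) (\<B> A) \<bullet> asc (\<B> A) (\<B> A) (\<B> A) \<bullet> (ar (cop A) \<diamond> idm (\<B> A)) \<bullet> ar (cop A)
    = asc' (\<B> A) (\<B> A) (\<B> A) \<bullet> (idm (\<B> A) \<diamond> ar (cop A)) \<bullet> ar (cop A)"
    by simp
  then show ?thesis
  unfolding deq_def by (auto intro!: larr_eqI)
qed

lemma cocomm_deq: "A \<in> Ob C \<Longrightarrow> deq [\<B> A] [(0, cop A), (0, \<sigma> (\<B> A) (\<B> A))] [(0, cop A)]"
proof -
  assume [simp]: "A \<in> Ob C"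
  have "br (\<B> A) (\<B> A) \<bullet> ar (cop A) = ar (cop A)"
    using comonoid_commute[of A] by (intro arrow_eqI) simp_all
  then show ?thesis
  unfolding deq_def by (auto intro!: larr_eqI)
qed

lemma counit_right_deq: "A \<in> Ob C \<Longrightarrow> deq [\<B> A] [(0, cop A), (1, dis A)] []"
  and counit_left_deq: "A \<in> Ob C \<Longrightarrow> deq [\<B> A] [(0, cop A), (0, dis A)] []"
proof -
  assume [simp]: "A \<in> Ob C"
  have "(ru (\<B> A) \<bullet> (idm (\<B> A) \<diamond> ar (dis A))) \<bullet> ar (cop A) = idm (\<B> A)"
    using comonoid_unit_right[of A] by (intro arrow_eqI) (simp_all del: comp_arr_assoc)
  then show "deq [\<B> A] [(0, cop A), (1, dis A)] []"
    unfolding deq_def by (auto intro!: larr_eqI)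
  have "(lu (\<B> A) \<bullet> (ar (dis A) \<diamond> idm (\<B> A))) \<bullet> ar (cop A) = idm (\<B> A)"
    using comonoid_unit_left[of A] by (intro arrow_eqI) (simp_all del: comp_arr_assoc)
  then show "deq [\<B> A] [(0, cop A), (0, dis A)] []"
    unfolding deq_def by (auto intro!: larr_eqI)
qed

lemma comult_copy_deq: "A \<in> Ob C
  \<Longrightarrow> deq [\<B> A] [(0, com A), (0, cop (\<B> A))] [(0, cop A), (0, com A), (1, com A)]"
proof -
  assume [simp]: "A \<in> Ob C"
  have "ar (com A) \<diamond> ar (com A) = (idm (\<B> (\<B> A)) \<diamond> ar (com A)) \<bullet> (ar (com A) \<diamond> idm (\<B> A))"
    by (simp flip: tens_comp)
  moreover have "ar (cop (\<B> A)) \<bullet> ar (com A) = (ar (com A) \<diamond> ar (com A)) \<bullet> ar (cop A)"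
    using comult_copy[of A] by (intro arrow_eqI) (simp_all del: comp_arr_assoc)
  ultimately show ?thesis
  unfolding deq_def by (auto intro!: larr_eqI)
qed

lemma comonad_unit_deq: "A \<in> Ob C \<Longrightarrow> deq [\<B> A] [(0, com A), (0, cou (\<B> A))] []"
proof -
  assume [simp]: "A \<in> Ob C"
  have "ar (cou (\<B> A)) \<bullet> ar (com A) = idm (\<B> A)"
    using comonad_unit_left[of A] by (intro arrow_eqI) simp_all
  then show ?thesis
  unfolding deq_def by (auto intro!: larr_eqI)
qed

end

section \<open>Calculating with sums\<close>

context linear_sym_monoidal_category
begin

lemma dsum_cong:
  assumes "dsum \<Gamma> xs ys zs" "deq \<Gamma> xs' xs" "deq \<Gamma> ys ys'" "deq \<Gamma> zs zs'"
  shows "dsum \<Gamma> xs' ys' zs'"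
  using assms deq_out[OF assms(2)] deq_out[OF assms(3)] deq_out[OF assms(4)]
  unfolding dsum_def deq_def by auto

lemma dsum_unique:
  assumes "dsum \<Gamma> xs ys zs" "dsum \<Gamma> xs' ys' zs'" "deq \<Gamma> ys ys'" "deq \<Gamma> zs zs'"
  shows "deq \<Gamma> xs xs'"
  using assms unfolding dsum_def deq_def by auto

lemma add_arr_commute: "is_larr F \<Longrightarrow> is_larr G \<Longrightarrow> src G = src F \<Longrightarrow> trg G = trg F \<Longrightarrow> F \<boxplus> G = G \<boxplus> F"
  using add_commute[of "ob (src F)" "ob (trg F)" "mor F" "mor G"]
  by (intro arrow_eqI) (simp_all add: is_larr_def is_arr_def del: is_larrD is_arr_ob)

lemma add_arr_assoc: "is_larr F \<Longrightarrow> is_larr G \<Longrightarrow> is_larr H \<Longrightarrow> src G = src F \<Longrightarrow> trg G = trg F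
  \<Longrightarrow> src H = src F \<Longrightarrow> trg H = trg F \<Longrightarrow> (F \<boxplus> G) \<boxplus> H = F \<boxplus> (G \<boxplus> H)"
  using add_assoc[of "ob (src F)" "ob (trg F)" "mor F" "mor G" "mor H"]
  by (intro arrow_eqI) (simp_all add: is_larr_def is_arr_def del: is_larrD is_arr_ob)

lemma dsum_commute: "dsum \<Gamma> xs ys zs \<Longrightarrow> dsum \<Gamma> xs zs ys"
  unfolding dsum_def using add_arr_commute[of "ev \<Gamma> ys" "ev \<Gamma> zs"] by auto

text \<open>
  Two sums of four terms, with the two mixed terms in opposite order.
\<close>

lemma dsum_cross:
  assumes "dsum \<Gamma> xs p q" "dsum \<Gamma> p a b" "dsum \<Gamma> q c d"
    and "dsum \<Gamma> xs' p' q'" "dsum \<Gamma> p' a' b'" "dsum \<Gamma> q' c' d'"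
    and "deq \<Gamma> a a'" "deq \<Gamma> b c'" "deq \<Gamma> c b'" "deq \<Gamma> d d'"
  shows "deq \<Gamma> xs xs'"
proof -
  have w: "wt \<Gamma> a" "wt \<Gamma> b" "wt \<Gamma> c" "wt \<Gamma> d" "wt \<Gamma> xs" "wt \<Gamma> xs'"
    and o: "out \<Gamma> a = out \<Gamma> xs" "out \<Gamma> b = out \<Gamma> xs" "out \<Gamma> c = out \<Gamma> xs" "out \<Gamma> d = out \<Gamma> xs"
    using assms by (auto simp: dsum_def)
  let ?a = "ev \<Gamma> a" and ?b = "ev \<Gamma> b" and ?c = "ev \<Gamma> c" and ?d = "ev \<Gamma> d"
  have "ev \<Gamma> xs = (?a \<boxplus> ?b) \<boxplus> (?c \<boxplus> ?d)"
    using assms by (auto simp: dsum_def)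
  also have "\<dots> = ?a \<boxplus> ((?b \<boxplus> ?c) \<boxplus> ?d)"
    using w o by (simp add: add_arr_assoc)
  also have "?b \<boxplus> ?c = ?c \<boxplus> ?b"
    using w o by (intro add_arr_commute) simp_all
  also have "?a \<boxplus> ((?c \<boxplus> ?b) \<boxplus> ?d) = (?a \<boxplus> ?c) \<boxplus> (?b \<boxplus> ?d)"
    using w o by (simp add: add_arr_assoc)
  also have "\<dots> = ev \<Gamma> xs'"
    using assms by (auto simp: dsum_def deq_def)
  finally show ?thesis using w by (simp add: deq_def)
qed

end

section \<open>Borrowing an argument\<close>

context differential_modality
begin

context
  fixes A assumes A [simp]: "A \<in> Ob C"
begin

text \<open>
  Copying what remains after borrowing amounts to borrowing from the second copy, by coassociativity.
  Cocommutativity adds that the argument may come from either copy (\<open>cop_bor_swap\<close>) and that two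
  borrowed arguments may be exchanged (\<open>bor_bor_swap\<close>).
\<close>

lemma bor_cop: "deq [\<B> A] [(0, bor A), (0, cop A)] [(0, cop A), (1, bor A)]"
proof -
  have "deq [\<B> A] [(0, bor A), (0, cop A)] [(0, cop A), (1, cou A), (0, cop A)]"
    by (rule deq_rewrite[OF borrow_deq, where pre = "[]" and i = 0 and post = "[(0, cop A)]"]) simp_all
  also have "deq [\<B> A] \<dots> [(0, cop A), (1, cop A), (2, cou A)]"
    by (rule deq_rewrite[OF coassoc_deq, where pre = "[]" and i = 0 and post = "[(2, cou A)]"]) simp_all
  also have "deq [\<B> A] \<dots> [(0, cop A), (1, bor A)]"
    by (rule deq_rewrite[OF borrow_deq[THEN deq_sym], where pre = "[(0, cop A)]" and i = 1 and post = "[]"])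
      simp_all
  finally show ?thesis .
qed

lemma cop_bor_swap: "deq [\<B> A] [(0, cop A), (0, bor A), (1, \<sigma> A (\<B> A))] [(0, cop A), (1, bor A)]"
proof -
  have "deq [\<B> A] [(0, cop A), (0, bor A), (1, \<sigma> A (\<B> A))]
      [(0, cop A), (0, cop A), (1, cou A), (1, \<sigma> A (\<B> A))]"
    by (rule deq_rewrite[OF borrow_deq, where pre = "[(0, cop A)]" and i = 0
          and post = "[(1, \<sigma> A (\<B> A))]"]) simp_all
  also have "deq [\<B> A] \<dots> [(0, cop A), (0, cop A), (1, \<sigma> (\<B> A) (\<B> A)), (2, cou A)]"
    by (rule deq_rewrite[OF move_left_nat[of "cou A" "\<B> A"], where pre = "[(0, cop A), (0, cop A)]"
          and i = 1 and post = "[]"]) simp_all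
  also have "deq [\<B> A] \<dots> [(0, cop A), (1, cop A), (1, \<sigma> (\<B> A) (\<B> A)), (2, cou A)]"
    by (rule deq_rewrite[OF coassoc_deq, where pre = "[]" and i = 0
          and post = "[(1, \<sigma> (\<B> A) (\<B> A)), (2, cou A)]"]) simp_all
  also have "deq [\<B> A] \<dots> [(0, cop A), (1, cop A), (2, cou A)]"
    by (rule deq_rewrite[OF cocomm_deq, where pre = "[(0, cop A)]" and i = 1 and post = "[(2, cou A)]"])
      simp_all
  also have "deq [\<B> A] \<dots> [(0, cop A), (1, bor A)]"
    by (rule deq_rewrite[OF borrow_deq[THEN deq_sym], where pre = "[(0, cop A)]" and i = 1 and post = "[]"])
      simp_all
  finally show ?thesis .
qed

lemma bor_bor_swap: "deq [\<B> A] [(0, bor A), (0, bor A), (1, \<sigma> A A)] [(0, bor A), (0, bor A)]"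
proof -
  have "deq [\<B> A] [(0, bor A), (0, bor A), (1, \<sigma> A A)]
      [(0, cop A), (0, bor A), (2, cou A), (1, \<sigma> A A)]"
    by (rule deq_rewrite[OF borrow_deq, where pre = "[]" and i = 0
          and post = "[(0, bor A), (1, \<sigma> A A)]"]) simp_all
  also have "deq [\<B> A] \<dots> [(0, cop A), (0, bor A), (1, \<sigma> A (\<B> A)), (1, cou A)]"
    by (rule deq_rewrite[OF move_right_nat[of "cou A" A], where pre = "[(0, cop A), (0, bor A)]"
          and i = 1 and post = "[]"]) simp_all
  also have "deq [\<B> A] \<dots> [(0, cop A), (1, bor A), (1, cou A)]"
    by (rule deq_rewrite[OF cop_bor_swap, where pre = "[]" and i = 0 and post = "[(1, cou A)]"]) simp_all
  also have "deq [\<B> A] \<dots> [(0, bor A), (0, cop A), (1, cou A)]"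
    by (rule deq_rewrite[OF bor_cop[THEN deq_sym], where pre = "[]" and i = 0 and post = "[(1, cou A)]"])
      simp_all
  also have "deq [\<B> A] \<dots> [(0, bor A), (0, bor A)]"
    by (rule deq_rewrite[OF borrow_deq[THEN deq_sym], where pre = "[(0, bor A)]" and i = 0 and post = "[]"])
      simp_all
  finally show ?thesis .
qed

text \<open>
  Borrowing after \<open>\<delta>\<close> yields an element of \<open>!A\<close>, and \<open>\<epsilon> \<delta> = 1\<close> shows that it is just a copy.
\<close>

lemma com_bor: "deq [\<B> A] [(0, com A), (0, bor (\<B> A))] [(0, cop A), (0, com A)]"
proof -
  have "deq [\<B> A] [(0, com A), (0, bor (\<B> A))] [(0, com A), (0, cop (\<B> A)), (1, cou (\<B> A))]"
    by (rule deq_rewrite[OF borrow_deq, where pre = "[(0, com A)]" and i = 0 and post = "[]"]) simp_all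
  also have "deq [\<B> A] \<dots> [(0, cop A), (0, com A), (1, com A), (1, cou (\<B> A))]"
    by (rule deq_rewrite[OF comult_copy_deq, where pre = "[]" and i = 0 and post = "[(1, cou (\<B> A))]"])
      simp_all
  also have "deq [\<B> A] \<dots> [(0, cop A), (0, com A)]"
    by (rule deq_rewrite[OF comonad_unit_deq, where pre = "[(0, cop A), (0, com A)]" and i = 1 and post = "[]"])
      simp_all
  finally show ?thesis .
qed

lemma bor_dis: "deq [\<B> A] [(0, bor A), (0, dis A)] [(0, cou A)]"
proof -
  have "deq [\<B> A] [(0, bor A), (0, dis A)] [(0, cop A), (1, cou A), (0, dis A)]"
    by (rule deq_rewrite[OF borrow_deq, where pre = "[]" and i = 0 and post = "[(0, dis A)]"]) simp_all
  also have "deq [\<B> A] \<dots> [(0, cou A)]"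
    by (rule deq_rewrite[OF counit_left_deq, where pre = "[]" and i = 0 and post = "[(0, cou A)]"]) simp_all
  finally show ?thesis .
qed

text \<open>
  The argument borrowed after a differentiation is either the direction of differentiation or an
  old argument.  The product rule gives two terms; in the first one \<open>\<epsilon> d\<close> is computed by the linear
  rule, and the discarded copy disappears by the counit law.
\<close>

lemma der_bor: "dsum [\<B> A, A] [(0, der A), (0, bor A)] [] [(0, bor A), (1, \<sigma> A A), (0, der A)]"
proof (rule dsum_cong)
  show "dsum [\<B> A, A] [(0, der A), (0, cop A), (1, cou A)]
    [(0, cop A), (1, der A), (1, cou A)] [(0, cop A), (1, \<sigma> (\<B> A) A), (0, der A), (1, cou A)]"
    by (rule dsum_rewrite[OF product_dsum, where pre = "[]" and i = 0 and post = "[(1, cou A)]"]) simp_all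
  show "deq [\<B> A, A] [(0, der A), (0, bor A)] [(0, der A), (0, cop A), (1, cou A)]"
    by (rule deq_rewrite[OF borrow_deq, where pre = "[(0, der A)]" and i = 0 and post = "[]"]) simp_all
  have "deq [\<B> A, A] [(0, cop A), (1, der A), (1, cou A)] [(0, cop A), (1, dis A)]"
    by (rule deq_rewrite[OF linear_deq, where pre = "[(0, cop A)]" and i = 1 and post = "[]"]) simp_all
  also have "deq [\<B> A, A] \<dots> []"
    by (rule deq_rewrite[OF counit_right_deq, where pre = "[]" and i = 0 and post = "[]"]) simp_all
  finally show "deq [\<B> A, A] [(0, cop A), (1, der A), (1, cou A)] []" .
  have "deq [\<B> A, A] [(0, cop A), (1, \<sigma> (\<B> A) A), (0, der A), (1, cou A)]
      [(0, cop A), (1, cou A), (1, \<sigma> A A), (0, der A)]"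
    by (rule deq_rewrite[OF move_left_nat[of "cou A" A, THEN deq_sym], where pre = "[(0, cop A)]"
          and i = 1 and post = "[(0, der A)]"]) simp_all
  also have "deq [\<B> A, A] \<dots> [(0, bor A), (1, \<sigma> A A), (0, der A)]"
    by (rule deq_rewrite[OF borrow_deq[THEN deq_sym], where pre = "[]" and i = 0
          and post = "[(1, \<sigma> A A), (0, der A)]"]) simp_all
  finally show "deq [\<B> A, A] [(0, cop A), (1, \<sigma> (\<B> A) A), (0, der A), (1, cou A)]
      [(0, bor A), (1, \<sigma> A A), (0, der A)]" .
qed

end

end

section \<open>The lifted action\<close>

context sym_monoidal_category
begin

lemma is_larr_act: "A \<in> Ob C \<Longrightarrow> X \<in> Ob C \<Longrightarrow> is_larr (act X A \<alpha>) \<longleftrightarrow> \<alpha> \<in> Hom C (A \<otimes> X) A"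
  by (simp add: act_def is_larr_iff_Hom)

lemma is_larr_gmap: "A \<in> Ob C \<Longrightarrow> B \<in> Ob C \<Longrightarrow> is_larr (gmap A f B) \<longleftrightarrow> f \<in> Hom C A B"
  by (simp add: gmap_def is_larr_iff_Hom)

lemma commuting_deq:
  assumes [simp]: "A \<in> Ob C" "X \<in> Ob C" "is_larr (act X A \<alpha>)"
  shows "deq [A, X, X] [(1, \<sigma> X X), (0, act X A \<alpha>), (0, act X A \<alpha>)] [(0, act X A \<alpha>), (0, act X A \<alpha>)]
    \<longleftrightarrow> \<alpha> \<cdot> (\<alpha> \<star> \<one> X) \<cdot> \<x> A X X = \<alpha> \<cdot> (\<alpha> \<star> \<one> X)"
proof -
  let ?t = "ar (act X A \<alpha>)"
  have "\<alpha> \<cdot> (\<alpha> \<star> \<one> X) \<cdot> \<x> A X X = \<alpha> \<cdot> (\<alpha> \<star> \<one> X) \<longleftrightarrow>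
    mor ((?t \<bullet> (?t \<diamond> idm X)) \<bullet> (asc' A X X \<bullet> (idm A \<diamond> br X X) \<bullet> asc A X X))
      = mor (?t \<bullet> (?t \<diamond> idm X))"
    using exch_arr[of A X X] by (simp del: comp_arr_assoc)
  also have "\<dots> \<longleftrightarrow> (?t \<bullet> (?t \<diamond> idm X)) \<bullet> (asc' A X X \<bullet> (idm A \<diamond> br X X) \<bullet> asc A X X)
      = ?t \<bullet> (?t \<diamond> idm X)"
    by (rule iffI, rule arrow_eqI) (simp_all del: comp_arr_assoc mor_comp mor_tens)
  also have "\<dots> \<longleftrightarrow> deq [A, X, X] [(1, \<sigma> X X), (0, act X A \<alpha>), (0, act X A \<alpha>)]
      [(0, act X A \<alpha>), (0, act X A \<alpha>)]"
    (is "?l \<longleftrightarrow> deq ?G ?x ?y")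
  proof -
    have "deq ?G ?x ?y \<longleftrightarrow> ev ?G ?x = ev ?G ?y" by (simp add: deq_def)
    also have "\<dots> \<longleftrightarrow> ar (ev ?G ?x) = ar (ev ?G ?y)"
      by (rule iffI, metis, rule larr_eqI) (simp_all del: ar_simps)
    finally show ?thesis by simp
  qed
  finally show ?thesis ..
qed

end

context differential_modality
begin

context
  fixes A X \<alpha>
  assumes A [simp]: "A \<in> Ob C" and X [simp]: "X \<in> Ob C" and \<alpha> [simp]: "is_larr (act X A \<alpha>)"
begin

abbreviation (input) "\<tau> \<equiv> act X A \<alpha>"
abbreviation (input) "\<theta> \<equiv> act X (\<B> A) (bang_action C D X A \<alpha>)"

lemma bang_action_arr: "ar \<theta>
  = ar (der A) \<bullet> (idm (\<B> A) \<diamond> ar \<tau>) \<bullet> asc (\<B> A) A X \<bullet> (ar (bor A) \<diamond> idm X)"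
proof -
  have "ar \<theta> = ((ar (der A) \<bullet> (idm (\<B> A) \<diamond> ar \<tau>)) \<bullet> asc (\<B> A) A X) \<bullet> (ar (bor A) \<diamond> idm X)"
    by (rule arrow_eqI) (simp_all add: bang_action_def del: comp_arr_assoc)
  then show ?thesis by simp
qed

lemma is_larr_bang_action [simp]: "is_larr \<theta>"
  unfolding is_larr_def[of \<theta>] bang_action_arr by simp

lemma bang_action_deq: "deq [\<B> A, X] [(0, \<theta>)] [(0, bor A), (1, \<tau>), (0, der A)]"
  unfolding deq_def using bang_action_arr by (auto intro!: larr_eqI)

text \<open>
  Acting twice: either both letters act on the same argument, or they act on two arguments.  The
  second summand is brought to the form in which both arguments are borrowed first and given back
  last.
\<close>

lemma bang_action_twice: "dsum [\<B> A, X, X] [(0, \<theta>), (0, \<theta>)] [(0, bor A), (1, \<tau>), (1, \<tau>), (0, der A)]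
  [(0, bor A), (0, bor A), (2, \<sigma> A X), (1, \<tau>), (2, \<tau>), (0, der A), (0, der A)]"
proof (rule dsum_cong)
  show "dsum [\<B> A, X, X] [(0, bor A), (1, \<tau>), (0, der A), (0, bor A), (1, \<tau>), (0, der A)]
    [(0, bor A), (1, \<tau>), (1, \<tau>), (0, der A)]
    [(0, bor A), (0, bor A), (2, \<tau>), (1, \<sigma> A A), (2, \<tau>), (0, der A), (0, der A)]"
    by (rule dsum_rewrite[OF der_bor, where pre = "[(0, bor A), (1, \<tau>)]" and i = 0
          and post = "[(1, \<tau>), (0, der A)]"]) simp_all
  have "deq [\<B> A, X, X] [(0, \<theta>), (0, \<theta>)] [(0, bor A), (1, \<tau>), (0, der A), (0, \<theta>)]"
    by (rule deq_rewrite[OF bang_action_deq, where pre = "[]" and i = 0 and post = "[(0, \<theta>)]"]) simp_all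
  also have "deq [\<B> A, X, X] \<dots> [(0, bor A), (1, \<tau>), (0, der A), (0, bor A), (1, \<tau>), (0, der A)]"
    by (rule deq_rewrite[OF bang_action_deq, where pre = "[(0, bor A), (1, \<tau>), (0, der A)]" and i = 0
          and post = "[]"]) simp_all
  finally show "deq [\<B> A, X, X] [(0, \<theta>), (0, \<theta>)]
    [(0, bor A), (1, \<tau>), (0, der A), (0, bor A), (1, \<tau>), (0, der A)]" .
  show "deq [\<B> A, X, X] [(0, bor A), (1, \<tau>), (1, \<tau>), (0, der A)] [(0, bor A), (1, \<tau>), (1, \<tau>), (0, der A)]"
    by (rule deq_refl) simp
  have "deq [\<B> A, X, X] [(0, bor A), (0, bor A), (2, \<tau>), (1, \<sigma> A A), (2, \<tau>), (0, der A), (0, der A)]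
    [(0, bor A), (0, bor A), (1, \<sigma> A A), (2, \<sigma> A X), (1, \<tau>), (2, \<tau>), (0, der A), (0, der A)]"
    by (rule deq_rewrite[OF move_right_nat[of \<tau> A], where pre = "[(0, bor A), (0, bor A)]" and i = 1
          and post = "[(2, \<tau>), (0, der A), (0, der A)]"]) simp_all
  also have "deq [\<B> A, X, X] \<dots>
    [(0, bor A), (0, bor A), (2, \<sigma> A X), (1, \<tau>), (2, \<tau>), (0, der A), (0, der A)]"
    by (rule deq_rewrite[OF bor_bor_swap, where pre = "[]" and i = 0
          and post = "[(2, \<sigma> A X), (1, \<tau>), (2, \<tau>), (0, der A), (0, der A)]"]) simp_all
  finally show "deq [\<B> A, X, X]
    [(0, bor A), (0, bor A), (2, \<tau>), (1, \<sigma> A A), (2, \<tau>), (0, der A), (0, der A)]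
    [(0, bor A), (0, bor A), (2, \<sigma> A X), (1, \<tau>), (2, \<tau>), (0, der A), (0, der A)]" .
qed

text \<open>
  Exchanging the two letters exchanges the two results and the two arguments.  The former does not
  matter because of the interchange rule, the latter because borrowed arguments may be exchanged.
\<close>

lemma two_borrows_symmetric: "deq [\<B> A, X, X]
  [(0, bor A), (0, bor A), (2, \<sigma> A X), (1, \<tau>), (2, \<tau>), (0, der A), (0, der A)]
  [(1, \<sigma> X X), (0, bor A), (0, bor A), (2, \<sigma> A X), (1, \<tau>), (2, \<tau>), (0, der A), (0, der A)]"
proof -
  have "deq [\<B> A, X, X]
    [(0, bor A), (0, bor A), (2, \<sigma> A X), (1, \<tau>), (2, \<tau>), (0, der A), (0, der A)]
    [(0, bor A), (0, bor A), (2, \<sigma> A X), (1, \<tau>), (2, \<tau>), (1, \<sigma> A A), (0, der A), (0, der A)]"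
    by (rule deq_rewrite[OF interchange_deq[THEN deq_sym], where i = 0 and post = "[]"
          and pre = "[(0, bor A), (0, bor A), (2, \<sigma> A X), (1, \<tau>), (2, \<tau>)]"]) simp_all
  \<comment> \<open>The symmetry of the results, introduced by the interchange rule, is pulled through both
      occurrences of the action, where it becomes a symmetry of the pairs of argument and letter.\<close>
  also have "deq [\<B> A, X, X] \<dots>
    [(0, bor A), (0, bor A), (2, \<sigma> A X), (3, \<tau>), (2, \<sigma> X A), (1, \<sigma> A A), (2, \<tau>), (0, der A), (0, der A)]"
    by (rule deq_rewrite[OF move_left_nat[of \<tau> A], where i = 1 and post = "[(0, der A), (0, der A)]"
          and pre = "[(0, bor A), (0, bor A), (2, \<sigma> A X), (3, \<tau>)]"]) simp_all
  also have "deq [\<B> A, X, X] \<dots>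
    [(0, bor A), (0, bor A), (2, \<sigma> A X), (2, \<sigma> X A), (3, \<sigma> X X), (2, \<tau>), (1, \<sigma> A A), (2, \<tau>),
      (0, der A), (0, der A)]"
    by (rule deq_rewrite[OF move_right_nat[of \<tau> X], where i = 2
          and post = "[(1, \<sigma> A A), (2, \<tau>), (0, der A), (0, der A)]"
          and pre = "[(0, bor A), (0, bor A), (2, \<sigma> A X)]"]) simp_all
  also have "deq [\<B> A, X, X] \<dots>
    [(0, bor A), (0, bor A), (3, \<sigma> X X), (2, \<tau>), (1, \<sigma> A A), (2, \<tau>), (0, der A), (0, der A)]"
    by (rule deq_rewrite[OF swap_swap[of A X], where i = 2
          and post = "[(3, \<sigma> X X), (2, \<tau>), (1, \<sigma> A A), (2, \<tau>), (0, der A), (0, der A)]"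
          and pre = "[(0, bor A), (0, bor A)]"]) simp_all
  also have "deq [\<B> A, X, X] \<dots>
    [(0, bor A), (0, bor A), (3, \<sigma> X X), (1, \<sigma> A A), (2, \<sigma> A X), (1, \<tau>), (2, \<tau>), (0, der A), (0, der A)]"
    by (rule deq_rewrite[OF move_right_nat[of \<tau> A], where i = 1 and post = "[(2, \<tau>), (0, der A), (0, der A)]"
          and pre = "[(0, bor A), (0, bor A), (3, \<sigma> X X)]"]) simp_all
  also have "deq [\<B> A, X, X] \<dots>
    [(1, \<sigma> X X), (0, bor A), (0, bor A), (2, \<sigma> A X), (1, \<tau>), (2, \<tau>), (0, der A), (0, der A)]"
    by (rule deq_rewrite[OF bor_bor_swap, where i = 0 and pre = "[]"
          and post = "[(3, \<sigma> X X), (2, \<sigma> A X), (1, \<tau>), (2, \<tau>), (0, der A), (0, der A)]"]) simp_all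
  finally show ?thesis .
qed

lemma bang_action_commuting:
  assumes comm: "deq [A, X, X] [(1, \<sigma> X X), (0, \<tau>), (0, \<tau>)] [(0, \<tau>), (0, \<tau>)]"
  shows "deq [\<B> A, X, X] [(1, \<sigma> X X), (0, \<theta>), (0, \<theta>)] [(0, \<theta>), (0, \<theta>)]"
proof (rule dsum_unique)
  show "dsum [\<B> A, X, X] [(1, \<sigma> X X), (0, \<theta>), (0, \<theta>)]
    [(1, \<sigma> X X), (0, bor A), (1, \<tau>), (1, \<tau>), (0, der A)]
    [(1, \<sigma> X X), (0, bor A), (0, bor A), (2, \<sigma> A X), (1, \<tau>), (2, \<tau>), (0, der A), (0, der A)]"
    by (rule dsum_rewrite[OF bang_action_twice, where pre = "[(1, \<sigma> X X)]" and i = 0 and post = "[]"])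
      simp_all
  show "deq [\<B> A, X, X] [(1, \<sigma> X X), (0, bor A), (1, \<tau>), (1, \<tau>), (0, der A)]
      [(0, bor A), (1, \<tau>), (1, \<tau>), (0, der A)]"
    by (rule deq_rewrite[OF comm, where pre = "[(0, bor A)]" and i = 1 and post = "[(0, der A)]"]) simp_all
qed (rule bang_action_twice, rule two_borrows_symmetric[THEN deq_sym])

lemma bang_action_counit: "deq [\<B> A, X] [(0, \<theta>), (0, cou A)] [(0, cou A), (0, \<tau>)]"
proof -
  have "deq [\<B> A, X] [(0, \<theta>), (0, cou A)] [(0, bor A), (1, \<tau>), (0, der A), (0, cou A)]"
    by (rule deq_rewrite[OF bang_action_deq, where pre = "[]" and i = 0 and post = "[(0, cou A)]"]) simp_all
  also have "deq [\<B> A, X] \<dots> [(0, bor A), (1, \<tau>), (0, dis A)]"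
    by (rule deq_rewrite[OF linear_deq, where pre = "[(0, bor A), (1, \<tau>)]" and i = 0 and post = "[]"]) simp_all
  also have "deq [\<B> A, X] \<dots> [(0, cou A), (0, \<tau>)]"
    by (rule deq_rewrite[OF bor_dis, where pre = "[]" and i = 0 and post = "[(0, \<tau>)]"]) simp_all
  finally show ?thesis .
qed

text \<open>
  The action on \<open>!A \<otimes> !A\<close> acts on either factor, which matches the two terms of the product rule.  The
  second term agrees only because the argument may be borrowed from either copy.
\<close>

lemma bang_action_copy: "dsum [\<B> A, X] [(0, \<theta>), (0, cop A)]
  [(0, cop A), (1, \<theta>)] [(0, cop A), (1, \<sigma> (\<B> A) X), (0, \<theta>)]"
proof (rule dsum_cong)
  show "dsum [\<B> A, X] [(0, bor A), (1, \<tau>), (0, der A), (0, cop A)]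
    [(0, bor A), (0, cop A), (2, \<tau>), (1, der A)]
    [(0, bor A), (0, cop A), (2, \<tau>), (1, \<sigma> (\<B> A) A), (0, der A)]"
    by (rule dsum_rewrite[OF product_dsum, where pre = "[(0, bor A), (1, \<tau>)]" and i = 0 and post = "[]"])
      simp_all
  show "deq [\<B> A, X] [(0, \<theta>), (0, cop A)] [(0, bor A), (1, \<tau>), (0, der A), (0, cop A)]"
    by (rule deq_rewrite[OF bang_action_deq, where pre = "[]" and i = 0 and post = "[(0, cop A)]"]) simp_all
  have "deq [\<B> A, X] [(0, bor A), (0, cop A), (2, \<tau>), (1, der A)]
      [(0, cop A), (1, bor A), (2, \<tau>), (1, der A)]"
    by (rule deq_rewrite[OF bor_cop, where pre = "[]" and i = 0 and post = "[(2, \<tau>), (1, der A)]"]) simp_all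
  also have "deq [\<B> A, X] \<dots> [(0, cop A), (1, \<theta>)]"
    by (rule deq_rewrite[OF bang_action_deq[THEN deq_sym], where pre = "[(0, cop A)]" and i = 1
          and post = "[]"]) simp_all
  finally show "deq [\<B> A, X] [(0, bor A), (0, cop A), (2, \<tau>), (1, der A)] [(0, cop A), (1, \<theta>)]" .
  have "deq [\<B> A, X] [(0, bor A), (0, cop A), (2, \<tau>), (1, \<sigma> (\<B> A) A), (0, der A)]
      [(0, cop A), (1, bor A), (2, \<tau>), (1, \<sigma> (\<B> A) A), (0, der A)]"
    by (rule deq_rewrite[OF bor_cop, where pre = "[]" and i = 0
          and post = "[(2, \<tau>), (1, \<sigma> (\<B> A) A), (0, der A)]"]) simp_all
  also have "deq [\<B> A, X] \<dots>
      [(0, cop A), (1, bor A), (1, \<sigma> (\<B> A) A), (2, \<sigma> (\<B> A) X), (1, \<tau>), (0, der A)]"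
    by (rule deq_rewrite[OF move_right_nat[of \<tau> "\<B> A"], where pre = "[(0, cop A), (1, bor A)]" and i = 1
          and post = "[(0, der A)]"]) simp_all
  also have "deq [\<B> A, X] \<dots>
      [(0, cop A), (0, bor A), (1, \<sigma> A (\<B> A)), (1, \<sigma> (\<B> A) A), (2, \<sigma> (\<B> A) X), (1, \<tau>), (0, der A)]"
    by (rule deq_rewrite[OF cop_bor_swap[THEN deq_sym], where pre = "[]" and i = 0
          and post = "[(1, \<sigma> (\<B> A) A), (2, \<sigma> (\<B> A) X), (1, \<tau>), (0, der A)]"]) simp_all
  also have "deq [\<B> A, X] \<dots> [(0, cop A), (1, \<sigma> (\<B> A) X), (0, bor A), (1, \<tau>), (0, der A)]"
    by (rule deq_rewrite[OF swap_swap[of A "\<B> A"], where pre = "[(0, cop A), (0, bor A)]" and i = 1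
          and post = "[(2, \<sigma> (\<B> A) X), (1, \<tau>), (0, der A)]"]) simp_all
  also have "deq [\<B> A, X] \<dots> [(0, cop A), (1, \<sigma> (\<B> A) X), (0, \<theta>)]"
    by (rule deq_rewrite[OF bang_action_deq[THEN deq_sym], where pre = "[(0, cop A), (1, \<sigma> (\<B> A) X)]"
          and i = 0 and post = "[]"]) simp_all
  finally show "deq [\<B> A, X] [(0, bor A), (0, cop A), (2, \<tau>), (1, \<sigma> (\<B> A) A), (0, der A)]
    [(0, cop A), (1, \<sigma> (\<B> A) X), (0, \<theta>)]" .
qed

text \<open>
  By \<open>der_bor\<close>, a letter that acts after a differentiation acts on the direction of differentiation or
  on an old argument.  In the latter case the two results are given back in the wrong order, which
  the interchange rule corrects.
\<close>

lemma bang_action_deriving: "dsum [\<B> A, A, X] [(0, der A), (0, \<theta>)]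
  [(1, \<tau>), (0, der A)] [(1, \<sigma> A X), (0, \<theta>), (0, der A)]"
proof (rule dsum_cong)
  show "dsum [\<B> A, A, X] [(0, der A), (0, bor A), (1, \<tau>), (0, der A)] [(1, \<tau>), (0, der A)]
    [(0, bor A), (1, \<sigma> A A), (2, \<tau>), (0, der A), (0, der A)]"
    by (rule dsum_rewrite[OF der_bor, where pre = "[]" and i = 0 and post = "[(1, \<tau>), (0, der A)]"])
      simp_all
  show "deq [\<B> A, A, X] [(0, der A), (0, \<theta>)] [(0, der A), (0, bor A), (1, \<tau>), (0, der A)]"
    by (rule deq_rewrite[OF bang_action_deq, where pre = "[(0, der A)]" and i = 0 and post = "[]"]) simp_all
  show "deq [\<B> A, A, X] [(1, \<tau>), (0, der A)] [(1, \<tau>), (0, der A)]"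
    by (rule deq_refl) simp
  have "deq [\<B> A, A, X] [(0, bor A), (1, \<sigma> A A), (2, \<tau>), (0, der A), (0, der A)]
    [(0, bor A), (1, \<sigma> A A), (2, \<tau>), (1, \<sigma> A A), (0, der A), (0, der A)]"
    by (rule deq_rewrite[OF interchange_deq[THEN deq_sym], where i = 0 and post = "[]"
          and pre = "[(0, bor A), (1, \<sigma> A A), (2, \<tau>)]"]) simp_all
  also have "deq [\<B> A, A, X] \<dots>
    [(0, bor A), (1, \<sigma> A A), (1, \<sigma> A A), (2, \<sigma> A X), (1, \<tau>), (0, der A), (0, der A)]"
    by (rule deq_rewrite[OF move_right_nat[of \<tau> A], where i = 1 and post = "[(0, der A), (0, der A)]"
          and pre = "[(0, bor A), (1, \<sigma> A A)]"]) simp_all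
  also have "deq [\<B> A, A, X] \<dots> [(1, \<sigma> A X), (0, bor A), (1, \<tau>), (0, der A), (0, der A)]"
    by (rule deq_rewrite[OF swap_swap[of A A], where i = 1 and pre = "[(0, bor A)]"
          and post = "[(2, \<sigma> A X), (1, \<tau>), (0, der A), (0, der A)]"]) simp_all
  also have "deq [\<B> A, A, X] \<dots> [(1, \<sigma> A X), (0, \<theta>), (0, der A)]"
    by (rule deq_rewrite[OF bang_action_deq[THEN deq_sym], where i = 0 and pre = "[(1, \<sigma> A X)]"
          and post = "[(0, der A)]"]) simp_all
  finally show "deq [\<B> A, A, X] [(0, bor A), (1, \<sigma> A A), (2, \<tau>), (0, der A), (0, der A)]
    [(1, \<sigma> A X), (0, \<theta>), (0, der A)]" .
qed

end

lemma bang_action_comult: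
  assumes [simp]: "A \<in> Ob C" "X \<in> Ob C" "is_larr (act X A \<alpha>)"
  defines "\<beta> \<equiv> bang_action C D X A \<alpha>"
  shows "deq [\<B> A, X] [(0, act X (\<B> A) \<beta>), (0, com A)]
    [(0, com A), (0, act X (\<B> (\<B> A)) (bang_action C D X (\<B> A) \<beta>))]"
proof -
  let ?t = "act X A \<alpha>" and ?b = "act X (\<B> A) \<beta>"
    and ?bb = "act X (\<B> (\<B> A)) (bang_action C D X (\<B> A) \<beta>)"
  have [simp]: "is_larr ?b" unfolding \<beta>_def by simp
  have [simp]: "is_larr ?bb" by simp
  note b = bang_action_deq[OF assms(1-3), folded \<beta>_def]
  have "deq [\<B> A, X] [(0, ?b), (0, com A)] [(0, bor A), (1, ?t), (0, der A), (0, com A)]"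
    by (rule deq_rewrite[OF b, where pre = "[]" and i = 0 and post = "[(0, com A)]"]) simp_all
  also have "deq [\<B> A, X] \<dots>
      [(0, bor A), (0, cop A), (2, ?t), (1, der A), (0, com A), (0, der (\<B> A))]"
    by (rule deq_rewrite[OF chain_deq, where pre = "[(0, bor A), (1, ?t)]" and i = 0 and post = "[]"]) simp_all
  also have "deq [\<B> A, X] \<dots>
      [(0, cop A), (1, bor A), (2, ?t), (1, der A), (0, com A), (0, der (\<B> A))]"
    by (rule deq_rewrite[OF bor_cop, where pre = "[]" and i = 0
          and post = "[(2, ?t), (1, der A), (0, com A), (0, der (\<B> A))]"]) simp_all
  also have "deq [\<B> A, X] \<dots> [(0, cop A), (0, com A), (1, ?b), (0, der (\<B> A))]"
    by (rule deq_rewrite[OF b[THEN deq_sym], where pre = "[(0, cop A)]" and i = 1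
          and post = "[(0, com A), (0, der (\<B> A))]"]) simp_all
  also have "deq [\<B> A, X] \<dots> [(0, com A), (0, bor (\<B> A)), (1, ?b), (0, der (\<B> A))]"
    by (rule deq_rewrite[OF com_bor[THEN deq_sym], where pre = "[]" and i = 0
          and post = "[(1, ?b), (0, der (\<B> A))]"]) simp_all
  also have "deq [\<B> A, X] \<dots> [(0, com A), (0, ?bb)]"
    by (rule deq_rewrite[OF bang_action_deq[of "\<B> A" X \<beta>, THEN deq_sym], where pre = "[(0, com A)]"
          and i = 0 and post = "[]"]) simp_all
  finally show ?thesis .
qed

end

section \<open>Tensor products of actions\<close>

context sym_monoidal_category
begin

lemma action_mapI:
  assumes "is_arr f" "f \<bullet> a = b \<bullet> (f \<diamond> idm X)"
  shows "mor f \<in> action_maps C X (src f, mor a) (trg f, mor b)"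
  using assms(1) arg_cong[OF assms(2), of mor] by (simp add: action_maps_def is_arr_def del: is_arr_ob)

lemma action_map_arr:
  assumes "A \<in> Ob C" "B \<in> Ob C" "X \<in> Ob C" "is_larr (act X A \<alpha>)" "is_larr (act X B \<beta>)"
  shows "f \<in> action_maps C X (A, \<alpha>) (B, \<beta>) \<longleftrightarrow> is_arr (ar (gmap A f B))
    \<and> ar (gmap A f B) \<bullet> ar (act X A \<alpha>) = ar (act X B \<beta>) \<bullet> (ar (gmap A f B) \<diamond> idm X)"
    (is "?l \<longleftrightarrow> ?a \<and> ?m = ?n")
proof -
  have "?m = ?n \<longleftrightarrow> mor ?m = mor ?n"
    by (rule iffI, metis, rule arrow_eqI) (simp_all del: mor_comp)
  then show ?thesis
    using assms by (simp add: action_maps_def is_arr_def del: is_arr_ob)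
qed

lemma action_map_deq:
  assumes [simp]: "A \<in> Ob C" "B \<in> Ob C" "X \<in> Ob C" "is_larr (act X A \<alpha>)" "is_larr (act X B \<beta>)"
  shows "f \<in> action_maps C X (A, \<alpha>) (B, \<beta>) \<longleftrightarrow> is_larr (gmap A f B)
    \<and> deq [A, X] [(0, act X A \<alpha>), (0, gmap A f B)] [(0, gmap A f B), (0, act X B \<beta>)]"
    (is "?l \<longleftrightarrow> ?g \<and> deq ?G ?x ?y")
proof (cases ?g)
  case True
  note [simp] = True
  have "deq ?G ?x ?y \<longleftrightarrow> ev ?G ?x = ev ?G ?y" by (simp add: deq_def)
  also have "\<dots> \<longleftrightarrow> ar (ev ?G ?x) = ar (ev ?G ?y)"
    by (rule iffI, metis, rule larr_eqI) (simp_all del: ar_simps)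
  finally show ?thesis by (simp add: action_map_arr)
next
  case False
  moreover have "is_arr (ar (gmap A f B)) \<longleftrightarrow> ?g" by (simp add: is_larr_def del: is_larrD)
  ultimately show ?thesis by (simp add: action_map_arr)
qed

end

context linear_sym_monoidal_category
begin

lemma dsum_assoc:
  assumes "dsum \<Gamma> xs a p" "dsum \<Gamma> p b c" "dsum \<Gamma> xs' q c" "dsum \<Gamma> q a b"
  shows "deq \<Gamma> xs xs'"
  using assms add_arr_assoc[of "ev \<Gamma> a" "ev \<Gamma> b" "ev \<Gamma> c"] unfolding dsum_def deq_def by auto

text \<open>
  The action on a tensor product, as a diagram generator with the two factors kept apart.
\<close>

definition pact where "pact X A \<alpha> B \<beta>
  = ([A, B, X], (\<one> A \<star> \<beta>) \<cdot> \<a> A B X \<oplus> (\<alpha> \<star> \<one> B) \<cdot> \<x> A B X, [A, B])"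

lemma pact_sel [simp]:
  "src (pact X A \<alpha> B \<beta>) = [A, B, X]" "trg (pact X A \<alpha> B \<beta>) = [A, B]"
  by (simp_all add: pact_def)

lemma mor_pact: "mor (pact X A \<alpha> B \<beta>) = (\<one> A \<star> \<beta>) \<cdot> \<a> A B X \<oplus> (\<alpha> \<star> \<one> B) \<cdot> \<x> A B X"
  by (simp_all add: pact_def)

lemma action_tensor_eq: "action_tensor C X (A, \<alpha>) (B, \<beta>) = (A \<otimes> B, mor (pact X A \<alpha> B \<beta>))"
  by (simp add: action_tensor_def mor_pact)

context
  fixes A B X \<alpha> \<beta>
  assumes A [simp]: "A \<in> Ob C" and B [simp]: "B \<in> Ob C" and X [simp]: "X \<in> Ob C"
    and \<alpha> [simp]: "is_larr (act X A \<alpha>)" and \<beta> [simp]: "is_larr (act X B \<beta>)"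
begin

lemma pact_arr: "ar (pact X A \<alpha> B \<beta>) = (idm A \<diamond> ar (act X B \<beta>)) \<bullet> asc A B X
  \<boxplus> (ar (act X A \<alpha>) \<diamond> idm B) \<bullet> asc' A X B \<bullet> (idm A \<diamond> br B X) \<bullet> asc A B X"
proof -
  have "ar (pact X A \<alpha> B \<beta>) = (idm A \<diamond> ar (act X B \<beta>)) \<bullet> asc A B X
    \<boxplus> (ar (act X A \<alpha>) \<diamond> idm B) \<bullet> (asc' A X B \<bullet> (idm A \<diamond> br B X) \<bullet> asc A B X)"
    using exch_arr[of A B X] by (intro arrow_eqI) (simp_all add: mor_pact)
  then show ?thesis by simp
qed

lemma is_larr_pact [simp]: "is_larr (pact X A \<alpha> B \<beta>)"
  unfolding is_larr_def[of "pact X A \<alpha> B \<beta>"] pact_arr by simp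

lemma pact_dsum: "dsum [A, B, X] [(0, pact X A \<alpha> B \<beta>)]
  [(1, act X B \<beta>)] [(1, \<sigma> B X), (0, act X A \<alpha>)]"
  unfolding dsum_def using pact_arr by (auto intro!: larr_eqI)

lemma ar_act_pact: "ar (act X (A \<otimes> B) (mor (pact X A \<alpha> B \<beta>))) = ar (pact X A \<alpha> B \<beta>)"
  by (rule arrow_eqI) simp_all

lemma is_larr_act_pact [simp]: "is_larr (act X (A \<otimes> B) (mor (pact X A \<alpha> B \<beta>)))"
  unfolding is_larr_def[of "act X (A \<otimes> B) (mor (pact X A \<alpha> B \<beta>))"] ar_act_pact by simp

text \<open>
  Of the four terms of acting twice, the two in which both letters act on the same factor are
  symmetric by hypothesis; the two mixed ones are interchanged.
\<close>

lemma pact_commuting: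
  assumes comm: "deq [A, X, X] [(1, \<sigma> X X), (0, act X A \<alpha>), (0, act X A \<alpha>)] [(0, act X A \<alpha>), (0, act X A \<alpha>)]"
    "deq [B, X, X] [(1, \<sigma> X X), (0, act X B \<beta>), (0, act X B \<beta>)] [(0, act X B \<beta>), (0, act X B \<beta>)]"
  shows "deq [A, B, X, X] [(2, \<sigma> X X), (0, pact X A \<alpha> B \<beta>), (0, pact X A \<alpha> B \<beta>)]
    [(0, pact X A \<alpha> B \<beta>), (0, pact X A \<alpha> B \<beta>)]"
proof -
  let ?T = "pact X A \<alpha> B \<beta>" and ?a = "act X A \<alpha>" and ?b = "act X B \<beta>"
  have "dsum [A, B, X, X] [(0, ?T), (0, ?T)] [(0, ?T), (1, ?b)] [(0, ?T), (1, \<sigma> B X), (0, ?a)]"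
    by (rule dsum_rewrite[OF pact_dsum, where pre = "[(0, ?T)]" and i = 0 and post = "[]"]) simp_all
  moreover have "dsum [A, B, X, X] [(0, ?T), (1, ?b)] [(1, ?b), (1, ?b)] [(1, \<sigma> B X), (0, ?a), (1, ?b)]"
    by (rule dsum_rewrite[OF pact_dsum, where pre = "[]" and i = 0 and post = "[(1, ?b)]"]) simp_all
  moreover have "dsum [A, B, X, X] [(0, ?T), (1, \<sigma> B X), (0, ?a)]
      [(1, ?b), (1, \<sigma> B X), (0, ?a)] [(1, \<sigma> B X), (0, ?a), (1, \<sigma> B X), (0, ?a)]"
    by (rule dsum_rewrite[OF pact_dsum, where pre = "[]" and i = 0
          and post = "[(1, \<sigma> B X), (0, ?a)]"]) simp_all
  moreover have "dsum [A, B, X, X] [(2, \<sigma> X X), (0, ?T), (0, ?T)]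
      [(2, \<sigma> X X), (0, ?T), (1, ?b)] [(2, \<sigma> X X), (0, ?T), (1, \<sigma> B X), (0, ?a)]"
    by (rule dsum_rewrite[OF pact_dsum, where pre = "[(2, \<sigma> X X), (0, ?T)]" and i = 0 and post = "[]"])
      simp_all
  moreover have "dsum [A, B, X, X] [(2, \<sigma> X X), (0, ?T), (1, ?b)]
      [(2, \<sigma> X X), (1, ?b), (1, ?b)] [(2, \<sigma> X X), (1, \<sigma> B X), (0, ?a), (1, ?b)]"
    by (rule dsum_rewrite[OF pact_dsum, where pre = "[(2, \<sigma> X X)]" and i = 0 and post = "[(1, ?b)]"])
      simp_all
  moreover have "dsum [A, B, X, X] [(2, \<sigma> X X), (0, ?T), (1, \<sigma> B X), (0, ?a)]
      [(2, \<sigma> X X), (1, ?b), (1, \<sigma> B X), (0, ?a)]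
      [(2, \<sigma> X X), (1, \<sigma> B X), (0, ?a), (1, \<sigma> B X), (0, ?a)]"
    by (rule dsum_rewrite[OF pact_dsum, where pre = "[(2, \<sigma> X X)]" and i = 0
          and post = "[(1, \<sigma> B X), (0, ?a)]"]) simp_all
  moreover have "deq [A, B, X, X] [(2, \<sigma> X X), (1, ?b), (1, ?b)] [(1, ?b), (1, ?b)]"
    by (rule deq_rewrite[OF comm(2), where pre = "[]" and i = 1 and post = "[]"]) simp_all
  moreover have "deq [A, B, X, X] [(2, \<sigma> X X), (1, \<sigma> B X), (0, ?a), (1, ?b)]
      [(1, ?b), (1, \<sigma> B X), (0, ?a)]"
    by (rule deq_rewrite[OF move_left_nat[of ?b X, THEN deq_sym], where pre = "[]" and i = 1
          and post = "[(0, ?a)]"]) simp_all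
  moreover have "deq [A, B, X, X] [(2, \<sigma> X X), (1, ?b), (1, \<sigma> B X), (0, ?a)]
      [(1, \<sigma> B X), (0, ?a), (1, ?b)]"
  proof -
    have "deq [A, B, X, X] [(2, \<sigma> X X), (1, ?b), (1, \<sigma> B X), (0, ?a)]
        [(2, \<sigma> X X), (2, \<sigma> X X), (1, \<sigma> B X), (0, ?a), (1, ?b)]"
      by (rule deq_rewrite[OF move_left_nat[of ?b X], where pre = "[(2, \<sigma> X X)]" and i = 1
            and post = "[(0, ?a)]"]) simp_all
    also have "deq [A, B, X, X] \<dots> [(1, \<sigma> B X), (0, ?a), (1, ?b)]"
      by (rule deq_rewrite[OF swap_swap[of X X], where pre = "[]" and i = 2
            and post = "[(1, \<sigma> B X), (0, ?a), (1, ?b)]"]) simp_all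
    finally show ?thesis .
  qed
  moreover have "deq [A, B, X, X] [(2, \<sigma> X X), (1, \<sigma> B X), (0, ?a), (1, \<sigma> B X), (0, ?a)]
      [(1, \<sigma> B X), (0, ?a), (1, \<sigma> B X), (0, ?a)]"
  proof -
    have "deq [A, B, X, X] [(2, \<sigma> X X), (1, \<sigma> B X), (0, ?a), (1, \<sigma> B X), (0, ?a)]
        [(1, \<sigma> B X), (2, \<sigma> B X), (1, \<sigma> X X), (0, ?a), (0, ?a)]"
      by (rule deq_rewrite[OF move_right_nat[of "\<sigma> X X" B], where pre = "[]" and i = 1
            and post = "[(0, ?a), (0, ?a)]"]) simp_all
    also have "deq [A, B, X, X] \<dots> [(1, \<sigma> B X), (0, ?a), (1, \<sigma> B X), (0, ?a)]"
      by (rule deq_rewrite[OF comm(1), where pre = "[(1, \<sigma> B X), (2, \<sigma> B X)]" and i = 0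
            and post = "[]"]) simp_all
    finally show ?thesis .
  qed
  ultimately show ?thesis
    by (intro dsum_cross[of "[A, B, X, X]" "[(2, \<sigma> X X), (0, ?T), (0, ?T)]"])
qed

lemma pact_commuting_law:
  assumes "\<alpha> \<cdot> (\<alpha> \<star> \<one> X) \<cdot> \<x> A X X = \<alpha> \<cdot> (\<alpha> \<star> \<one> X)" "\<beta> \<cdot> (\<beta> \<star> \<one> X) \<cdot> \<x> B X X = \<beta> \<cdot> (\<beta> \<star> \<one> X)"
  defines "\<tau> \<equiv> mor (pact X A \<alpha> B \<beta>)"
  shows "\<tau> \<cdot> (\<tau> \<star> \<one> X) \<cdot> \<x> (A \<otimes> B) X X = \<tau> \<cdot> (\<tau> \<star> \<one> X)"
proof -
  let ?T = "pact X A \<alpha> B \<beta>"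
  have [simp]: "is_larr (act X (A \<otimes> B) \<tau>)" by (simp add: \<tau>_def)
  have "deq [A, B, X, X] [(2, \<sigma> X X), (0, ?T), (0, ?T)] [(0, ?T), (0, ?T)]"
    by (rule pact_commuting)
      (rule commuting_deq[THEN iffD2, OF A X \<alpha> assms(1)], rule commuting_deq[THEN iffD2, OF B X \<beta> assms(2)])
  then have "ar (ev [A, B, X, X] [(2, \<sigma> X X), (0, ?T), (0, ?T)]) = ar (ev [A, B, X, X] [(0, ?T), (0, ?T)])"
    by (simp add: deq_def)
  then have "deq [A \<otimes> B, X, X] [(1, \<sigma> X X), (0, act X (A \<otimes> B) \<tau>), (0, act X (A \<otimes> B) \<tau>)]
      [(0, act X (A \<otimes> B) \<tau>), (0, act X (A \<otimes> B) \<tau>)]"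
    unfolding deq_def using ar_act_pact by (auto intro!: larr_eqI simp: \<tau>_def)
  then show ?thesis by (intro commuting_deq[THEN iffD1]) simp_all
qed

end

lemma pact_swap:
  assumes [simp]: "A \<in> Ob C" "B \<in> Ob C" "X \<in> Ob C" "is_larr (act X A \<alpha>)" "is_larr (act X B \<beta>)"
  shows "deq [A, B, X] [(0, pact X A \<alpha> B \<beta>), (0, \<sigma> A B)] [(0, \<sigma> A B), (0, pact X B \<beta> A \<alpha>)]"
proof (rule dsum_unique)
  let ?a = "act X A \<alpha>" and ?b = "act X B \<beta>"
  show "dsum [A, B, X] [(0, pact X A \<alpha> B \<beta>), (0, \<sigma> A B)]
      [(1, ?b), (0, \<sigma> A B)] [(1, \<sigma> B X), (0, ?a), (0, \<sigma> A B)]"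
    by (rule dsum_rewrite[OF pact_dsum, where pre = "[]" and i = 0 and post = "[(0, \<sigma> A B)]"]) simp_all
  have p: "dsum [B, A, X] [(0, pact X B \<beta> A \<alpha>)] [(1, \<sigma> A X), (0, ?b)] [(1, ?a)]"
    by (rule dsum_commute, rule pact_dsum) simp_all
  show "dsum [A, B, X] [(0, \<sigma> A B), (0, pact X B \<beta> A \<alpha>)]
      [(0, \<sigma> A B), (1, \<sigma> A X), (0, ?b)] [(0, \<sigma> A B), (1, ?a)]"
    by (rule dsum_rewrite[OF p, where pre = "[(0, \<sigma> A B)]" and i = 0 and post = "[]"]) simp_all
  show "deq [A, B, X] [(1, ?b), (0, \<sigma> A B)] [(0, \<sigma> A B), (1, \<sigma> A X), (0, ?b)]"
    by (rule deq_rewrite[OF move_right_nat[of ?b A], where pre = "[]" and i = 0 and post = "[]"]) simp_all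
  have "deq [A, B, X] [(1, \<sigma> B X), (0, ?a), (0, \<sigma> A B)] [(1, \<sigma> B X), (1, \<sigma> X B), (0, \<sigma> A B), (1, ?a)]"
    by (rule deq_rewrite[OF move_left_nat[of ?a B], where pre = "[(1, \<sigma> B X)]" and i = 0 and post = "[]"])
      simp_all
  also have "deq [A, B, X] \<dots> [(0, \<sigma> A B), (1, ?a)]"
    by (rule deq_rewrite[OF swap_swap[of B X], where pre = "[]" and i = 1 and post = "[(0, \<sigma> A B), (1, ?a)]"])
      simp_all
  finally show "deq [A, B, X] [(1, \<sigma> B X), (0, ?a), (0, \<sigma> A B)] [(0, \<sigma> A B), (1, ?a)]" .
qed

text \<open>
  Both sides are the sum of the three terms in which \<open>X\<close> acts on \<open>A\<close>, on \<open>B\<close> or on \<open>E\<close>.  The object \<open>B \<otimes> E\<close>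
  counts as one factor on one side and as two on the other; \<open>\<iota>\<close> is the identity, regarded as the
  arrow that merges the factors, and \<open>[(1, \<iota>)]\<close> depicts the associator.
\<close>

lemma pact_assoc:
  assumes [simp]: "A \<in> Ob C" "B \<in> Ob C" "E \<in> Ob C" "X \<in> Ob C"
    and [simp]: "is_larr (act X A \<alpha>)" "is_larr (act X B \<beta>)" "is_larr (act X E \<gamma>)"
  defines "ab \<equiv> pact X A \<alpha> B \<beta>" and "be \<equiv> pact X B \<beta> E \<gamma>"
  defines "abe \<equiv> ([A, B, E, X], mor (pact X (A \<otimes> B) (mor ab) E \<gamma>), [A, B, E])"
  defines "\<iota> \<equiv> ([B, E], \<one> (B \<otimes> E), [B \<otimes> E])"
  shows "deq [A, B, E, X] [(0, abe), (1, \<iota>)] [(1, \<iota>), (0, pact X A \<alpha> (B \<otimes> E) (mor be))]"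
proof -
  let ?a = "act X A \<alpha>" and ?b = "act X B \<beta>" and ?e = "act X E \<gamma>"
    and ?be = "act X (B \<otimes> E) (mor be)" and ?ab = "act X (A \<otimes> B) (mor ab)"
  have [simp]: "src ab = [A, B, X]" "trg ab = [A, B]" "src be = [B, E, X]" "trg be = [B, E]"
    "is_larr ab" "is_larr be" "is_larr ?be" "is_larr ?ab"
    by (simp_all add: ab_def be_def)
  have ar_ab: "ar ?ab = ar ab" and ar_be: "ar ?be = ar be"
    by (simp_all add: ab_def be_def ar_act_pact)
  have [simp]: "src \<iota> = [B, E]" "trg \<iota> = [B \<otimes> E]" "src abe = [A, B, E, X]" "trg abe = [A, B, E]"
    by (simp_all add: \<iota>_def abe_def)
  have ar_\<iota>: "ar \<iota> = idm (B \<otimes> E)" by (simp add: ar_def \<iota>_def idm_def)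
  have [simp]: "is_larr \<iota>" by (simp add: is_larr_def[of \<iota>] ar_\<iota>)
  have "ar abe = ar (pact X (A \<otimes> B) (mor ab) E \<gamma>)"
    by (simp add: ar_def abe_def)
  also have "\<dots> = (idm (A \<otimes> B) \<diamond> ar ?e) \<bullet> asc (A \<otimes> B) E X
      \<boxplus> (ar ab \<diamond> idm E) \<bullet> asc' (A \<otimes> B) X E \<bullet> (idm (A \<otimes> B) \<diamond> br E X) \<bullet> asc (A \<otimes> B) E X"
    using pact_arr[of "A \<otimes> B" E X "mor ab" \<gamma>] ar_ab by simp
  finally have ar_abe: "ar abe = \<dots>" .
  have [simp]: "is_larr abe" by (simp add: is_larr_def[of abe] ar_abe)
  have s1: "dsum [A, B, E, X] [(0, abe)] [(2, ?e)] [(2, \<sigma> E X), (0, ab)]"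
    unfolding dsum_def by (auto intro!: larr_eqI simp: ar_abe)
  have s2: "dsum [A, B \<otimes> E, X] [(0, pact X A \<alpha> (B \<otimes> E) (mor be))] [(1, ?be)] [(1, \<sigma> (B \<otimes> E) X), (0, ?a)]"
    by (rule pact_dsum) simp_all
  have b: "deq [B, E, X] [(0, \<iota>), (0, ?be)] [(0, be), (0, \<iota>)]"
    unfolding deq_def by (auto intro!: larr_eqI simp: ar_\<iota> ar_be)
  have sb: "dsum [B, E, X] [(0, be)] [(1, ?e)] [(1, \<sigma> E X), (0, ?b)]"
    unfolding be_def by (rule pact_dsum) simp_all
  have sa: "dsum [A, B, X] [(0, ab)] [(1, ?b)] [(1, \<sigma> B X), (0, ?a)]"
    unfolding ab_def by (rule pact_dsum) simp_all
  have t3: "dsum [A, B, E, X] [(2, \<sigma> E X), (0, ab), (1, \<iota>)]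
      [(2, \<sigma> E X), (1, ?b), (1, \<iota>)] [(2, \<sigma> E X), (1, \<sigma> B X), (0, ?a), (1, \<iota>)]"
    by (rule dsum_rewrite[OF sa, where pre = "[(2, \<sigma> E X)]" and i = 0 and post = "[(1, \<iota>)]"]) simp_all
  have t1: "dsum [A, B, E, X] [(0, abe), (1, \<iota>)] [(2, ?e), (1, \<iota>)] [(2, \<sigma> E X), (0, ab), (1, \<iota>)]"
    by (rule dsum_rewrite[OF s1, where pre = "[]" and i = 0 and post = "[(1, \<iota>)]"]) simp_all
  have t2: "dsum [A, B, E, X] [(1, \<iota>), (0, pact X A \<alpha> (B \<otimes> E) (mor be))]
      [(1, be), (1, \<iota>)] [(2, \<sigma> E X), (1, \<sigma> B X), (0, ?a), (1, \<iota>)]"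
  proof (rule dsum_cong)
    show "dsum [A, B, E, X] [(1, \<iota>), (0, pact X A \<alpha> (B \<otimes> E) (mor be))]
      [(1, \<iota>), (1, ?be)] [(1, \<iota>), (1, \<sigma> (B \<otimes> E) X), (0, ?a)]"
      by (rule dsum_rewrite[OF s2, where pre = "[(1, \<iota>)]" and i = 0 and post = "[]"]) simp_all
    show "deq [A, B, E, X] [(1, \<iota>), (0, pact X A \<alpha> (B \<otimes> E) (mor be))]
      [(1, \<iota>), (0, pact X A \<alpha> (B \<otimes> E) (mor be))]"
      by (rule deq_refl) simp
    show "deq [A, B, E, X] [(1, \<iota>), (1, ?be)] [(1, be), (1, \<iota>)]"
      by (rule deq_rewrite[OF b, where pre = "[]" and i = 1 and post = "[]"]) simp_all
    show "deq [A, B, E, X] [(1, \<iota>), (1, \<sigma> (B \<otimes> E) X), (0, ?a)]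
        [(2, \<sigma> E X), (1, \<sigma> B X), (0, ?a), (1, \<iota>)]"
      by (rule deq_rewrite[OF move_left_nat[of \<iota> X], where pre = "[]" and i = 1 and post = "[(0, ?a)]"])
        simp_all
  qed
  have t4: "dsum [A, B, E, X] [(1, be), (1, \<iota>)] [(2, ?e), (1, \<iota>)] [(2, \<sigma> E X), (1, ?b), (1, \<iota>)]"
    by (rule dsum_rewrite[OF sb, where pre = "[]" and i = 1 and post = "[(1, \<iota>)]"]) simp_all
  show ?thesis
    by (rule dsum_assoc[OF t1 t3 t2 t4])
qed

lemma pact_map:
  assumes [simp]: "A \<in> Ob C" "B \<in> Ob C" "A' \<in> Ob C" "B' \<in> Ob C" "X \<in> Ob C"
    and [simp]: "is_larr (act X A \<alpha>)" "is_larr (act X B \<beta>)" "is_larr (act X A' \<alpha>')" "is_larr (act X B' \<beta>')"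
      "is_larr (gmap A f B)" "is_larr (gmap A' f' B')"
    and f: "deq [A, X] [(0, act X A \<alpha>), (0, gmap A f B)] [(0, gmap A f B), (0, act X B \<beta>)]"
    and f': "deq [A', X] [(0, act X A' \<alpha>'), (0, gmap A' f' B')] [(0, gmap A' f' B'), (0, act X B' \<beta>')]"
  shows "deq [A, A', X] [(0, pact X A \<alpha> A' \<alpha>'), (0, gmap A f B), (1, gmap A' f' B')]
    [(0, gmap A f B), (1, gmap A' f' B'), (0, pact X B \<beta> B' \<beta>')]"
proof (rule dsum_unique)
  let ?a = "act X A \<alpha>" and ?b = "act X B \<beta>" and ?a' = "act X A' \<alpha>'" and ?b' = "act X B' \<beta>'"
    and ?f = "gmap A f B" and ?f' = "gmap A' f' B'"
  show "dsum [A, A', X] [(0, pact X A \<alpha> A' \<alpha>'), (0, ?f), (1, ?f')]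
      [(1, ?a'), (0, ?f), (1, ?f')] [(1, \<sigma> A' X), (0, ?a), (0, ?f), (1, ?f')]"
    by (rule dsum_rewrite[OF pact_dsum, where pre = "[]" and i = 0 and post = "[(0, ?f), (1, ?f')]"])
      simp_all
  show "dsum [A, A', X] [(0, ?f), (1, ?f'), (0, pact X B \<beta> B' \<beta>')]
      [(0, ?f), (1, ?f'), (1, ?b')] [(0, ?f), (1, ?f'), (1, \<sigma> B' X), (0, ?b)]"
    by (rule dsum_rewrite[OF pact_dsum, where pre = "[(0, ?f), (1, ?f')]" and i = 0 and post = "[]"])
      simp_all
  show "deq [A, A', X] [(1, ?a'), (0, ?f), (1, ?f')] [(0, ?f), (1, ?f'), (1, ?b')]"
    by (rule deq_rewrite[OF f', where pre = "[(0, ?f)]" and i = 1 and post = "[]"]) simp_all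
  have "deq [A, A', X] [(1, \<sigma> A' X), (0, ?a), (0, ?f), (1, ?f')] [(1, \<sigma> A' X), (0, ?f), (0, ?b), (1, ?f')]"
    by (rule deq_rewrite[OF f, where pre = "[(1, \<sigma> A' X)]" and i = 0 and post = "[(1, ?f')]"]) simp_all
  also have "deq [A, A', X] \<dots> [(0, ?f), (1, ?f'), (1, \<sigma> B' X), (0, ?b)]"
    by (rule deq_rewrite[OF move_left_nat[of ?f' X, THEN deq_sym], where pre = "[(0, ?f)]" and i = 1
          and post = "[(0, ?b)]"]) simp_all
  finally show "deq [A, A', X] [(1, \<sigma> A' X), (0, ?a), (0, ?f), (1, ?f')]
      [(0, ?f), (1, ?f'), (1, \<sigma> B' X), (0, ?b)]" .
qed

end

section \<open>Morphisms of actions\<close>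

context linear_sym_monoidal_category
begin

text \<open>
  The axioms for zero concern scalars; since \<open>\<zero>\<close> is \<open>0 \<odot> \<zero>\<close>, bilinearity gives the absorption laws.
\<close>

lemma zero_comp:
  assumes "A \<in> Ob C" "B \<in> Ob C" "E \<in> Ob C" "f \<in> Hom C A B"
  shows "\<zero> B E \<cdot> f = \<zero> A E"
  using comp_scale_left[of A B E f "\<zero> B E" 0] assms by (simp add: zero_scale zero_in comp_in[of A B E])

lemma comp_zero:
  assumes "A \<in> Ob C" "B \<in> Ob C" "E \<in> Ob C" "g \<in> Hom C B E"
  shows "g \<cdot> \<zero> A B = \<zero> A E"
  using comp_scale_right[of A B E "\<zero> A B" g 0] assms by (simp add: zero_scale zero_in comp_in[of A B E])

lemma zero_tensor:
  assumes "A \<in> Ob C" "B \<in> Ob C" "A' \<in> Ob C" "B' \<in> Ob C" "f \<in> Hom C A' B'"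
  shows "\<zero> A B \<star> f = \<zero> (A \<otimes> A') (B \<otimes> B')" and "f \<star> \<zero> A B = \<zero> (A' \<otimes> A) (B' \<otimes> B)"
  using tensor_scale_left[of A B A' B' "\<zero> A B" f 0] tensor_scale_right[of A' B' A B f "\<zero> A B" 0] assms
    zero_scale[of "A \<otimes> A'" "B \<otimes> B'" "\<zero> A B \<star> f"] zero_scale[of "A' \<otimes> A" "B' \<otimes> B" "f \<star> \<zero> A B"]
    tensor_map_in[of A B A' B' "\<zero> A B" f] tensor_map_in[of A' B' A B f "\<zero> A B"]
  by (simp_all add: zero_scale zero_in)

lemma commuting_actions_iff: "(A, \<alpha>) \<in> commuting_actions C X \<longleftrightarrow> A \<in> Ob C \<and> \<alpha> \<in> Hom C (A \<otimes> X) A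
    \<and> \<alpha> \<cdot> (\<alpha> \<star> \<one> X) \<cdot> \<x> A X X = \<alpha> \<cdot> (\<alpha> \<star> \<one> X)"
  by (simp add: commuting_actions_def)

lemma act_Ob: "P \<in> commuting_actions C X \<Longrightarrow> fst P \<in> Ob C"
  by (auto simp: commuting_actions_def)

lemma action_map_Hom: "f \<in> action_maps C X P Q \<Longrightarrow> f \<in> Hom C (fst P) (fst Q)"
  by (cases P; cases Q) (auto simp: action_maps_def)

lemma fst_action_tensor [simp]: "fst (action_tensor C X P Q) = fst P \<otimes> fst Q"
  by (auto simp: action_tensor_def split: prod.splits)

context
  fixes X assumes X [simp]: "X \<in> Ob C"
begin

lemma action_is_larr:
  "P \<in> commuting_actions C X \<Longrightarrow> is_larr (act X (fst P) (snd P))"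
  by (cases P) (simp add: commuting_actions_iff is_larr_act)

lemma exch_in: "A \<in> Ob C \<Longrightarrow> B \<in> Ob C \<Longrightarrow> E \<in> Ob C \<Longrightarrow> \<x> A B E \<in> Hom C (A \<otimes> B \<otimes> E) (A \<otimes> E \<otimes> B)"
proof -
  assume [simp]: "A \<in> Ob C" "B \<in> Ob C" "E \<in> Ob C"
  have "is_arr (asc' A E B \<bullet> (idm A \<diamond> br B E) \<bullet> asc A B E)" by simp
  then show ?thesis using exch_arr[of A B E] by (simp add: is_arr_def del: is_arr_ob)
qed

lemma action_mapE:
  assumes "P \<in> commuting_actions C X" "Q \<in> commuting_actions C X" "f \<in> action_maps C X P Q"
  defines "F \<equiv> (fst P, f, fst Q)" and "a \<equiv> ar (act X (fst P) (snd P))" and "b \<equiv> ar (act X (fst Q) (snd Q))"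
  shows "is_arr F" "F \<bullet> a = b \<bullet> (F \<diamond> idm X)"
proof -
  have "F = ar (gmap (fst P) f (fst Q))" by (simp add: F_def gmap_def ar_def)
  then show "is_arr F" "F \<bullet> a = b \<bullet> (F \<diamond> idm X)"
    using action_map_arr[of "fst P" "fst Q" X "snd P" "snd Q" f] assms action_is_larr act_Ob
    by (simp_all del: ob_eval)
qed

lemma action_mapI_pair:
  assumes "is_arr F" "F \<bullet> ar (act X (fst P) (snd P)) = ar (act X (fst Q) (snd Q)) \<bullet> (F \<diamond> idm X)"
    "src F = fst P" "trg F = fst Q"
  shows "mor F \<in> action_maps C X P Q"
  using action_mapI[OF assms(1,2)] assms(3,4) by simp

lemma ident_action_map:
  assumes "P \<in> commuting_actions C X" shows "\<one> (fst P) \<in> action_maps C X P P"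
  using action_mapI_pair[of "idm (fst P)" P P] action_is_larr[OF assms] act_Ob[OF assms] by simp

lemma comp_action_map:
  assumes P: "P \<in> commuting_actions C X" "Q \<in> commuting_actions C X" "R \<in> commuting_actions C X"
    and fg: "f \<in> action_maps C X P Q" "g \<in> action_maps C X Q R"
  shows "g \<cdot> f \<in> action_maps C X P R"
proof -
  let ?F = "(fst P, f, fst Q)" and ?G = "(fst Q, g, fst R)"
  note [simp] = action_is_larr[OF P(1)] action_is_larr[OF P(2)] action_is_larr[OF P(3)]
    act_Ob[OF P(1)] act_Ob[OF P(2)] act_Ob[OF P(3)]
  note f = action_mapE[OF P(1,2) fg(1)] and g = action_mapE[OF P(2,3) fg(2)]
  have "mor (?G \<bullet> ?F) \<in> action_maps C X P R"
    using f g comp_reassoc[OF g(2), of "?F \<diamond> idm X"] tens_comp_right[of ?F ?G X]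
    by (intro action_mapI_pair) simp_all
  then show ?thesis by simp
qed

text \<open>
  With this, only one direction of each structural isomorphism needs a computation.
\<close>

lemma inverse_action_map:
  assumes P: "P \<in> commuting_actions C X" "Q \<in> commuting_actions C X"
    and f: "f \<in> action_maps C X P Q" and g: "g \<in> Hom C (fst Q) (fst P)"
    and inv: "g \<cdot> f = \<one> (fst P)" "f \<cdot> g = \<one> (fst Q)"
  shows "g \<in> action_maps C X Q P"
proof -
  let ?F = "(fst P, f, fst Q)" and ?G = "(fst Q, g, fst P)"
  let ?a = "ar (act X (fst P) (snd P))" and ?b = "ar (act X (fst Q) (snd Q))"
  note [simp] = action_is_larr[OF P(1)] action_is_larr[OF P(2)] act_Ob[OF P(1)] act_Ob[OF P(2)]
  note f = action_mapE[OF P f]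
  have [simp]: "is_arr ?F" "is_arr ?G" using f g by (simp_all add: is_arr_def)
  have inv: "?G \<bullet> ?F = idm (fst P)" "?F \<bullet> ?G = idm (fst Q)"
    by (auto intro!: arrow_eqI simp: inv)
  have FG: "(?F \<diamond> idm X) \<bullet> (?G \<diamond> idm X) = idm (fst Q \<otimes> X)"
    by (simp add: inv flip: tens_comp_right)
  have "?G \<bullet> ?b = ?G \<bullet> (?b \<bullet> (?F \<diamond> idm X)) \<bullet> (?G \<diamond> idm X)"
    by (simp add: FG)
  also have "\<dots> = ?a \<bullet> (?G \<diamond> idm X)"
    by (simp flip: f(2)) (simp add: inv comp_reassoc[OF inv(1)])
  finally have "mor ?G \<in> action_maps C X Q P"
    by (intro action_mapI_pair) simp_all
  then show ?thesis by simp
qed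

lemma tensor_action:
  assumes P: "P \<in> commuting_actions C X" "Q \<in> commuting_actions C X"
  shows "action_tensor C X P Q \<in> commuting_actions C X"
proof -
  obtain A \<alpha> B \<beta> where PQ: "P = (A, \<alpha>)" "Q = (B, \<beta>)" by (cases P; cases Q)
  note [simp] = action_is_larr[OF P(1), unfolded PQ fst_conv snd_conv]
    action_is_larr[OF P(2), unfolded PQ fst_conv snd_conv]
    act_Ob[OF P(1), unfolded PQ fst_conv] act_Ob[OF P(2), unfolded PQ fst_conv]
  have "mor (pact X A \<alpha> B \<beta>) \<in> Hom C (A \<otimes> B \<otimes> X) (A \<otimes> B)"
    by (rule is_larr_act[THEN iffD1, OF _ _ is_larr_act_pact]) simp_all
  then show ?thesis
    using pact_commuting_law[of A B X \<alpha> \<beta>] P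
    by (simp add: PQ action_tensor_eq commuting_actions_iff)
qed

lemma tensor_action_map:
  assumes P: "P \<in> commuting_actions C X" "Q \<in> commuting_actions C X"
      "P' \<in> commuting_actions C X" "Q' \<in> commuting_actions C X"
    and f: "f \<in> action_maps C X P Q" "f' \<in> action_maps C X P' Q'"
  shows "f \<star> f' \<in> action_maps C X (action_tensor C X P P') (action_tensor C X Q Q')"
proof -
  obtain A \<alpha> B \<beta> A' \<alpha>' B' \<beta>' where PQ: "P = (A, \<alpha>)" "Q = (B, \<beta>)" "P' = (A', \<alpha>')" "Q' = (B', \<beta>')"
    by (cases P; cases Q; cases P'; cases Q')
  note [simp] = P[THEN action_is_larr, unfolded PQ fst_conv snd_conv] P[THEN act_Ob, unfolded PQ fst_conv]
  let ?f = "gmap A f B" and ?f' = "gmap A' f' B'"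
  have 1: "is_larr ?f" "deq [A, X] [(0, act X A \<alpha>), (0, ?f)] [(0, ?f), (0, act X B \<beta>)]"
    "is_larr ?f'" "deq [A', X] [(0, act X A' \<alpha>'), (0, ?f')] [(0, ?f'), (0, act X B' \<beta>')]"
    using f by (simp_all only: PQ) (simp_all add: action_map_deq)
  note [simp] = 1(1,3)
  have "deq [A, A', X] [(0, pact X A \<alpha> A' \<alpha>'), (0, ?f), (1, ?f')]
    [(0, ?f), (1, ?f'), (0, pact X B \<beta> B' \<beta>')]"
    using 1 by (intro pact_map) simp_all
  note sq = this
  let ?T = "pact X A \<alpha> A' \<alpha>'" and ?T' = "pact X B \<beta> B' \<beta>'"
  have e1: "(lid [B] \<parallel> ?f') \<bullet> (?f \<parallel> lid [A']) = ?f \<parallel> ?f'"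
    and e2: "(lid [B] \<parallel> ?f' \<parallel> lid [X]) \<bullet> (?f \<parallel> lid [A', X]) = ?f \<parallel> ?f' \<parallel> lid [X]"
    by (simp_all flip: ltens_lcomp)
  have "(?f \<parallel> ?f') \<bullet> ?T = (lid [B] \<parallel> ?f') \<bullet> (?f \<parallel> lid [A']) \<bullet> ?T"
    by (simp add: lcomp_assoc flip: e1)
  also have "\<dots> = ?T' \<bullet> (lid [B] \<parallel> ?f' \<parallel> lid [X]) \<bullet> (?f \<parallel> lid [A', X])"
    using sq by (simp add: deq_def lcomp_assoc)
  also have "\<dots> = ?T' \<bullet> ((?f \<parallel> ?f') \<parallel> lid [X])"
    by (simp add: e2)
  finally have "(?f \<parallel> ?f') \<bullet> ?T = ?T' \<bullet> ((?f \<parallel> ?f') \<parallel> lid [X])" .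
  then have "ar ((?f \<parallel> ?f') \<bullet> pact X A \<alpha> A' \<alpha>')
      = ar (pact X B \<beta> B' \<beta>' \<bullet> ((?f \<parallel> ?f') \<parallel> lid [X]))"
    by (rule arg_cong)
  then have "(ar ?f \<diamond> ar ?f') \<bullet> ar (pact X A \<alpha> A' \<alpha>') = ar (pact X B \<beta> B' \<beta>') \<bullet> ((ar ?f \<diamond> ar ?f') \<diamond> idm X)"
    by (simp del: ltens_assoc)
  then have "mor (ar ?f \<diamond> ar ?f') \<in> action_maps C X (action_tensor C X P P') (action_tensor C X Q Q')"
    by (intro action_mapI_pair) (simp_all add: PQ action_tensor_eq ar_act_pact)
  then show ?thesis by simp
qed

lemma unit_action: "(\<I>, \<zero> (\<I> \<otimes> X) \<I>) \<in> commuting_actions C X"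
  using zero_comp[OF _ _ _ tensor_map_in[of "\<I> \<otimes> X" \<I> X X]]
    zero_comp[OF _ _ _ exch_in[of \<I> X X]]
  by (simp add: commuting_actions_iff zero_in ident_in)

lemma add_action_map:
  assumes P: "P \<in> commuting_actions C X" "Q \<in> commuting_actions C X"
    and fg: "f \<in> action_maps C X P Q" "g \<in> action_maps C X P Q"
  shows "f \<oplus> g \<in> action_maps C X P Q"
proof -
  let ?F = "(fst P, f, fst Q)" and ?G = "(fst P, g, fst Q)"
  note [simp] = P[THEN action_is_larr] P[THEN act_Ob]
  note f = action_mapE[OF P fg(1)] and g = action_mapE[OF P fg(2)]
  have "mor (?F \<boxplus> ?G) \<in> action_maps C X P Q"
    using f g by (intro action_mapI_pair) (simp_all add: add_arr_comp comp_arr_add add_arr_tens)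
  then show ?thesis by simp
qed

lemma zero_action_map:
  assumes P: "P \<in> commuting_actions C X" "Q \<in> commuting_actions C X"
  shows "\<zero> (fst P) (fst Q) \<in> action_maps C X P Q"
proof -
  obtain A \<alpha> B \<beta> where PQ: "P = (A, \<alpha>)" "Q = (B, \<beta>)" by (cases P; cases Q)
  have [simp]: "A \<in> Ob C" "B \<in> Ob C" "\<alpha> \<in> Hom C (A \<otimes> X) A" "\<beta> \<in> Hom C (B \<otimes> X) B"
    using P by (simp_all add: PQ commuting_actions_iff)
  have "\<zero> A B \<cdot> \<alpha> = \<zero> (A \<otimes> X) B" "\<beta> \<cdot> \<zero> (A \<otimes> X) (B \<otimes> X) = \<zero> (A \<otimes> X) B"
    by (rule zero_comp comp_zero; simp)+
  then show ?thesis
    using zero_tensor(1)[of A B X X "\<one> X"]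
    by (simp add: PQ action_maps_def zero_in ident_in)
qed

lemma scale_action_map:
  assumes P: "P \<in> commuting_actions C X" "Q \<in> commuting_actions C X" and f: "f \<in> action_maps C X P Q"
  shows "r \<odot> f \<in> action_maps C X P Q"
  using P f comp_scale_left[of "fst P \<otimes> X" "fst P" "fst Q" "snd P" f r]
    comp_scale_right[of "fst P \<otimes> X" "fst Q \<otimes> X" "fst Q" "f \<star> \<one> X" "snd Q" r]
    tensor_scale_left[of "fst P" "fst Q" X X f "\<one> X" r] tensor_map_in[of "fst P" "fst Q" X X f "\<one> X"]
  by (cases P; cases Q) (simp add: commuting_actions_iff action_maps_def scale_in ident_in)

lemma symm_action_map:
  assumes P: "P \<in> commuting_actions C X" "Q \<in> commuting_actions C X"
  shows "\<s> (fst P) (fst Q) \<in> action_maps C X (action_tensor C X P Q) (action_tensor C X Q P)"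
proof -
  obtain A \<alpha> B \<beta> where PQ: "P = (A, \<alpha>)" "Q = (B, \<beta>)" by (cases P; cases Q)
  note [simp] = P[THEN action_is_larr, unfolded PQ fst_conv snd_conv] P[THEN act_Ob, unfolded PQ fst_conv]
  have "ar (ev [A, B, X] [(0, pact X A \<alpha> B \<beta>), (0, \<sigma> A B)]) = ar (ev [A, B, X] [(0, \<sigma> A B), (0, pact X B \<beta> A \<alpha>)])"
    using pact_swap[of A B X \<alpha> \<beta>] by (simp add: deq_def)
  then have "mor (br A B) \<in> action_maps C X (action_tensor C X P Q) (action_tensor C X Q P)"
    by (intro action_mapI_pair) (simp_all add: PQ action_tensor_eq ar_act_pact)
  then show ?thesis by (simp add: PQ)
qed

lemma assoc_action_map:
  assumes P: "P \<in> commuting_actions C X" "Q \<in> commuting_actions C X" "R \<in> commuting_actions C X"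
  shows "\<a> (fst P) (fst Q) (fst R) \<in> action_maps C X (action_tensor C X (action_tensor C X P Q) R)
    (action_tensor C X P (action_tensor C X Q R))"
proof -
  obtain A \<alpha> B \<beta> E \<gamma> where PQ: "P = (A, \<alpha>)" "Q = (B, \<beta>)" "R = (E, \<gamma>)" by (cases P; cases Q; cases R)
  note [simp] = P[THEN action_is_larr, unfolded PQ fst_conv snd_conv] P[THEN act_Ob, unfolded PQ fst_conv]
  let ?abe = "pact X (A \<otimes> B) (mor (pact X A \<alpha> B \<beta>)) E \<gamma>"
  let ?abe' = "([A, B, E, X], mor ?abe, [A, B, E])" and ?\<iota> = "([B, E], \<one> (B \<otimes> E), [B \<otimes> E])"
  let ?w = "pact X A \<alpha> (B \<otimes> E) (mor (pact X B \<beta> E \<gamma>))"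
  have ar_\<iota>: "ar ?\<iota> = idm (B \<otimes> E)" by (simp add: ar_def idm_def)
  have [simp]: "is_larr ?\<iota>" by (simp add: is_larr_def[of ?\<iota>] ar_\<iota>)
  have ar_abe: "ar ?abe' = ar ?abe" by (simp add: ar_def)
  have "is_larr ?abe" by simp
  then have [simp]: "is_larr ?abe'"
    unfolding is_larr_def[of ?abe'] ar_abe using is_larrD(3) by simp
  have "ar (ev [A, B, E, X] [(0, ?abe'), (1, ?\<iota>)]) = ar (ev [A, B, E, X] [(1, ?\<iota>), (0, ?w)])"
    using pact_assoc[of A B E X \<alpha> \<beta> \<gamma>] by (simp add: deq_def)
  moreover have "lid [A] \<parallel> ?\<iota> \<parallel> lid [X] = (lid [A] \<parallel> ?\<iota>) \<parallel> lid [X]"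
    by simp
  ultimately have "asc A B E \<bullet> ar ?abe = ar ?w \<bullet> (asc A B E \<diamond> idm X)"
    by (simp add: ar_abe ar_\<iota> del: ltens_assoc)
  then have "mor (asc A B E) \<in> action_maps C X (action_tensor C X (action_tensor C X P Q) R)
    (action_tensor C X P (action_tensor C X Q R))"
    by (intro action_mapI_pair) (simp_all add: PQ action_tensor_eq ar_act_pact)
  then show ?thesis by (simp add: PQ)
qed

text \<open>
  As the action on the unit is zero, only one summand remains, and what is left is a coherence law of
  the unit; similarly for the right unitor.
\<close>

lemma lunit_action_map:
  assumes P: "P \<in> commuting_actions C X"
  shows "\<l> (fst P) \<in> action_maps C X (action_tensor C X (\<I>, \<zero> (\<I> \<otimes> X) \<I>) P) P"
proof -
  obtain A \<alpha> where PQ: "P = (A, \<alpha>)" by (cases P)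
  note [simp] = P[THEN action_is_larr, unfolded PQ fst_conv snd_conv] P[THEN act_Ob, unfolded PQ fst_conv]
    unit_action[THEN action_is_larr, unfolded PQ fst_conv snd_conv]
  let ?t = "ar (act X A \<alpha>)"
  have "(\<zero> (\<I> \<otimes> X) \<I> \<star> \<one> A) \<cdot> \<x> \<I> A X = \<zero> (\<I> \<otimes> A \<otimes> X) (\<I> \<otimes> A)"
    using zero_tensor(1)[of "\<I> \<otimes> X" \<I> A A "\<one> A"] zero_comp[OF _ _ _ exch_in[of \<I> A X], of "\<I> \<otimes> A"]
    by (simp add: ident_in)
  moreover have "is_arr ((idm \<I> \<diamond> ?t) \<bullet> asc \<I> A X)" by simp
  then have "(\<one> \<I> \<star> \<alpha>) \<cdot> \<a> \<I> A X \<in> Hom C (\<I> \<otimes> A \<otimes> X) (\<I> \<otimes> A)"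
    by (simp add: is_arr_def del: is_arr_ob)
  ultimately have "ar (pact X \<I> (\<zero> (\<I> \<otimes> X) \<I>) A \<alpha>) = (idm \<I> \<diamond> ?t) \<bullet> asc \<I> A X"
    by (intro arrow_eqI) (simp_all add: mor_pact add_zero)
  then have "lu A \<bullet> ar (pact X \<I> (\<zero> (\<I> \<otimes> X) \<I>) A \<alpha>) = ?t \<bullet> (lu A \<diamond> idm X)"
    using comp_reassoc[OF lu_nat[of ?t], of "asc \<I> A X"] by (simp add: lu_tens)
  then have "mor (lu A) \<in> action_maps C X (action_tensor C X (\<I>, \<zero> (\<I> \<otimes> X) \<I>) P) P"
    by (intro action_mapI_pair) (simp_all add: PQ action_tensor_eq ar_act_pact)
  then show ?thesis by (simp add: PQ)
qed

lemma runit_action_map: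
  assumes P: "P \<in> commuting_actions C X"
  shows "\<r> (fst P) \<in> action_maps C X (action_tensor C X P (\<I>, \<zero> (\<I> \<otimes> X) \<I>)) P"
proof -
  obtain A \<alpha> where PQ: "P = (A, \<alpha>)" by (cases P)
  note [simp] = P[THEN action_is_larr, unfolded PQ fst_conv snd_conv] P[THEN act_Ob, unfolded PQ fst_conv]
    unit_action[THEN action_is_larr, unfolded PQ fst_conv snd_conv]
  let ?t = "ar (act X A \<alpha>)" and ?x = "asc' A X \<I> \<bullet> (idm A \<diamond> br \<I> X) \<bullet> asc A \<I> X"
  have 0: "(\<one> A \<star> \<zero> (\<I> \<otimes> X) \<I>) \<cdot> \<a> A \<I> X = \<zero> (A \<otimes> \<I> \<otimes> X) (A \<otimes> \<I>)"
    using zero_tensor(2)[of "\<I> \<otimes> X" \<I> A A "\<one> A"] zero_comp[OF _ _ _ assoc_in[of A \<I> X], of "A \<otimes> \<I>"]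
    by (simp add: ident_in)
  have "is_arr ((?t \<diamond> idm \<I>) \<bullet> ?x)" by simp
  then have 1: "(\<alpha> \<star> \<one> \<I>) \<cdot> \<x> A \<I> X \<in> Hom C (A \<otimes> \<I> \<otimes> X) (A \<otimes> \<I>)"
    using exch_arr[of A \<I> X] by (simp add: is_arr_def del: is_arr_ob)
  have "ar (pact X A \<alpha> \<I> (\<zero> (\<I> \<otimes> X) \<I>)) = (?t \<diamond> idm \<I>) \<bullet> ?x"
    using exch_arr[of A \<I> X] 1 add_zero[OF _ _ 1] add_commute[OF _ _ 1 zero_in]
    by (intro arrow_eqI) (simp_all add: mor_pact 0)
  then have "ru A \<bullet> ar (pact X A \<alpha> \<I> (\<zero> (\<I> \<otimes> X) \<I>)) = ?t \<bullet> ru (A \<otimes> X) \<bullet> ?x"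
    using comp_reassoc[OF ru_nat[of ?t], of ?x] by simp
  also have "ru (A \<otimes> X) \<bullet> ?x = (idm A \<diamond> ru X) \<bullet> (idm A \<diamond> br \<I> X) \<bullet> asc A \<I> X"
    by (simp flip: ru_tens)
  also have "\<dots> = (idm A \<diamond> (ru X \<bullet> br \<I> X)) \<bullet> asc A \<I> X"
    by (simp add: tens_comp_left)
  also have "ru X \<bullet> br \<I> X = lu X"
    by (simp flip: lu_br)
  also have "(idm A \<diamond> lu X) \<bullet> asc A \<I> X = ru A \<diamond> idm X"
    by (simp add: triangle_arr)
  finally have "mor (ru A) \<in> action_maps C X (action_tensor C X P (\<I>, \<zero> (\<I> \<otimes> X) \<I>)) P"
    by (intro action_mapI_pair) (simp_all add: PQ action_tensor_eq ar_act_pact)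
  then show ?thesis by (simp add: PQ)
qed

end

end

section \<open>The structural maps of the modality are morphisms of actions\<close>

context differential_modality
begin

context
  fixes X assumes X [simp]: "X \<in> Ob C"
begin

abbreviation (input) "bng P \<equiv> (\<B> (fst P), bang_action C D X (fst P) (snd P))"

lemma is_larr_bang_act [simp]:
  "P \<in> commuting_actions C X \<Longrightarrow> is_larr (act X (\<B> (fst P)) (bang_action C D X (fst P) (snd P)))"
  by (rule is_larr_bang_action) (auto simp: act_Ob action_is_larr)

lemma bang_commuting_action:
  assumes P: "P \<in> commuting_actions C X"
  shows "bng P \<in> commuting_actions C X"
proof -
  obtain A \<alpha> where PQ: "P = (A, \<alpha>)" by (cases P)
  note [simp] = P[THEN action_is_larr[OF X], unfolded PQ fst_conv snd_conv] P[THEN act_Ob, unfolded PQ fst_conv]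
    P[THEN is_larr_bang_act, unfolded PQ fst_conv snd_conv]
  have "deq [A, X, X] [(1, \<sigma> X X), (0, act X A \<alpha>), (0, act X A \<alpha>)] [(0, act X A \<alpha>), (0, act X A \<alpha>)]"
    by (rule commuting_deq[THEN iffD2]) (use P in \<open>simp_all add: PQ commuting_actions_iff\<close>)
  note bang_action_commuting[OF _ _ _ this]
  then show ?thesis
    using is_larr_act[of "\<B> A" X "bang_action C D X A \<alpha>"]
      commuting_deq[of "\<B> A" X "bang_action C D X A \<alpha>"]
    by (simp add: PQ commuting_actions_iff)
qed

lemma counit_action_map:
  assumes P: "P \<in> commuting_actions C X"
  shows "counit D (fst P) \<in> action_maps C X (bng P) P"
proof -
  obtain A \<alpha> where PQ: "P = (A, \<alpha>)" by (cases P)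
  note [simp] = P[THEN action_is_larr[OF X], unfolded PQ fst_conv snd_conv] P[THEN act_Ob, unfolded PQ fst_conv]
    P[THEN is_larr_bang_act, unfolded PQ fst_conv snd_conv]
  have "gmap (\<B> A) (counit D A) A = cou A" by (simp add: gmap_def cou_def)
  then show ?thesis
    using bang_action_counit[of A X \<alpha>] by (simp add: PQ action_map_deq)
qed

lemma comult_action_map:
  assumes P: "P \<in> commuting_actions C X"
  shows "comult D (fst P) \<in> action_maps C X (bng P) (bng (bng P))"
proof -
  obtain A \<alpha> where PQ: "P = (A, \<alpha>)" by (cases P)
  note [simp] = P[THEN action_is_larr[OF X], unfolded PQ fst_conv snd_conv] P[THEN act_Ob, unfolded PQ fst_conv]
    P[THEN is_larr_bang_act, unfolded PQ fst_conv snd_conv]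
    bang_commuting_action[OF P, THEN is_larr_bang_act, unfolded PQ fst_conv snd_conv]
  have "gmap (\<B> A) (comult D A) (\<B> (\<B> A)) = com A" by (simp add: gmap_def com_def)
  then show ?thesis
    using bang_action_comult[of A X \<alpha>] by (simp add: PQ action_map_deq)
qed

lemma discard_action_map:
  assumes P: "P \<in> commuting_actions C X"
  shows "discard D (fst P) \<in> action_maps C X (bng P) (\<I>, \<zero> (\<I> \<otimes> X) \<I>)"
proof -
  obtain A \<alpha> where PQ: "P = (A, \<alpha>)" by (cases P)
  note [simp] = P[THEN action_is_larr[OF X], unfolded PQ fst_conv snd_conv] P[THEN act_Ob, unfolded PQ fst_conv]
    P[THEN is_larr_bang_act, unfolded PQ fst_conv snd_conv]
  let ?k = "(idm (\<B> A) \<diamond> ar (act X A \<alpha>)) \<bullet> asc (\<B> A) A X \<bullet> (ar (bor A) \<diamond> idm X)"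
  have k: "mor ?k \<in> Hom C (\<B> A \<otimes> X) (\<B> A \<otimes> A)"
  proof -
    have "is_arr ?k" by simp
    then show ?thesis by (simp add: is_arr_def del: is_arr_ob)
  qed
  have "ar (dis A) \<bullet> ar (act X (\<B> A) (bang_action C D X A \<alpha>)) = (ar (dis A) \<bullet> ar (der A)) \<bullet> ?k"
    by (simp add: bang_action_arr)
  then have "mor (ar (dis A) \<bullet> ar (act X (\<B> A) (bang_action C D X A \<alpha>)))
      = mor ((ar (dis A) \<bullet> ar (der A)) \<bullet> ?k)"
    by (rule arg_cong)
  also have "\<dots> = \<zero> (\<B> A \<otimes> A) \<I> \<cdot> mor ?k"
    using constant_rule[of A] by (simp del: comp_arr_assoc)
  also have "\<dots> = \<zero> (\<B> A \<otimes> X) \<I>"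
    using k by (intro zero_comp) simp_all
  finally have "discard D A \<cdot> bang_action C D X A \<alpha> = \<zero> (\<B> A \<otimes> X) \<I>" by simp
  moreover have "\<zero> (\<I> \<otimes> X) \<I> \<cdot> (discard D A \<star> \<one> X) = \<zero> (\<B> A \<otimes> X) \<I>"
    by (rule zero_comp) (simp_all add: tensor_map_in discard_in ident_in)
  ultimately show ?thesis by (simp add: PQ action_maps_def discard_in)
qed

lemma copy_action_map:
  assumes P: "P \<in> commuting_actions C X"
  shows "copy D (fst P) \<in> action_maps C X (bng P) (action_tensor C X (bng P) (bng P))"
proof -
  obtain A \<alpha> where PQ: "P = (A, \<alpha>)" by (cases P)
  note [simp] = P[THEN action_is_larr[OF X], unfolded PQ fst_conv snd_conv] P[THEN act_Ob, unfolded PQ fst_conv]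
    P[THEN is_larr_bang_act, unfolded PQ fst_conv snd_conv]
  let ?\<beta> = "bang_action C D X A \<alpha>"
  let ?T = "pact X (\<B> A) ?\<beta> (\<B> A) ?\<beta>" and ?b = "act X (\<B> A) ?\<beta>"
  have "dsum [\<B> A, X] [(0, cop A), (0, ?T)] [(0, cop A), (1, ?b)] [(0, cop A), (1, \<sigma> (\<B> A) X), (0, ?b)]"
    by (rule dsum_rewrite[OF pact_dsum, where pre = "[(0, cop A)]" and i = 0 and post = "[]"]) simp_all
  with bang_action_copy[of A X \<alpha>] have "deq [\<B> A, X] [(0, ?b), (0, cop A)] [(0, cop A), (0, ?T)]"
    by (rule dsum_unique) (auto intro!: deq_refl)
  then have "ar (ev [\<B> A, X] [(0, ?b), (0, cop A)]) = ar (ev [\<B> A, X] [(0, cop A), (0, ?T)])"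
    by (simp add: deq_def)
  then have "mor (ar (cop A)) \<in> action_maps C X (bng P) (action_tensor C X (bng P) (bng P))"
    by (intro action_mapI_pair) (simp_all add: PQ action_tensor_eq ar_act_pact)
  then show ?thesis by (simp add: PQ)
qed

lemma deriving_action_map:
  assumes P: "P \<in> commuting_actions C X"
  shows "deriving D (fst P) \<in> action_maps C X (action_tensor C X (bng P) P) (bng P)"
proof -
  obtain A \<alpha> where PQ: "P = (A, \<alpha>)" by (cases P)
  note [simp] = P[THEN action_is_larr[OF X], unfolded PQ fst_conv snd_conv] P[THEN act_Ob, unfolded PQ fst_conv]
    P[THEN is_larr_bang_act, unfolded PQ fst_conv snd_conv]
  let ?\<beta> = "bang_action C D X A \<alpha>" and ?t = "act X A \<alpha>"
  let ?T = "pact X (\<B> A) ?\<beta> A \<alpha>" and ?b = "act X (\<B> A) ?\<beta>"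
  have "dsum [\<B> A, A, X] [(0, ?T), (0, der A)] [(1, ?t), (0, der A)] [(1, \<sigma> A X), (0, ?b), (0, der A)]"
    by (rule dsum_rewrite[OF pact_dsum, where pre = "[]" and i = 0 and post = "[(0, der A)]"]) simp_all
  then have "deq [\<B> A, A, X] [(0, ?T), (0, der A)] [(0, der A), (0, ?b)]"
    by (rule dsum_unique[OF _ bang_action_deriving]) (auto intro!: deq_refl)
  then have "ar (ev [\<B> A, A, X] [(0, ?T), (0, der A)]) = ar (ev [\<B> A, A, X] [(0, der A), (0, ?b)])"
    by (simp add: deq_def)
  then have "mor (ar (der A)) \<in> action_maps C X (action_tensor C X (bng P) P) (bng P)"
    by (intro action_mapI_pair) (simp_all add: PQ action_tensor_eq ar_act_pact)
  then show ?thesis by (simp add: PQ)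
qed

lemma bang_map_action_map:
  assumes P: "P \<in> commuting_actions C X" "Q \<in> commuting_actions C X" and f: "f \<in> action_maps C X P Q"
  shows "bang_map D f \<in> action_maps C X (bng P) (bng Q)"
proof -
  obtain A \<alpha> B \<beta> where PQ: "P = (A, \<alpha>)" "Q = (B, \<beta>)" by (cases P; cases Q)
  note [simp] = P[THEN action_is_larr[OF X], unfolded PQ fst_conv snd_conv] P[THEN act_Ob, unfolded PQ fst_conv]
    P[THEN is_larr_bang_act, unfolded PQ fst_conv snd_conv]
  let ?a = "act X A \<alpha>" and ?b = "act X B \<beta>" and ?f = "gmap A f B" and ?F = "gmap (\<B> A) (bang_map D f) (\<B> B)"
  let ?aa = "act X (\<B> A) (bang_action C D X A \<alpha>)" and ?bb = "act X (\<B> B) (bang_action C D X B \<beta>)"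
  have [simp]: "is_larr ?f" and rf: "deq [A, X] [(0, ?a), (0, ?f)] [(0, ?f), (0, ?b)]"
    using f by (simp_all only: PQ) (simp_all add: action_map_deq)
  have fin: "f \<in> Hom C A B" using is_larr_gmap[of A B f] by simp
  have [simp]: "is_larr ?F" using bang_map_in[OF _ _ fin] by (subst is_larr_gmap) simp_all
  have d: "deq [\<B> A, A] [(0, ?F), (1, ?f), (0, der B)] [(0, der A), (0, ?F)]"
  proof -
    have "ar (der B) \<bullet> (ar ?F \<diamond> ar ?f) = ar ?F \<bullet> ar (der A)"
      using deriving_natural[OF _ _ fin] by (intro arrow_eqI) simp_all
    moreover have "ar ?F \<diamond> ar ?f = (idm (\<B> B) \<diamond> ar ?f) \<bullet> (ar ?F \<diamond> idm A)"
      by (simp flip: tens_comp)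
    ultimately show ?thesis
      unfolding deq_def by (auto intro!: larr_eqI)
  qed
  have b: "deq [\<B> A] [(0, ?F), (0, bor B)] [(0, bor A), (0, ?F), (1, ?f)]"
  proof -
    have "ar (cop B) \<bullet> ar ?F = (ar ?F \<diamond> ar ?F) \<bullet> ar (cop A)"
      using copy_natural[OF _ _ fin] by (intro arrow_eqI) simp_all
    moreover have c: "ar (cou B) \<bullet> ar ?F = ar ?f \<bullet> ar (cou A)"
      using counit_natural[OF _ _ fin] by (intro arrow_eqI) simp_all
    have "(idm (\<B> B) \<diamond> ar (cou B)) \<bullet> (ar ?F \<diamond> ar ?F)
        = (idm (\<B> B) \<diamond> ar ?f) \<bullet> (ar ?F \<diamond> idm A) \<bullet> (idm (\<B> A) \<diamond> ar (cou A))"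
      by (simp add: c flip: tens_comp)
    from comp_reassoc[OF this, of "ar (cop A)"] have "(idm (\<B> B) \<diamond> ar (cou B)) \<bullet> (ar ?F \<diamond> ar ?F) \<bullet> ar (cop A)
        = (idm (\<B> B) \<diamond> ar ?f) \<bullet> (ar ?F \<diamond> idm A) \<bullet> (idm (\<B> A) \<diamond> ar (cou A)) \<bullet> ar (cop A)"
      by simp
    ultimately show ?thesis
      unfolding deq_def by (auto intro!: larr_eqI simp: borrow_arr)
  qed
  have "deq [\<B> A, X] [(0, ?aa), (0, ?F)] [(0, bor A), (1, ?a), (0, der A), (0, ?F)]"
    by (rule deq_rewrite[OF bang_action_deq, where pre = "[]" and i = 0 and post = "[(0, ?F)]"]) simp_all
  also have "deq [\<B> A, X] \<dots> [(0, bor A), (0, ?F), (1, ?a), (1, ?f), (0, der B)]"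
    by (rule deq_rewrite[OF d[THEN deq_sym], where pre = "[(0, bor A), (1, ?a)]" and i = 0 and post = "[]"])
      simp_all
  also have "deq [\<B> A, X] \<dots> [(0, bor A), (0, ?F), (1, ?f), (1, ?b), (0, der B)]"
    by (rule deq_rewrite[OF rf, where pre = "[(0, bor A), (0, ?F)]" and i = 1 and post = "[(0, der B)]"])
      simp_all
  also have "deq [\<B> A, X] \<dots> [(0, ?F), (0, bor B), (1, ?b), (0, der B)]"
    by (rule deq_rewrite[OF b[THEN deq_sym], where pre = "[]" and i = 0 and post = "[(1, ?b), (0, der B)]"])
      simp_all
  also have "deq [\<B> A, X] \<dots> [(0, ?F), (0, ?bb)]"
    by (rule deq_rewrite[OF bang_action_deq[THEN deq_sym], where pre = "[(0, ?F)]" and i = 0 and post = "[]"])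
      simp_all
  finally show ?thesis
    by (simp add: PQ action_map_deq)
qed

end

end

section \<open>The lifted differential modality\<close>

text \<open>
  Written with projections, the structure of \<open>CAct C X\<close> visibly lies over that of \<open>C\<close>.
\<close>

lemma CAct_sel [simp]:
  "Ob (CAct C X) = commuting_actions C X"
  "Hom (CAct C X) = action_maps C X"
  "\<one>\<^bsub>CAct C X\<^esub> P = \<one>\<^bsub>C\<^esub> (fst P)"
  "compose (CAct C X) = compose C"
  "tensor_ob (CAct C X) = action_tensor C X"
  "tensor_map (CAct C X) = tensor_map C"
  "\<I>\<^bsub>CAct C X\<^esub> = (\<I>\<^bsub>C\<^esub>, \<zero>\<^bsub>C\<^esub> (\<I>\<^bsub>C\<^esub> \<otimes>\<^bsub>C\<^esub> X) \<I>\<^bsub>C\<^esub>)"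
  "\<a>\<^bsub>CAct C X\<^esub> P Q R = \<a>\<^bsub>C\<^esub> (fst P) (fst Q) (fst R)"
  "\<a>\<i>\<^bsub>CAct C X\<^esub> P Q R = \<a>\<i>\<^bsub>C\<^esub> (fst P) (fst Q) (fst R)"
  "\<l>\<^bsub>CAct C X\<^esub> P = \<l>\<^bsub>C\<^esub> (fst P)"
  "\<l>\<i>\<^bsub>CAct C X\<^esub> P = \<l>\<i>\<^bsub>C\<^esub> (fst P)"
  "\<r>\<^bsub>CAct C X\<^esub> P = \<r>\<^bsub>C\<^esub> (fst P)"
  "\<r>\<i>\<^bsub>CAct C X\<^esub> P = \<r>\<i>\<^bsub>C\<^esub> (fst P)"
  "\<s>\<^bsub>CAct C X\<^esub> P Q = \<s>\<^bsub>C\<^esub> (fst P) (fst Q)"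
  "add_map (CAct C X) = add_map C"
  "\<zero>\<^bsub>CAct C X\<^esub> P Q = \<zero>\<^bsub>C\<^esub> (fst P) (fst Q)"
  "scale_map (CAct C X) = scale_map C"
  by (simp_all add: CAct_def split_beta)

lemma lifted_modality_sel [simp]:
  "bang (lifted_modality C D X) P = (bang D (fst P), bang_action C D X (fst P) (snd P))"
  "bang_map (lifted_modality C D X) = bang_map D"
  "counit (lifted_modality C D X) P = counit D (fst P)"
  "comult (lifted_modality C D X) P = comult D (fst P)"
  "discard (lifted_modality C D X) P = discard D (fst P)"
  "copy (lifted_modality C D X) P = copy D (fst P)"
  "deriving (lifted_modality C D X) P = deriving D (fst P)"
  by (simp_all add: lifted_modality_def split_beta)

context linear_sym_monoidal_category
begin

context
  fixes X assumes X [simp]: "X \<in> Ob C"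
begin

lemma assoc_inv_action_map:
  assumes P: "P \<in> commuting_actions C X" "Q \<in> commuting_actions C X" "R \<in> commuting_actions C X"
  shows "\<a>\<i> (fst P) (fst Q) (fst R) \<in> action_maps C X (action_tensor C X P (action_tensor C X Q R))
    (action_tensor C X (action_tensor C X P Q) R)"
  by (rule inverse_action_map[OF X _ _ assoc_action_map[OF X P]])
    (use P[THEN act_Ob] P in \<open>simp_all add: tensor_action assoc_inv_in assoc_inv_left assoc_inv_right\<close>)

lemma lunit_inv_action_map:
  assumes P: "P \<in> commuting_actions C X"
  shows "\<l>\<i> (fst P) \<in> action_maps C X P (action_tensor C X (\<I>, \<zero> (\<I> \<otimes> X) \<I>) P)"
  by (rule inverse_action_map[OF X _ _ lunit_action_map[OF X P]])
    (use P[THEN act_Ob] P in \<open>simp_all add: tensor_action unit_action lunit_inv_in lunit_inv_left lunit_inv_right\<close>)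

lemma runit_inv_action_map:
  assumes P: "P \<in> commuting_actions C X"
  shows "\<r>\<i> (fst P) \<in> action_maps C X P (action_tensor C X P (\<I>, \<zero> (\<I> \<otimes> X) \<I>))"
  by (rule inverse_action_map[OF X _ _ runit_action_map[OF X P]])
    (use P[THEN act_Ob] P in \<open>simp_all add: tensor_action unit_action runit_inv_in runit_inv_left runit_inv_right\<close>)

end

end

lemma CAct_linear:
  fixes C :: "('o, 'm, 'k :: {comm_semiring_0, comm_monoid_mult}) linear_smc"
  assumes "linear_sym_monoidal_category C" and X: "X \<in> Ob C"
  shows "linear_sym_monoidal_category (CAct C X)"
proof -
  interpret linear_sym_monoidal_category C by fact
  note am = ident_action_map[OF X] comp_action_map[OF X] tensor_action[OF X] tensor_action_map[OF X]
    unit_action[OF X] assoc_action_map[OF X] assoc_inv_action_map[OF X] lunit_action_map[OF X]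
    lunit_inv_action_map[OF X] runit_action_map[OF X] runit_inv_action_map[OF X] symm_action_map[OF X]
    add_action_map[OF X] zero_action_map[OF X] scale_action_map[OF X]
  note eq = assoc_inv_left assoc_inv_right lunit_inv_left lunit_inv_right runit_inv_left
    runit_inv_right pentagon triangle symm_symm hexagon tensor_ident
  note eq2 = comp_ident_right comp_ident_left comp_assoc
    tensor_comp assoc_natural lunit_natural runit_natural symm_natural
    add_assoc add_commute add_zero scale_add scale_zero add_scale zero_scale mult_scale one_scale
    comp_add_left comp_add_right comp_scale_left comp_scale_right tensor_add_left tensor_add_right
    tensor_scale_left tensor_scale_right
  \<comment> \<open>Typing obligations are closure properties of morphisms of actions; equations hold in \<open>C\<close>.\<close>
  show ?thesis
    by unfold_locales
      (simp_all add: am act_Ob eq del: ob_eval, (blast intro: am eq2 dest: act_Ob action_map_Hom)+)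
qed

theorem proposition40:
  fixes C :: "('o, 'm, 'k :: {comm_semiring_0, comm_monoid_mult}) linear_smc"
    and D :: "('o, 'm) modality" and X :: 'o
  assumes "linear_sym_monoidal_category C"
    and "differential_modality C D"
    and "X \<in> Ob C"
  shows "linear_sym_monoidal_category (CAct C X) \<and>
    differential_modality (CAct C X) (lifted_modality C D X)"
proof
  show lin: "linear_sym_monoidal_category (CAct C X)"
    by (rule CAct_linear[OF assms(1,3)])
  interpret A: linear_sym_monoidal_category "CAct C X" by (rule lin)
  interpret differential_modality C D by fact
  note X = assms(3)
  note am = bang_commuting_action[OF X] bang_map_action_map[OF X] counit_action_map[OF X]
    comult_action_map[OF X] discard_action_map[OF X] copy_action_map[OF X] deriving_action_map[OF X]
  note am' = am[simplified fst_conv snd_conv]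
  have x: "\<x>\<^bsub>CAct C X\<^esub> P Q R = \<x>\<^bsub>C\<^esub> (fst P) (fst Q) (fst R)" for P Q R
    by (simp add: exch_def)
  note eq = comonad_unit_left comonad_unit_right comonad_assoc
    comonoid_assoc comonoid_unit_left comonoid_unit_right comonoid_commute comult_discard comult_copy
    constant_rule product_rule linear_rule chain_rule interchange_rule bang_ident
  note eq2 = bang_comp counit_natural comult_natural discard_natural copy_natural deriving_natural
  show "differential_modality (CAct C X) (lifted_modality C D X)"
    by unfold_locales
      (simp_all add: am am' act_Ob eq x del: ob_eval,
        (blast intro: am am' eq2 dest: act_Ob action_map_Hom)+)
qed

end
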